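(* (Ganea Sequence) Let $Z$ be a central ideal in a finite-dimensional Leibniz algebra $L$. Then the sequence \[L/L'\otimes Z\oplus Z\otimes L/L'\xrightarrow{\overline{\theta}} M(L)\xrightarrow{\beta} M(L/Z)\xrightarrow{\gamma} L'\cap Z\to 0\] (with the maps described in the context) is exact.
   Context: A (left) Leibniz algebra over a field $\mathbb{F}$ is an $\mathbb{F}$-vector space with a bilinear multiplication satisfying $x(yz)=(xy)z+y(xz)$. $L'$ is the span of all products in $L$; $Z(L)=\{z: zx=xz=0\ \forall x\in L\}$; a central ideal is an ideal contained in $Z(L)$. Multiplier: a pair $(K,M)$ is a defining pair for $L$ if $L\cong K/M$ and $M\subseteq Z(K)\cap K'$; it is maximal if $\dim K$ is maximal, and then $M=M(L)$ is the multiplier of $L$. It is known that for finite-dimensional $L$ and any free presentation $0\to R\to F\to L\to0$ ($F$ a free Leibniz algebra), $M(L)\cong(F'\cap R)/(FR+RF)$, where $FR$, $RF$ denote spans of products. Maps: write $L=F/R$ and $Z=T/R$ with $F$ a free Leibniz algebra and $R\subseteq T$ ideals of $F$; then $FT+TF\subseteq R$. Identify $M(L)=(R\cap F')/(FR+RF)$, $M(L/Z)=(T\cap F')/(FT+TF)$, $L'\cap Z=(T\cap(F'+R))/R$, $L/L'=F/(R+F')$. Then $\beta$ and $\gamma$ are induced by the inclusions $R\cap F'\to T\cap F'\to T\cap(F'+R)$, and $\overline{\theta}$ is the linear map determined by $(f+(R+F'))\otimes(t+R)\mapsto ft+(FR+RF)$ on the first summand and $(t+R)\otimes(f+(R+F'))\mapsto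 tf+(FR+RF)$ on the second summand ($f\in F$, $t\in T$). *)

theory Defs
  imports "Jordan_Normal_Form.Missing_VectorSpace" "HOL-Algebra.QuotRing"
begin

section \<open>Leibniz algebras\<close>

text \<open>
  An algebra over \<open>K\<close> is a \<^type>\<open>module\<close> record, whose field \<^const>\<open>mult\<close> is the (in
  general nonassociative) product and whose field \<^const>\<open>one\<close> carries no meaning.
\<close>

locale leibniz_algebra = vectorspace K L for K (structure) and L (structure) +
  assumes prod_closed:
      "\<lbrakk>x \<in> carrier L; y \<in> carrier L\<rbrakk> \<Longrightarrow> x \<otimes>\<^bsub>L\<^esub> y \<in> carrier L"
    and prod_add_left:
      "\<lbrakk>x \<in> carrier L; y \<in> carrier L; z \<in> carrier L\<rbrakk> \<Longrightarrow>
        (x \<oplus>\<^bsub>L\<^esub> y) \<otimes>\<^bsub>L\<^esub> z = x \<otimes>\<^bsub>L\<^esub> z \<oplus>\<^bsub>L\<^esub> y \<otimes>\<^bsub>L\<^esub> z"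
    and prod_add_right:
      "\<lbrakk>x \<in> carrier L; y \<in> carrier L; z \<in> carrier L\<rbrakk> \<Longrightarrow>
        z \<otimes>\<^bsub>L\<^esub> (x \<oplus>\<^bsub>L\<^esub> y) = z \<otimes>\<^bsub>L\<^esub> x \<oplus>\<^bsub>L\<^esub> z \<otimes>\<^bsub>L\<^esub> y"
    and prod_smult_left:
      "\<lbrakk>a \<in> carrier K; x \<in> carrier L; y \<in> carrier L\<rbrakk> \<Longrightarrow>
        (a \<odot>\<^bsub>L\<^esub> x) \<otimes>\<^bsub>L\<^esub> y = a \<odot>\<^bsub>L\<^esub> (x \<otimes>\<^bsub>L\<^esub> y)"
    and prod_smult_right:
      "\<lbrakk>a \<in> carrier K; x \<in> carrier L; y \<in> carrier L\<rbrakk> \<Longrightarrow>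
        x \<otimes>\<^bsub>L\<^esub> (a \<odot>\<^bsub>L\<^esub> y) = a \<odot>\<^bsub>L\<^esub> (x \<otimes>\<^bsub>L\<^esub> y)"
    and left_leibniz:
      "\<lbrakk>x \<in> carrier L; y \<in> carrier L; z \<in> carrier L\<rbrakk> \<Longrightarrow>
        x \<otimes>\<^bsub>L\<^esub> (y \<otimes>\<^bsub>L\<^esub> z) = (x \<otimes>\<^bsub>L\<^esub> y) \<otimes>\<^bsub>L\<^esub> z \<oplus>\<^bsub>L\<^esub> y \<otimes>\<^bsub>L\<^esub> (x \<otimes>\<^bsub>L\<^esub> z)"

definition prod_span ::
    "('k, 'r) ring_scheme \<Rightarrow> ('k, 'l) module \<Rightarrow> 'l set \<Rightarrow> 'l set \<Rightarrow> 'l set" where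
  "prod_span K L A B = module.span K L {a \<otimes>\<^bsub>L\<^esub> b | a b. a \<in> A \<and> b \<in> B}"

definition derived_ideal :: "('k, 'r) ring_scheme \<Rightarrow> ('k, 'l) module \<Rightarrow> 'l set" where
  "derived_ideal K L = prod_span K L (carrier L) (carrier L)"

definition leibniz_center :: "('k, 'l) module \<Rightarrow> 'l set" where
  "leibniz_center L =
     {z \<in> carrier L. \<forall>x \<in> carrier L. z \<otimes>\<^bsub>L\<^esub> x = \<zero>\<^bsub>L\<^esub> \<and> x \<otimes>\<^bsub>L\<^esub> z = \<zero>\<^bsub>L\<^esub>}"

definition alg_ideal :: "('k, 'r) ring_scheme \<Rightarrow> ('k, 'l) module \<Rightarrow> 'l set \<Rightarrow> bool" where
  "alg_ideal K L I \<longleftrightarrow> subspace K I L \<and>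
     (\<forall>x \<in> carrier L. \<forall>i \<in> I. x \<otimes>\<^bsub>L\<^esub> i \<in> I \<and> i \<otimes>\<^bsub>L\<^esub> x \<in> I)"

definition central_ideal :: "('k, 'r) ring_scheme \<Rightarrow> ('k, 'l) module \<Rightarrow> 'l set \<Rightarrow> bool" where
  "central_ideal K L Z \<longleftrightarrow> alg_ideal K L Z \<and> Z \<subseteq> leibniz_center L"

definition linear_iso ::
    "('k, 'r) ring_scheme \<Rightarrow> ('k, 'v) module \<Rightarrow> ('k, 'w) module \<Rightarrow> ('v \<Rightarrow> 'w) \<Rightarrow> bool" where
  "linear_iso K V W \<phi> \<longleftrightarrow> linear_map K V W \<phi> \<and> bij_betw \<phi> (carrier V) (carrier W)"

definition alg_hom ::
    "('k, 'r) ring_scheme \<Rightarrow> ('k, 'v) module \<Rightarrow> ('k, 'w) module \<Rightarrow> ('v \<Rightarrow> 'w) \<Rightarrow> bool" where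
  "alg_hom K L M \<phi> \<longleftrightarrow> linear_map K L M \<phi> \<and>
     (\<forall>x \<in> carrier L. \<forall>y \<in> carrier L. \<phi> (x \<otimes>\<^bsub>L\<^esub> y) = \<phi> x \<otimes>\<^bsub>M\<^esub> \<phi> y)"

definition alg_iso ::
    "('k, 'r) ring_scheme \<Rightarrow> ('k, 'v) module \<Rightarrow> ('k, 'w) module \<Rightarrow> ('v \<Rightarrow> 'w) \<Rightarrow> bool" where
  "alg_iso K L M \<phi> \<longleftrightarrow> alg_hom K L M \<phi> \<and> bij_betw \<phi> (carrier L) (carrier M)"

text \<open>
  The library quotient \<^const>\<open>FactRing\<close> by cosets, with the induced scalar multiplication. It
  serves as the quotient algebra if \<open>I\<close> is an ideal of \<open>V\<close>, and as the quotient vector space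
  (the product being ignored) if \<open>I\<close> is just a subspace.
\<close>

definition quot :: "('k, 'v) module \<Rightarrow> 'v set \<Rightarrow> ('k, 'v set) module" where
  "quot V I = \<lparr>carrier = carrier (V Quot I), mult = mult (V Quot I), one = one (V Quot I),
     zero = zero (V Quot I), add = add (V Quot I),
     smult = (\<lambda>a C. \<Union>v \<in> C. I +>\<^bsub>V\<^esub> (a \<odot>\<^bsub>V\<^esub> v))\<rparr>"


section \<open>Free vector spaces and tensor products\<close>

definition free_vs :: "('k, 'r) ring_scheme \<Rightarrow> 's set \<Rightarrow> ('k, 's \<Rightarrow> 'k) module" where
  "free_vs K S = \<lparr>
     carrier = {f. (\<forall>s \<in> S. f s \<in> carrier K) \<and> (\<forall>s. s \<notin> S \<longrightarrow> f s = \<zero>\<^bsub>K\<^esub>) \<and>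
                   finite {s. f s \<noteq> \<zero>\<^bsub>K\<^esub>}},
     mult = (\<lambda>f g s. \<zero>\<^bsub>K\<^esub>), one = (\<lambda>s. \<zero>\<^bsub>K\<^esub>),
     zero = (\<lambda>s. \<zero>\<^bsub>K\<^esub>), add = (\<lambda>f g s. f s \<oplus>\<^bsub>K\<^esub> g s),
     smult = (\<lambda>a f s. a \<otimes>\<^bsub>K\<^esub> f s)\<rparr>"

definition unit_vec :: "('k, 'r) ring_scheme \<Rightarrow> 's \<Rightarrow> 's \<Rightarrow> 'k" where
  "unit_vec K s = (\<lambda>t. if t = s then \<one>\<^bsub>K\<^esub> else \<zero>\<^bsub>K\<^esub>)"

definition tensor_relations ::
    "('k, 'r) ring_scheme \<Rightarrow> ('k, 'v) module \<Rightarrow> ('k, 'w) module \<Rightarrow> ('v \<times> 'w \<Rightarrow> 'k) set" where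
  "tensor_relations K V W =
    (let A = free_vs K (carrier V \<times> carrier W); e = (\<lambda>v w. unit_vec K (v, w)) in
     module.span K A
      ({e (v \<oplus>\<^bsub>V\<^esub> v') w \<ominus>\<^bsub>A\<^esub> (e v w \<oplus>\<^bsub>A\<^esub> e v' w) | v v' w.
          v \<in> carrier V \<and> v' \<in> carrier V \<and> w \<in> carrier W} \<union>
       {e v (w \<oplus>\<^bsub>W\<^esub> w') \<ominus>\<^bsub>A\<^esub> (e v w \<oplus>\<^bsub>A\<^esub> e v w') | v w w'.
          v \<in> carrier V \<and> w \<in> carrier W \<and> w' \<in> carrier W} \<union>
       {e (a \<odot>\<^bsub>V\<^esub> v) w \<ominus>\<^bsub>A\<^esub> (a \<odot>\<^bsub>A\<^esub> e v w) | a v w.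
          a \<in> carrier K \<and> v \<in> carrier V \<and> w \<in> carrier W} \<union>
       {e v (a \<odot>\<^bsub>W\<^esub> w) \<ominus>\<^bsub>A\<^esub> (a \<odot>\<^bsub>A\<^esub> e v w) | a v w.
          a \<in> carrier K \<and> v \<in> carrier V \<and> w \<in> carrier W}))"

definition tensor_space ::
    "('k, 'r) ring_scheme \<Rightarrow> ('k, 'v) module \<Rightarrow> ('k, 'w) module \<Rightarrow>
     ('k, ('v \<times> 'w \<Rightarrow> 'k) set) module" where
  "tensor_space K V W = quot (free_vs K (carrier V \<times> carrier W)) (tensor_relations K V W)"

definition pure_tensor ::
    "('k, 'r) ring_scheme \<Rightarrow> ('k, 'v) module \<Rightarrow> ('k, 'w) module \<Rightarrow> 'v \<Rightarrow> 'w \<Rightarrow>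
     ('v \<times> 'w \<Rightarrow> 'k) set" where
  "pure_tensor K V W v w =
     tensor_relations K V W +>\<^bsub>free_vs K (carrier V \<times> carrier W)\<^esub> unit_vec K (v, w)"


section \<open>Free Leibniz algebras\<close>

text \<open>
  The free nonassociative algebra on \<open>X\<close> has the nonassociative words in \<open>X\<close> as a basis. The
  free Leibniz algebra is its quotient by the smallest ideal containing all
  \<open>x(yz) - ((xy)z + y(xz))\<close>. (A definition by the universal property would have to quantify
  over algebras with arbitrary carrier types.)
\<close>

datatype (letters: 'x) word = Letter 'x | Prod "'x word" "'x word"

definition free_nonassoc_algebra ::
    "('k, 'r) ring_scheme \<Rightarrow> 'x set \<Rightarrow> ('k, 'x word \<Rightarrow> 'k) module" where
  "free_nonassoc_algebra K X = (free_vs K {w. letters w \<subseteq> X})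
     \<lparr>mult := (\<lambda>f g w. case w of Letter x \<Rightarrow> \<zero>\<^bsub>K\<^esub> | Prod u v \<Rightarrow> f u \<otimes>\<^bsub>K\<^esub> g v)\<rparr>"

definition leibniz_identity_ideal ::
    "('k, 'r) ring_scheme \<Rightarrow> ('k, 'v) module \<Rightarrow> 'v set" where
  "leibniz_identity_ideal K A = \<Inter>{I. alg_ideal K A I \<and>
     (\<forall>x \<in> carrier A. \<forall>y \<in> carrier A. \<forall>z \<in> carrier A.
        x \<otimes>\<^bsub>A\<^esub> (y \<otimes>\<^bsub>A\<^esub> z) \<ominus>\<^bsub>A\<^esub> ((x \<otimes>\<^bsub>A\<^esub> y) \<otimes>\<^bsub>A\<^esub> z \<oplus>\<^bsub>A\<^esub> y \<otimes>\<^bsub>A\<^esub> (x \<otimes>\<^bsub>A\<^esub> z)) \<in> I)}"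

definition free_leibniz ::
    "('k, 'r) ring_scheme \<Rightarrow> 'x set \<Rightarrow> ('k, ('x word \<Rightarrow> 'k) set) module" where
  "free_leibniz K X =
     quot (free_nonassoc_algebra K X) (leibniz_identity_ideal K (free_nonassoc_algebra K X))"

definition free_gen :: "('k, 'r) ring_scheme \<Rightarrow> 'x set \<Rightarrow> 'x \<Rightarrow> ('x word \<Rightarrow> 'k) set" where
  "free_gen K X x = leibniz_identity_ideal K (free_nonassoc_algebra K X)
     +>\<^bsub>free_nonassoc_algebra K X\<^esub> unit_vec K (Letter x)"

definition free_leibniz_on ::
    "('k, 'r) ring_scheme \<Rightarrow> ('k, 'f) module \<Rightarrow> 'f set \<Rightarrow> bool" where
  "free_leibniz_on K F X \<longleftrightarrow> leibniz_algebra K F \<and> X \<subseteq> carrier F \<and>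
     (\<exists>\<phi>. alg_iso K (free_leibniz K X) F \<phi> \<and> (\<forall>x \<in> X. \<phi> (free_gen K X x) = x))"


section \<open>Multipliers\<close>

definition defining_pair ::
    "('k, 'r) ring_scheme \<Rightarrow> ('k, 'l) module \<Rightarrow> ('k, 'e) module \<Rightarrow> 'e set \<Rightarrow> bool" where
  "defining_pair K L E M \<longleftrightarrow> leibniz_algebra K E \<and> alg_ideal K E M \<and>
     M \<subseteq> leibniz_center E \<inter> derived_ideal K E \<and> (\<exists>\<phi>. alg_iso K (quot E M) L \<phi>)"

text \<open>
  For finite-dimensional \<open>L\<close>, every defining pair \<open>(E, M)\<close> has \<open>E\<close> finite-dimensional
  (\<open>E'\<close> is spanned by products of representatives of a basis of \<open>E/M\<close>), so the
  finiteness conditions below only keep \<^const>\<open>vectorspace.dim\<close> meaningful. A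
  finite-dimensional algebra is isomorphic to one whose elements are coordinate functions
  \<open>nat \<Rightarrow> 'k\<close>, so comparing with such algebras is comparing with all of them.
\<close>

definition maximal_defining_pair ::
    "('k, 'r) ring_scheme \<Rightarrow> ('k, 'l) module \<Rightarrow> ('k, 'e) module \<Rightarrow> 'e set \<Rightarrow> bool" where
  "maximal_defining_pair K L E M \<longleftrightarrow> defining_pair K L E M \<and> vectorspace.fin_dim K E \<and>
     (\<forall>(E' :: ('k, nat \<Rightarrow> 'k) module) M'.
        defining_pair K L E' M' \<and> vectorspace.fin_dim K E' \<longrightarrow>
        vectorspace.dim K E' \<le> vectorspace.dim K E)"

definition comm_span :: "('k, 'r) ring_scheme \<Rightarrow> ('k, 'f) module \<Rightarrow> 'f set \<Rightarrow> 'f set" where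
  "comm_span K F R = prod_span K F (carrier F) R <+>\<^bsub>F\<^esub> prod_span K F R (carrier F)"

text \<open>
  \<open>(R \<inter> F')/(FR + RF)\<close>: if \<open>R\<close> is the kernel of a surjection from a free Leibniz algebra
  \<open>F\<close> onto a finite-dimensional \<open>L\<close>, this is a model of the multiplier of \<open>L\<close>.
\<close>

definition hopf_space ::
    "('k, 'r) ring_scheme \<Rightarrow> ('k, 'f) module \<Rightarrow> 'f set \<Rightarrow> ('k, 'f set) module" where
  "hopf_space K F R = quot (F\<lparr>carrier := R \<inter> derived_ideal K F\<rparr>) (comm_span K F R)"

end

theory Submission
  imports Defs
begin

text \<open>
  Write \<open>C\<^sub>R = FR + RF\<close>. Since \<open>F\<close> is free and \<open>E\<^sub>1/M\<^sub>1\<close> is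
  isomorphic to \<open>L\<close>, the presentation \<open>\<pi>\<close> lifts to \<open>\<rho>\<^sub>1 : F \<rightarrow> E\<^sub>1\<close>. It maps
  \<open>R \<inter> F'\<close> onto \<open>M\<^sub>1\<close> and kills \<open>C\<^sub>R\<close>, because \<open>M\<^sub>1\<close> is central and
  contained in \<open>E\<^sub>1'\<close>. For the Hopf formula, choose a subspace \<open>U \<supseteq> F'\<close> with
  \<open>F = U + R\<close> and \<open>U \<inter> R = F' \<inter> R\<close>. Then \<open>U/C\<^sub>R\<close> with the ideal
  \<open>(R \<inter> F')/C\<^sub>R\<close> is a finite-dimensional defining pair of \<open>L\<close> that maps onto \<open>E\<^sub>1\<close>,
  so by maximality this map is injective and \<open>\<rho>\<^sub>1\<close> has kernel \<open>C\<^sub>R\<close> on \<open>R \<inter> F'\<close>.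

  Applied to \<open>L\<close> and to \<open>L/Z = F/T\<close>, this reduces the sequence to
  \<open>\<beta> (\<rho>\<^sub>1 r) = \<rho>\<^sub>2 r\<close>, \<open>\<gamma> (\<rho>\<^sub>2 t) = \<pi> t\<close> and \<open>\<theta> (f \<otimes> t) = \<rho>\<^sub>1 (ft)\<close>.
  Exactness is then read off from the kernels of \<open>\<rho>\<^sub>1\<close>, \<open>\<rho>\<^sub>2\<close> and \<open>\<pi>\<close>, which on
  \<open>R \<inter> F'\<close>, \<open>T \<inter> F'\<close> and \<open>T \<inter> F'\<close> are \<open>C\<^sub>R\<close>, \<open>C\<^sub>T\<close> and \<open>R \<inter> F'\<close>.
\<close>

section \<open>Linear maps and subspaces\<close>

text \<open>The obstacle is size. \<open>F\<close> and \<open>R/C\<^sub>R\<close> may be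
  infinite-dimensional, while a maximal defining pair is known only through a comparison of finite
  dimensions. Cutting down to \<open>U\<close> cures this: \<open>U/(R \<inter> F')\<close> is a
  copy of \<open>L\<close>, and modulo \<open>C\<^sub>R\<close> a product in \<open>F\<close>
  depends only on the classes of its factors modulo \<open>R\<close>, so that finitely many products
  span \<open>F'/C\<^sub>R\<close>. The resulting pair maps onto \<open>E\<^sub>1\<close>, yet by
  maximality its dimension is at most that of \<open>E\<^sub>1\<close>; these two facts pull in
  opposite directions and leave only injectivity.

  The delicate point in the sequence itself is that \<open>\<theta>\<close> is well defined on
  \<open>L/L'\<close>, that is, that \<open>F'T\<close> and \<open>TF'\<close> lie in
  \<open>C\<^sub>R\<close>. Centrality of \<open>Z\<close> gives only
  \<open>FT + TF \<subseteq> R\<close>. The Leibniz identity closes the gap: it rewrites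
  \<open>(xy)t\<close> and \<open>t(xy)\<close> by products that have a factor in
  \<open>FT + TF\<close>.\<close>

lemma subspaceI:
  fixes V (structure)
  assumes "vectorspace K V" and "N \<subseteq> carrier V" and "\<zero> \<in> N"
    and "\<And>v w. v \<in> N \<Longrightarrow> w \<in> N \<Longrightarrow> v \<oplus> w \<in> N"
    and "\<And>c v. c \<in> carrier K \<Longrightarrow> v \<in> N \<Longrightarrow> c \<odot> v \<in> N"
  shows "subspace K N V"
  using assms by (simp add: subspace_def submodule_def vectorspace_def)

lemma linear_mapI:
  assumes "vectorspace K V" and "vectorspace K W"
    and "\<And>v. v \<in> carrier V \<Longrightarrow> h v \<in> carrier W"
    and "\<And>v w. v \<in> carrier V \<Longrightarrow> w \<in> carrier V \<Longrightarrow> h (v \<oplus>\<^bsub>V\<^esub> w) = h v \<oplus>\<^bsub>W\<^esub> h w"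
    and "\<And>c v. c \<in> carrier K \<Longrightarrow> v \<in> carrier V \<Longrightarrow> h (c \<odot>\<^bsub>V\<^esub> v) = c \<odot>\<^bsub>W\<^esub> h v"
  shows "linear_map K V W h"
  using assms
  by (auto simp: linear_map_def mod_hom_def mod_hom_axioms_def module_hom_def vectorspace_def)

lemma linear_mapD:
  assumes "linear_map K V W h"
  shows "vectorspace K V" and "vectorspace K W"
    and "\<And>v. v \<in> carrier V \<Longrightarrow> h v \<in> carrier W"
    and "\<And>v w. v \<in> carrier V \<Longrightarrow> w \<in> carrier V \<Longrightarrow> h (v \<oplus>\<^bsub>V\<^esub> w) = h v \<oplus>\<^bsub>W\<^esub> h w"
    and "\<And>c v. c \<in> carrier K \<Longrightarrow> v \<in> carrier V \<Longrightarrow> h (c \<odot>\<^bsub>V\<^esub> v) = c \<odot>\<^bsub>W\<^esub> h v"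
    and "h \<zero>\<^bsub>V\<^esub> = \<zero>\<^bsub>W\<^esub>"
    and "\<And>v w. v \<in> carrier V \<Longrightarrow> w \<in> carrier V \<Longrightarrow> h (v \<ominus>\<^bsub>V\<^esub> w) = h v \<ominus>\<^bsub>W\<^esub> h w"
proof -
  interpret linear_map K V W h by fact
  show "vectorspace K V" "vectorspace K W" "h \<zero>\<^bsub>V\<^esub> = \<zero>\<^bsub>W\<^esub>" by (unfold_locales, simp)
  fix v assume v: "v \<in> carrier V"
  then show "h v \<in> carrier W" by simp
  show "h (c \<odot>\<^bsub>V\<^esub> v) = c \<odot>\<^bsub>W\<^esub> h v" if "c \<in> carrier K" for c
    using v that by simp
  fix w assume w: "w \<in> carrier V"
  show "h (v \<oplus>\<^bsub>V\<^esub> w) = h v \<oplus>\<^bsub>W\<^esub> h w" "h (v \<ominus>\<^bsub>V\<^esub> w) = h v \<ominus>\<^bsub>W\<^esub> h w"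
    using v w by simp_all
qed

lemma subspaceD:
  fixes V (structure)
  assumes "subspace K N V"
  shows "vectorspace K V" and "N \<subseteq> carrier V" and "\<zero> \<in> N"
    and "\<And>v w. v \<in> N \<Longrightarrow> w \<in> N \<Longrightarrow> v \<oplus> w \<in> N"
    and "\<And>c v. c \<in> carrier K \<Longrightarrow> v \<in> N \<Longrightarrow> c \<odot> v \<in> N"
    and "\<And>v. v \<in> N \<Longrightarrow> \<ominus> v \<in> N"
    and "\<And>v w. v \<in> N \<Longrightarrow> w \<in> N \<Longrightarrow> v \<ominus> w \<in> N"
proof -
  show vs: "vectorspace K V" using assms by (simp add: subspace_def)
  then interpret vectorspace K V .
  interpret N: submodule K N V using assms by (simp add: subspace_def)
  show "N \<subseteq> carrier V" "\<zero> \<in> N" using N.subset by auto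
  show neg: "\<ominus> v \<in> N" if "v \<in> N" for v
  proof -
    have "(\<ominus>\<^bsub>K\<^esub> \<one>\<^bsub>K\<^esub>) \<odot> v = \<ominus> v"
      using that N.subset by (intro smult_minus_1) auto
    then show ?thesis using N.smult_closed[of "\<ominus>\<^bsub>K\<^esub> \<one>\<^bsub>K\<^esub>" v] that by simp
  qed
  show "v \<ominus> w \<in> N" if "v \<in> N" "w \<in> N" for v w
    using that neg by (simp add: a_minus_def)
qed (use assms in \<open>simp_all add: subspace_def submodule.m_closed[of K N V] submodule.smult_closed[of K N V]\<close>)

lemma subspace_vectorspace: "subspace K N V \<Longrightarrow> vectorspace K (V\<lparr>carrier := N\<rparr>)"
  using vectorspace.subspace_is_vs subspaceD(1) by blast

lemma carrier_subspace: "vectorspace K V \<Longrightarrow> subspace K (carrier V) V"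
proof -
  assume "vectorspace K V"
  then interpret vectorspace K V .
  show ?thesis by (intro subspaceI) (unfold_locales, auto)
qed

lemma subspace_Int: "subspace K M V \<Longrightarrow> subspace K N V \<Longrightarrow> subspace K (M \<inter> N) V"
  by (rule subspaceI) (simp_all add: subspaceD subsetD[OF subspaceD(2)] le_infI1[OF subspaceD(2)])

lemma subspace_of_subspace:
  assumes "subspace K M V" and "subspace K N V" and "M \<subseteq> N"
  shows "subspace K M (V\<lparr>carrier := N\<rparr>)"
  using assms by (intro subspaceI) (auto intro: subspace_vectorspace dest: subspaceD)

lemma in_a_kernel: "x \<in> a_kernel V W h \<longleftrightarrow> x \<in> carrier V \<and> h x = \<zero>\<^bsub>W\<^esub>"
  by (simp add: a_kernel_def kernel_def)

lemma linear_map_kernel_subspace: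
  assumes "linear_map K V W h" shows "subspace K (a_kernel V W h) V"
proof -
  interpret linear_map K V W h by fact
  show ?thesis
    by (intro subspaceI) (unfold_locales, auto simp: in_a_kernel)
qed

lemma linear_map_vimage_subspace:
  assumes "linear_map K V W h" and "subspace K N W"
  shows "subspace K {v \<in> carrier V. h v \<in> N} V"
proof -
  interpret linear_map K V W h by fact
  show ?thesis
    using subspaceD[OF assms(2)] by (intro subspaceI) (unfold_locales, auto)
qed

lemma linear_map_image_subspace:
  assumes "linear_map K V W h" and "subspace K N V"
  shows "subspace K (h ` N) W"
proof -
  interpret linear_map K V W h by fact
  note N = subspaceD[OF assms(2)]
  show ?thesis
  proof (rule subspaceI)
    show "\<zero>\<^bsub>W\<^esub> \<in> h ` N" using N(3) f0_is_0 by (metis imageI)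
  next
    fix v w assume "v \<in> h ` N" "w \<in> h ` N"
    then obtain a b where "v = h a" "w = h b" "a \<in> N" "b \<in> N" by auto
    then have "v \<oplus>\<^bsub>W\<^esub> w = h (a \<oplus>\<^bsub>V\<^esub> b)" using N(2) by (simp add: subsetD)
    then show "v \<oplus>\<^bsub>W\<^esub> w \<in> h ` N" using N(4) \<open>a \<in> N\<close> \<open>b \<in> N\<close> by simp
  next
    fix c v assume "c \<in> carrier K" "v \<in> h ` N"
    then obtain a where "v = h a" "a \<in> N" by auto
    with \<open>c \<in> carrier K\<close> have "c \<odot>\<^bsub>W\<^esub> v = h (c \<odot>\<^bsub>V\<^esub> a)" using N(2) by (simp add: subsetD)
    then show "c \<odot>\<^bsub>W\<^esub> v \<in> h ` N" using N(5) \<open>c \<in> carrier K\<close> \<open>a \<in> N\<close> by simp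
  qed (use N(2) in \<open>unfold_locales, auto\<close>)
qed

lemma linear_map_restrict:
  assumes "linear_map K V W h" and "subspace K A V" and "subspace K B W" and "h ` A \<subseteq> B"
  shows "linear_map K (V\<lparr>carrier := A\<rparr>) (W\<lparr>carrier := B\<rparr>) h"
  using assms subsetD[OF subspaceD(2)[OF assms(2)]]
  by (intro linear_mapI) (auto intro: subspace_vectorspace linear_mapD)

lemma linear_map_restrict_dom:
  assumes "linear_map K V W h" and "subspace K A V"
  shows "linear_map K (V\<lparr>carrier := A\<rparr>) W h"
  using assms subsetD[OF subspaceD(2)[OF assms(2)]]
  by (intro linear_mapI) (auto intro: subspace_vectorspace linear_mapD)

lemma linear_map_comp:
  assumes "linear_map K U V g" and "linear_map K V W h"
  shows "linear_map K U W (\<lambda>x. h (g x))"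
proof (rule linear_mapI)
  show "vectorspace K U" "vectorspace K W" by (fact linear_mapD[OF assms(1)] linear_mapD[OF assms(2)])+
qed (simp_all add: linear_mapD[OF assms(1)] linear_mapD[OF assms(2)])

lemma linear_map_factor:
  assumes h: "linear_map K V W h" and g: "linear_map K V U g"
    and surj: "h ` carrier V = carrier W"
    and ker: "\<And>x. x \<in> carrier V \<Longrightarrow> h x = \<zero>\<^bsub>W\<^esub> \<Longrightarrow> g x = \<zero>\<^bsub>U\<^esub>"
  obtains g' where "linear_map K W U g'" and "\<And>x. x \<in> carrier V \<Longrightarrow> g' (h x) = g x"
proof -
  note hD = linear_mapD[OF h] and gD = linear_mapD[OF g]
  interpret V: vectorspace K V by (rule hD(1))
  interpret W: vectorspace K W by (rule hD(2))
  interpret U: vectorspace K U by (rule gD(2))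
  have eq: "g x = g y" if "x \<in> carrier V" "y \<in> carrier V" "h x = h y" for x y
  proof -
    have "h (x \<ominus>\<^bsub>V\<^esub> y) = \<zero>\<^bsub>W\<^esub>" using that hD(3)[of y] hD(7)[of x y] by simp
    then have "g x \<ominus>\<^bsub>U\<^esub> g y = \<zero>\<^bsub>U\<^esub>" using ker[of "x \<ominus>\<^bsub>V\<^esub> y"] that gD(7)[of x y] by simp
    then show ?thesis using that gD(3)[of x] gD(3)[of y] by simp
  qed
  define g' where "g' w = g (SOME v. v \<in> carrier V \<and> h v = w)" for w
  have g': "g' (h x) = g x" if x: "x \<in> carrier V" for x
  proof -
    have "(SOME v. v \<in> carrier V \<and> h v = h x) \<in> carrier V
        \<and> h (SOME v. v \<in> carrier V \<and> h v = h x) = h x"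
      by (rule someI[of "\<lambda>v. v \<in> carrier V \<and> h v = h x" x]) (simp add: x)
    then show ?thesis unfolding g'_def by (intro eq[OF _ x]) blast+
  qed
  have lin: "linear_map K W U g'"
  proof (rule linear_mapI)
    fix w assume "w \<in> carrier W"
    then obtain v where v: "v \<in> carrier V" "w = h v" using surj by (metis imageE)
    show "g' w \<in> carrier U" unfolding v(2) g'[OF v(1)] by (rule gD(3)[OF v(1)])
    fix w' assume "w' \<in> carrier W"
    then obtain v' where v': "v' \<in> carrier V" "w' = h v'" using surj by (metis imageE)
    have "g' (h (v \<oplus>\<^bsub>V\<^esub> v')) = g (v \<oplus>\<^bsub>V\<^esub> v')" by (rule g') (use v v' in simp)
    then show "g' (w \<oplus>\<^bsub>W\<^esub> w') = g' w \<oplus>\<^bsub>U\<^esub> g' w'"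
      unfolding hD(4)[OF v(1) v'(1)] gD(4)[OF v(1) v'(1)] v(2) v'(2) g'[OF v(1)] g'[OF v'(1)] .
  next
    fix c w assume c: "c \<in> carrier K" and "w \<in> carrier W"
    then obtain v where v: "v \<in> carrier V" "w = h v" using surj by (metis imageE)
    have "g' (h (c \<odot>\<^bsub>V\<^esub> v)) = g (c \<odot>\<^bsub>V\<^esub> v)" by (rule g') (use v c in simp)
    then show "g' (c \<odot>\<^bsub>W\<^esub> w) = c \<odot>\<^bsub>U\<^esub> g' w"
      unfolding hD(5)[OF c v(1)] gD(5)[OF c v(1)] v(2) g'[OF v(1)] .
  qed (rule hD(2) gD(2))+
  show ?thesis by (rule that[OF lin g'])
qed

section \<open>Cosets of a subspace\<close>

lemma subspace_abelian_subgroup: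
  assumes "subspace K N V" shows "abelian_subgroup N V"
proof -
  note N = subspaceD[OF assms]
  interpret vectorspace K V by (rule N(1))
  show ?thesis
  proof (rule abelian_subgroupI3)
    have "subgroup N (add_monoid V)"
    proof (rule add.subgroupI)
      show "N \<noteq> {}" using N(3) by auto
    qed (use N in \<open>auto simp: a_inv_def[symmetric]\<close>)
    then show "additive_subgroup N V" by (rule additive_subgroupI)
  qed (rule M.abelian_group_axioms)
qed

lemma coset_eq_iff:
  fixes V (structure)
  assumes "subspace K N V" and x: "x \<in> carrier V" and y: "y \<in> carrier V"
  shows "N +> x = N +> y \<longleftrightarrow> x \<ominus> y \<in> N"
proof -
  interpret abelian_subgroup N V by (rule subspace_abelian_subgroup) fact
  have "N +> x = N +> y \<longleftrightarrow> x \<in> N +> y"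
    using a_repr_independence'[OF _ y] a_rcos_self[OF x] by auto
  also have "\<dots> \<longleftrightarrow> x \<ominus> y \<in> N"
    using a_rcos_module[OF y x] by (simp add: a_minus_def)
  finally show ?thesis .
qed

lemma span_in_subspace:
  assumes "subspace K N V" and "S \<subseteq> N"
  shows "module.span K V S \<subseteq> N"
proof -
  interpret vectorspace K V by (rule subspaceD(1)[OF assms(1)])
  show ?thesis using span_is_subset[OF assms(2)] assms(1) by (simp add: subspace_def)
qed

lemma linear_map_cong:
  assumes "linear_map K V W h" and "\<And>x. x \<in> carrier V \<Longrightarrow> h' x = h x"
  shows "linear_map K V W h'"
proof -
  note hD = linear_mapD[OF assms(1)]
  interpret V: vectorspace K V by (rule hD(1))
  show ?thesis by (rule linear_mapI) (simp_all add: assms(2) hD)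
qed

lemma linear_map_restrict_cod:
  assumes "linear_map K V W h" and "subspace K B W" and "\<And>v. v \<in> carrier V \<Longrightarrow> h v \<in> B"
  shows "linear_map K V (W\<lparr>carrier := B\<rparr>) h"
  using assms(3)
  by (intro linear_mapI) (simp_all add: linear_mapD[OF assms(1)] subspace_vectorspace[OF assms(2)])

lemma subspace_trans:
  assumes "subspace K S (V\<lparr>carrier := M\<rparr>)" and "subspace K M V"
  shows "subspace K S V"
proof (rule subspaceI[OF subspaceD(1)[OF assms(2)]])
  note S = subspaceD[OF assms(1), simplified]
  show "S \<subseteq> carrier V" using S(2) subspaceD(2)[OF assms(2)] by (rule order_trans)
  show "\<zero>\<^bsub>V\<^esub> \<in> S" by (rule S(3))
  show "v \<oplus>\<^bsub>V\<^esub> w \<in> S" if "v \<in> S" "w \<in> S" for v w using S(4)[OF that] .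
  show "c \<odot>\<^bsub>V\<^esub> v \<in> S" if "c \<in> carrier K" "v \<in> S" for c v using S(5)[OF that] .
qed

lemma direct_sum_linear:
  assumes g: "linear_map K V P g" and h: "linear_map K W P h"
  shows "linear_map K (direct_sum V W) P (\<lambda>x. g (fst x) \<oplus>\<^bsub>P\<^esub> h (snd x))"
proof -
  note gD = linear_mapD[OF g] and hD = linear_mapD[OF h]
  interpret P: vectorspace K P by (rule gD(2))
  show ?thesis
    by (rule linear_mapI[OF direct_sum_is_vs[OF gD(1) hD(1)] gD(2)])
       (auto simp: direct_sum_def gD(3-5) hD(3-5) P.smult_r_distr P.M.a_ac)
qed

text \<open>Negation is defined as the unique inverse inside the carrier, so shrinking the carrier
  of a record does not leave it unchanged by definition. Linearity of the inclusion of
  \<open>U\<close> settles the matter.\<close>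

lemma subspace_minus:
  assumes U: "subspace K U V" and "x \<in> U" and "y \<in> U"
  shows "x \<ominus>\<^bsub>V\<lparr>carrier := U\<rparr>\<^esub> y = x \<ominus>\<^bsub>V\<^esub> y"
proof -
  have "linear_map K V V (\<lambda>x. x)" by (rule linear_mapI) (simp_all add: subspaceD(1)[OF U])
  then show ?thesis using linear_mapD(7)[OF linear_map_restrict_dom[OF _ U]] assms by fastforce
qed

text \<open>Together with the induction principles for free spaces, this reduces an identity between
  linear maps to a check on a basis.\<close>

lemma linear_map_equalizer_subspace:
  assumes "linear_map K V W g" and "linear_map K V W h"
  shows "subspace K {v \<in> carrier V. g v = h v} V"
proof -
  interpret vectorspace K V by (rule linear_mapD(1)[OF assms(1)])
  show ?thesis
    by (rule subspaceI) (auto simp: linear_mapD[OF assms(1)] linear_mapD[OF assms(2)] vectorspace_axioms)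
qed

section \<open>Quotient spaces\<close>

text \<open>Every axiom for \<open>W\<close> is an equation between values of \<open>h\<close> and
  follows from the same axiom for \<open>V\<close>. It is applied to the coset map, to make
  \<open>quot\<close> a vector space, and to the identity, when only the product of a record
  changes.\<close>

lemma vectorspace_image:
  assumes "vectorspace K V" and carrier: "carrier W = h ` carrier V" and zero: "\<zero>\<^bsub>W\<^esub> = h \<zero>\<^bsub>V\<^esub>"
    and add: "\<And>v w. v \<in> carrier V \<Longrightarrow> w \<in> carrier V \<Longrightarrow> h v \<oplus>\<^bsub>W\<^esub> h w = h (v \<oplus>\<^bsub>V\<^esub> w)"
    and smult: "\<And>c v. c \<in> carrier K \<Longrightarrow> v \<in> carrier V \<Longrightarrow> c \<odot>\<^bsub>W\<^esub> h v = h (c \<odot>\<^bsub>V\<^esub> v)"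
  shows "vectorspace K W"
proof -
  interpret vectorspace K V by fact
  show ?thesis
  proof (rule vs_criteria)
    show "field K" by (rule field_axioms)
    show "\<forall>v\<in>carrier W. \<exists>w\<in>carrier W. v \<oplus>\<^bsub>W\<^esub> w = \<zero>\<^bsub>W\<^esub>"
    proof
      fix v assume "v \<in> carrier W"
      then obtain x where "x \<in> carrier V" "v = h x" using carrier by auto
      then have "h (\<ominus>\<^bsub>V\<^esub> x) \<in> carrier W \<and> v \<oplus>\<^bsub>W\<^esub> h (\<ominus>\<^bsub>V\<^esub> x) = \<zero>\<^bsub>W\<^esub>"
        by (simp add: carrier zero add M.r_neg)
      then show "\<exists>w\<in>carrier W. v \<oplus>\<^bsub>W\<^esub> w = \<zero>\<^bsub>W\<^esub>" by blast
    qed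
  qed (auto simp: carrier zero add smult M.a_ac smult_l_distr smult_r_distr smult_assoc1)
qed

lemma quot_simps:
  "carrier (quot V N) = (\<lambda>x. N +>\<^bsub>V\<^esub> x) ` carrier V"
  "zero (quot V N) = N"
  "add (quot V N) = set_add V"
  "mult (quot V N) = rcoset_mult V N"
  "smult (quot V N) = (\<lambda>a C. \<Union>v \<in> C. N +>\<^bsub>V\<^esub> (a \<odot>\<^bsub>V\<^esub> v))"
  by (auto simp: quot_def FactRing_def A_RCOSETS_def')

lemma coset_self: "subspace K N V \<Longrightarrow> x \<in> carrier V \<Longrightarrow> x \<in> N +>\<^bsub>V\<^esub> x"
  by (rule abelian_subgroup.a_rcos_self[OF subspace_abelian_subgroup])

lemma coset_subset: "subspace K N V \<Longrightarrow> x \<in> carrier V \<Longrightarrow> N +>\<^bsub>V\<^esub> x \<subseteq> carrier V"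
  by (meson abelian_monoid.a_r_coset_subset_G abelian_group.axioms(1)
      module.axioms(2) subspaceD(1,2) vectorspace.axioms(1))

lemma in_cosetD:
  assumes N: "subspace K N V" and x: "x \<in> carrier V" and y: "y \<in> N +>\<^bsub>V\<^esub> x"
  shows "y \<in> carrier V" and "N +>\<^bsub>V\<^esub> y = N +>\<^bsub>V\<^esub> x" and "y \<ominus>\<^bsub>V\<^esub> x \<in> N"
proof -
  interpret abelian_subgroup N V by (rule subspace_abelian_subgroup) fact
  show yV: "y \<in> carrier V" using coset_subset[OF N x] y by auto
  show "N +>\<^bsub>V\<^esub> y = N +>\<^bsub>V\<^esub> x" using a_repr_independence'[OF y x] by simp
  then show "y \<ominus>\<^bsub>V\<^esub> x \<in> N" using coset_eq_iff[OF N yV x] by simp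
qed

text \<open>Scalar multiplication in \<open>quot\<close> is a union over all representatives of a
  coset. The union collapses because all of them lead to the same coset.\<close>

lemma coset_smult:
  assumes N: "subspace K N V" and x: "x \<in> carrier V" and c: "c \<in> carrier K"
  shows "(\<Union>v \<in> N +>\<^bsub>V\<^esub> x. N +>\<^bsub>V\<^esub> (c \<odot>\<^bsub>V\<^esub> v)) = N +>\<^bsub>V\<^esub> (c \<odot>\<^bsub>V\<^esub> x)"
proof -
  interpret vectorspace K V by (rule subspaceD(1)[OF N])
  have "N +>\<^bsub>V\<^esub> (c \<odot>\<^bsub>V\<^esub> v) = N +>\<^bsub>V\<^esub> (c \<odot>\<^bsub>V\<^esub> x)" if "v \<in> N +>\<^bsub>V\<^esub> x" for v
  proof -
    note v = in_cosetD[OF N x that]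
    have "c \<odot>\<^bsub>V\<^esub> v \<ominus>\<^bsub>V\<^esub> c \<odot>\<^bsub>V\<^esub> x = c \<odot>\<^bsub>V\<^esub> (v \<ominus>\<^bsub>V\<^esub> x)"
      using v x c by (simp add: a_minus_def smult_r_distr smult_r_minus)
    then show ?thesis
      using v x c subspaceD(5)[OF N c v(3)] by (simp add: coset_eq_iff[OF N])
  qed
  then show ?thesis using coset_self[OF N x] by blast
qed

text \<open>The product of cosets is a union over pairs of representatives. Independence of the
  representatives is a hypothesis here, since for a mere subspace it may fail.\<close>

lemma coset_mult:
  assumes N: "subspace K N V" and x: "x \<in> carrier V" and y: "y \<in> carrier V"
    and cong: "\<And>x' y'. x' \<in> carrier V \<Longrightarrow> y' \<in> carrier V \<Longrightarrow> x' \<ominus>\<^bsub>V\<^esub> x \<in> N \<Longrightarrow> y' \<ominus>\<^bsub>V\<^esub> y \<in> N \<Longrightarrow>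
      N +>\<^bsub>V\<^esub> (x' \<otimes>\<^bsub>V\<^esub> y') = N +>\<^bsub>V\<^esub> (x \<otimes>\<^bsub>V\<^esub> y)"
  shows "(N +>\<^bsub>V\<^esub> x) \<otimes>\<^bsub>quot V N\<^esub> (N +>\<^bsub>V\<^esub> y) = N +>\<^bsub>V\<^esub> (x \<otimes>\<^bsub>V\<^esub> y)"
proof -
  have "N +>\<^bsub>V\<^esub> (a \<otimes>\<^bsub>V\<^esub> b) = N +>\<^bsub>V\<^esub> (x \<otimes>\<^bsub>V\<^esub> y)" if "a \<in> N +>\<^bsub>V\<^esub> x" "b \<in> N +>\<^bsub>V\<^esub> y" for a b
    using in_cosetD[OF N x that(1)] in_cosetD[OF N y that(2)] by (intro cong) auto
  then show ?thesis
    using coset_self[OF N x] coset_self[OF N y] unfolding quot_simps rcoset_mult_def by blast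
qed

lemma quot_linear_map:
  assumes N: "subspace K N V"
  shows "linear_map K V (quot V N) (\<lambda>x. N +>\<^bsub>V\<^esub> x)"
proof -
  interpret vectorspace K V by (rule subspaceD(1)[OF N])
  interpret abelian_subgroup N V by (rule subspace_abelian_subgroup[OF N])
  have "vectorspace K (quot V N)"
  proof (rule vectorspace_image[of K V _ "\<lambda>x. N +>\<^bsub>V\<^esub> x"])
    show "\<zero>\<^bsub>quot V N\<^esub> = N +>\<^bsub>V\<^esub> \<zero>\<^bsub>V\<^esub>" by (simp add: quot_simps a_subset)
  qed (use N in \<open>auto simp: quot_simps coset_smult a_rcos_sum subspaceD(1)\<close>)
  then show ?thesis
    by (intro linear_mapI) (auto simp: quot_simps coset_smult[OF N] a_rcos_sum subspaceD(1)[OF N])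
qed

lemma coset_eq_zero:
  assumes N: "subspace K N V" and x: "x \<in> carrier V"
  shows "N +>\<^bsub>V\<^esub> x = \<zero>\<^bsub>quot V N\<^esub> \<longleftrightarrow> x \<in> N"
proof -
  interpret vectorspace K V by (rule subspaceD(1)[OF N])
  have "\<zero>\<^bsub>quot V N\<^esub> = N +>\<^bsub>V\<^esub> \<zero>\<^bsub>V\<^esub>"
    using linear_mapD(6)[OF quot_linear_map[OF N]] by simp
  then show ?thesis using coset_eq_iff[OF N x M.zero_closed] x
    by (simp add: a_minus_def M.minus_equality[of "\<zero>\<^bsub>V\<^esub>" "\<zero>\<^bsub>V\<^esub>"])
qed

section \<open>Algebras and ideals\<close>

text \<open>The Leibniz identity is left out so that the theory of ideals and quotients also covers
  the free nonassociative algebra, of which the free Leibniz algebra is a quotient.\<close>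

locale bilinear_algebra = vectorspace K A
  for K :: "('k, 'r) ring_scheme" and A :: "('k, 'a) module" +
  assumes prod_closed: "x \<in> carrier A \<Longrightarrow> y \<in> carrier A \<Longrightarrow> x \<otimes>\<^bsub>A\<^esub> y \<in> carrier A"
    and prod_add_left: "x \<in> carrier A \<Longrightarrow> y \<in> carrier A \<Longrightarrow> z \<in> carrier A \<Longrightarrow>
      (x \<oplus>\<^bsub>A\<^esub> y) \<otimes>\<^bsub>A\<^esub> z = x \<otimes>\<^bsub>A\<^esub> z \<oplus>\<^bsub>A\<^esub> y \<otimes>\<^bsub>A\<^esub> z"
    and prod_add_right: "x \<in> carrier A \<Longrightarrow> y \<in> carrier A \<Longrightarrow> z \<in> carrier A \<Longrightarrow>
      z \<otimes>\<^bsub>A\<^esub> (x \<oplus>\<^bsub>A\<^esub> y) = z \<otimes>\<^bsub>A\<^esub> x \<oplus>\<^bsub>A\<^esub> z \<otimes>\<^bsub>A\<^esub> y"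
    and prod_smult_left: "a \<in> carrier K \<Longrightarrow> x \<in> carrier A \<Longrightarrow> y \<in> carrier A \<Longrightarrow>
      (a \<odot>\<^bsub>A\<^esub> x) \<otimes>\<^bsub>A\<^esub> y = a \<odot>\<^bsub>A\<^esub> (x \<otimes>\<^bsub>A\<^esub> y)"
    and prod_smult_right: "a \<in> carrier K \<Longrightarrow> x \<in> carrier A \<Longrightarrow> y \<in> carrier A \<Longrightarrow>
      x \<otimes>\<^bsub>A\<^esub> (a \<odot>\<^bsub>A\<^esub> y) = a \<odot>\<^bsub>A\<^esub> (x \<otimes>\<^bsub>A\<^esub> y)"
begin

lemma linear_left: "z \<in> carrier A \<Longrightarrow> linear_map K A A (\<lambda>x. x \<otimes>\<^bsub>A\<^esub> z)"
  by (rule linear_mapI)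
     (simp_all add: prod_closed prod_add_left prod_smult_left vectorspace_axioms)

lemma linear_right: "z \<in> carrier A \<Longrightarrow> linear_map K A A (\<lambda>x. z \<otimes>\<^bsub>A\<^esub> x)"
  by (rule linear_mapI)
     (simp_all add: prod_closed prod_add_right prod_smult_right vectorspace_axioms)

lemmas prod_zero_left = linear_mapD(6)[OF linear_left]
lemmas prod_zero_right = linear_mapD(6)[OF linear_right]
lemmas prod_minus_left = linear_mapD(7)[OF linear_left]
lemmas prod_minus_right = linear_mapD(7)[OF linear_right]

end

lemma leibniz_bilinear: "leibniz_algebra K L \<Longrightarrow> bilinear_algebra K L"
proof -
  assume "leibniz_algebra K L"
  then interpret leibniz_algebra K L .
  show ?thesis
    by unfold_locales (simp_all add: prod_closed prod_add_left prod_add_right prod_smult_left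
        prod_smult_right)
qed

lemma alg_homD:
  assumes "alg_hom K A B h"
  shows "linear_map K A B h"
    and "\<And>x y. x \<in> carrier A \<Longrightarrow> y \<in> carrier A \<Longrightarrow> h (x \<otimes>\<^bsub>A\<^esub> y) = h x \<otimes>\<^bsub>B\<^esub> h y"
  using assms by (auto simp: alg_hom_def)

lemma alg_idealD:
  assumes "alg_ideal K A I"
  shows "subspace K I A"
    and "\<And>x i. x \<in> carrier A \<Longrightarrow> i \<in> I \<Longrightarrow> x \<otimes>\<^bsub>A\<^esub> i \<in> I"
    and "\<And>x i. x \<in> carrier A \<Longrightarrow> i \<in> I \<Longrightarrow> i \<otimes>\<^bsub>A\<^esub> x \<in> I"
  using assms by (auto simp: alg_ideal_def)

lemma alg_hom_comp:
  assumes "alg_hom K A B g" and "alg_hom K B C h"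
  shows "alg_hom K A C (\<lambda>x. h (g x))"
  using alg_homD[OF assms(1)] alg_homD[OF assms(2)] linear_mapD(3)[OF alg_homD(1)[OF assms(1)]]
  by (simp add: alg_hom_def linear_map_comp[of K A B g C h])

lemma alg_hom_restrict_dom:
  assumes "alg_hom K A B h" and "subspace K S A"
  shows "alg_hom K (A\<lparr>carrier := S\<rparr>) B h"
  using alg_homD[OF assms(1)] linear_map_restrict_dom[OF alg_homD(1)[OF assms(1)] assms(2)]
    subspaceD(2)[OF assms(2)]
  by (simp add: alg_hom_def subset_iff)

lemma subalgebra_leibniz:
  assumes "leibniz_algebra K A" and S: "subspace K S A"
    and "\<And>x y. x \<in> S \<Longrightarrow> y \<in> S \<Longrightarrow> x \<otimes>\<^bsub>A\<^esub> y \<in> S"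
  shows "leibniz_algebra K (A\<lparr>carrier := S\<rparr>)"
proof -
  interpret leibniz_algebra K A by fact
  note [simp] = subsetD[OF subspaceD(2)[OF S]]
  show ?thesis
  proof (intro leibniz_algebra.intro leibniz_algebra_axioms.intro)
    fix x y z
    assume "x \<in> carrier (A\<lparr>carrier := S\<rparr>)" "y \<in> carrier (A\<lparr>carrier := S\<rparr>)"
      "z \<in> carrier (A\<lparr>carrier := S\<rparr>)"
    then show "x \<otimes>\<^bsub>A\<lparr>carrier := S\<rparr>\<^esub> (y \<otimes>\<^bsub>A\<lparr>carrier := S\<rparr>\<^esub> z) = (x \<otimes>\<^bsub>A\<lparr>carrier := S\<rparr>\<^esub> y)
        \<otimes>\<^bsub>A\<lparr>carrier := S\<rparr>\<^esub> z \<oplus>\<^bsub>A\<lparr>carrier := S\<rparr>\<^esub> y \<otimes>\<^bsub>A\<lparr>carrier := S\<rparr>\<^esub> (x \<otimes>\<^bsub>A\<lparr>carrier := S\<rparr>\<^esub> z)"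
      using left_leibniz[of x y z] by simp
  qed (use assms(3) subspace_vectorspace[OF S] in
      \<open>simp_all add: prod_add_left prod_add_right prod_smult_left prod_smult_right\<close>)
qed

text \<open>Identities are inherited by images. This makes \<open>quot L Z\<close> and the
  coordinate algebra of the Hopf formula Leibniz algebras.\<close>

lemma leibniz_image:
  assumes "leibniz_algebra K A" and h: "alg_hom K A B h" and surj: "h ` carrier A = carrier B"
  shows "leibniz_algebra K B"
proof -
  interpret leibniz_algebra K A by fact
  note lin = linear_mapD[OF alg_homD(1)[OF h]]
  note hom = alg_homD(2)[OF h, symmetric] lin(4,5)[symmetric]
  show ?thesis
  proof (intro leibniz_algebra.intro leibniz_algebra_axioms.intro, unfold surj[symmetric])
    fix x y z
    assume "x \<in> h ` carrier A" "y \<in> h ` carrier A" "z \<in> h ` carrier A"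
    then obtain a b c where abc: "a \<in> carrier A" "x = h a" "b \<in> carrier A" "y = h b"
      "c \<in> carrier A" "z = h c"
      by blast
    show "x \<otimes>\<^bsub>B\<^esub> (y \<otimes>\<^bsub>B\<^esub> z) = (x \<otimes>\<^bsub>B\<^esub> y) \<otimes>\<^bsub>B\<^esub> z \<oplus>\<^bsub>B\<^esub> y \<otimes>\<^bsub>B\<^esub> (x \<otimes>\<^bsub>B\<^esub> z)"
      using abc left_leibniz[of a b c] by (simp add: hom prod_closed)
  qed (simp add: lin(2), (force simp: hom prod_closed prod_add_left prod_add_right
      prod_smult_left prod_smult_right)+)
qed

context bilinear_algebra
begin

section \<open>Spans of products\<close>

lemma prod_span_subspace:
  assumes "S \<subseteq> carrier A" and "T \<subseteq> carrier A"
  shows "subspace K (prod_span K A S T) A"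
  unfolding prod_span_def by (rule span_is_subspace) (use assms prod_closed in blast)

lemma prod_in_prod_span:
  assumes "S \<subseteq> carrier A" and "T \<subseteq> carrier A" and "x \<in> S" and "y \<in> T"
  shows "x \<otimes>\<^bsub>A\<^esub> y \<in> prod_span K A S T"
proof -
  have "{a \<otimes>\<^bsub>A\<^esub> b | a b. a \<in> S \<and> b \<in> T} \<subseteq> carrier A" using assms prod_closed by blast
  from in_own_span[OF this] show ?thesis unfolding prod_span_def using assms by blast
qed

lemma prod_span_least:
  assumes "subspace K N A" and "\<And>x y. x \<in> S \<Longrightarrow> y \<in> T \<Longrightarrow> x \<otimes>\<^bsub>A\<^esub> y \<in> N"
  shows "prod_span K A S T \<subseteq> N"
  unfolding prod_span_def by (rule span_in_subspace[OF assms(1)]) (use assms(2) in blast)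

lemma derived_subspace: "subspace K (derived_ideal K A) A"
  unfolding derived_ideal_def by (rule prod_span_subspace) simp_all

lemma prod_in_derived: "x \<in> carrier A \<Longrightarrow> y \<in> carrier A \<Longrightarrow> x \<otimes>\<^bsub>A\<^esub> y \<in> derived_ideal K A"
  unfolding derived_ideal_def by (rule prod_in_prod_span) simp_all

lemma derived_least:
  assumes "subspace K N A"
    and "\<And>x y. x \<in> carrier A \<Longrightarrow> y \<in> carrier A \<Longrightarrow> x \<otimes>\<^bsub>A\<^esub> y \<in> N"
  shows "derived_ideal K A \<subseteq> N"
  unfolding derived_ideal_def using assms by (rule prod_span_least)

lemma comm_span_subspace:
  assumes "S \<subseteq> carrier A"
  shows "subspace K (comm_span K A S) A"
proof -
  note l = prod_span_subspace[OF order_refl assms] and r = prod_span_subspace[OF assms order_refl]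
  \<comment> \<open>The set sum in \<open>comm_span\<close> is recast as a sum of submodules, which
    is known to be a subspace.\<close>
  have "comm_span K A S
      = submodule_sum (prod_span K A (carrier A) S) (prod_span K A S (carrier A))"
    by (auto simp: comm_span_def set_add_def' submodule_sum_def image_iff)
  then show ?thesis using sum_is_subspace[OF l r] by simp
qed

lemma prod_in_comm_span:
  assumes S: "S \<subseteq> carrier A" and "x \<in> carrier A" and "s \<in> S"
  shows "x \<otimes>\<^bsub>A\<^esub> s \<in> comm_span K A S" and "s \<otimes>\<^bsub>A\<^esub> x \<in> comm_span K A S"
proof -
  note l = subspaceD[OF prod_span_subspace[OF order_refl S]]
    and r = subspaceD[OF prod_span_subspace[OF S order_refl]]
  have xs: "x \<otimes>\<^bsub>A\<^esub> s \<in> prod_span K A (carrier A) S" "s \<otimes>\<^bsub>A\<^esub> x \<in> prod_span K A S (carrier A)"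
    using assms by (simp_all add: prod_in_prod_span)
  have "x \<otimes>\<^bsub>A\<^esub> s \<oplus>\<^bsub>A\<^esub> \<zero>\<^bsub>A\<^esub> \<in> comm_span K A S" "\<zero>\<^bsub>A\<^esub> \<oplus>\<^bsub>A\<^esub> s \<otimes>\<^bsub>A\<^esub> x \<in> comm_span K A S"
    using xs l(3) r(3) unfolding comm_span_def set_add_def' by blast+
  then show "x \<otimes>\<^bsub>A\<^esub> s \<in> comm_span K A S" "s \<otimes>\<^bsub>A\<^esub> x \<in> comm_span K A S"
    using assms prod_closed by (auto simp: subset_iff)
qed

lemma comm_span_least:
  assumes N: "subspace K N A"
    and "\<And>x s. x \<in> carrier A \<Longrightarrow> s \<in> S \<Longrightarrow> x \<otimes>\<^bsub>A\<^esub> s \<in> N"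
    and "\<And>x s. x \<in> carrier A \<Longrightarrow> s \<in> S \<Longrightarrow> s \<otimes>\<^bsub>A\<^esub> x \<in> N"
  shows "comm_span K A S \<subseteq> N"
proof -
  have "prod_span K A (carrier A) S \<subseteq> N" "prod_span K A S (carrier A) \<subseteq> N"
    by (rule prod_span_least[OF N]; use assms(2,3) in blast)+
  then show ?thesis using subspaceD(4)[OF N] by (auto simp: comm_span_def set_add_def')
qed

lemma comm_span_subset_derived:
  assumes "S \<subseteq> carrier A"
  shows "comm_span K A S \<subseteq> derived_ideal K A"
  by (rule comm_span_least[OF derived_subspace]) (use assms prod_in_derived in blast)+

lemma comm_span_subset_ideal:
  assumes "alg_ideal K A I"
  shows "comm_span K A I \<subseteq> I"
  by (rule comm_span_least[OF alg_idealD(1)[OF assms]]) (use alg_idealD(2,3)[OF assms] in blast)+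

text \<open>In x'y' - xy = (x' - x)y' + x(y' - y) each summand has a factor in \<open>I\<close>.
  Landing in \<open>comm_span K A I\<close>, and not just in \<open>I\<close>, is what bounds
  \<open>F'\<close> modulo \<open>FR + RF\<close> and what makes \<open>\<theta>\<close> independent
  of representatives.\<close>

lemma prod_cong_comm_span:
  assumes I: "alg_ideal K A I"
    and x: "x \<in> carrier A" "x' \<in> carrier A" "x' \<ominus>\<^bsub>A\<^esub> x \<in> I"
    and y: "y \<in> carrier A" "y' \<in> carrier A" "y' \<ominus>\<^bsub>A\<^esub> y \<in> I"
  shows "x' \<otimes>\<^bsub>A\<^esub> y' \<ominus>\<^bsub>A\<^esub> x \<otimes>\<^bsub>A\<^esub> y \<in> comm_span K A I"
proof -
  note IA = subspaceD(2)[OF alg_idealD(1)[OF I]]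
  have "x' \<otimes>\<^bsub>A\<^esub> y' \<ominus>\<^bsub>A\<^esub> x \<otimes>\<^bsub>A\<^esub> y = (x' \<otimes>\<^bsub>A\<^esub> y' \<ominus>\<^bsub>A\<^esub> x \<otimes>\<^bsub>A\<^esub> y') \<oplus>\<^bsub>A\<^esub> (x \<otimes>\<^bsub>A\<^esub> y' \<ominus>\<^bsub>A\<^esub> x \<otimes>\<^bsub>A\<^esub> y)"
    using x y by (simp add: prod_closed a_minus_def M.a_assoc M.r_neg1)
  also have "\<dots> = (x' \<ominus>\<^bsub>A\<^esub> x) \<otimes>\<^bsub>A\<^esub> y' \<oplus>\<^bsub>A\<^esub> x \<otimes>\<^bsub>A\<^esub> (y' \<ominus>\<^bsub>A\<^esub> y)"
    using x y by (simp add: prod_minus_left prod_minus_right)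
  finally show ?thesis
    using subspaceD(4)[OF comm_span_subspace[OF IA]] prod_in_comm_span[OF IA] x y by simp
qed

lemma ideal_prod_cong:
  assumes I: "alg_ideal K A I"
    and x: "x \<in> carrier A" "x' \<in> carrier A" "x' \<ominus>\<^bsub>A\<^esub> x \<in> I"
    and y: "y \<in> carrier A" "y' \<in> carrier A" "y' \<ominus>\<^bsub>A\<^esub> y \<in> I"
  shows "x' \<otimes>\<^bsub>A\<^esub> y' \<ominus>\<^bsub>A\<^esub> x \<otimes>\<^bsub>A\<^esub> y \<in> I"
  using prod_cong_comm_span[OF assms] comm_span_subset_ideal[OF I] by blast

section \<open>Quotient algebras and transported products\<close>

lemma quot_alg_hom:
  assumes I: "alg_ideal K A I"
  shows "alg_hom K A (quot A I) (\<lambda>x. I +>\<^bsub>A\<^esub> x)"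
proof -
  note N = alg_idealD(1)[OF I]
  have "(I +>\<^bsub>A\<^esub> x) \<otimes>\<^bsub>quot A I\<^esub> (I +>\<^bsub>A\<^esub> y) = I +>\<^bsub>A\<^esub> (x \<otimes>\<^bsub>A\<^esub> y)"
    if "x \<in> carrier A" "y \<in> carrier A" for x y
    using that by (intro coset_mult[OF N])
      (simp_all add: coset_eq_iff[OF N] prod_closed ideal_prod_cong[OF I])
  then show ?thesis by (simp add: alg_hom_def quot_linear_map[OF N])
qed

lemma alg_hom_kernel_ideal:
  assumes h: "alg_hom K A B h" and "bilinear_algebra K B"
  shows "alg_ideal K A (a_kernel A B h)"
proof -
  interpret B: bilinear_algebra K B by fact
  show ?thesis
    unfolding alg_ideal_def
    using linear_map_kernel_subspace[OF alg_homD(1)[OF h]] linear_mapD(3)[OF alg_homD(1)[OF h]]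
    by (simp add: in_a_kernel prod_closed alg_homD(2)[OF h] B.prod_zero_left B.prod_zero_right)
qed

text \<open>Transport of structure: elements of \<open>W\<close> are multiplied through arbitrary
  preimages. As the kernel is an ideal, another choice of preimages changes the product only by an
  element of the kernel. This later puts a product on a coordinate space.\<close>

lemma push_product:
  fixes c W
  assumes c: "linear_map K A W c" and surj: "c ` carrier A = carrier W"
    and I: "alg_ideal K A (a_kernel A W c)"
  defines "s \<equiv> inv_into (carrier A) c"
  shows "alg_hom K A (W\<lparr>mult := \<lambda>x y. c (s x \<otimes>\<^bsub>A\<^esub> s y)\<rparr>) c"
proof -
  note lin = linear_mapD[OF c]
  interpret W: vectorspace K W by (rule lin(2))
  let ?B = "W\<lparr>mult := \<lambda>x y. c (s x \<otimes>\<^bsub>A\<^esub> s y)\<rparr>"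
  have "vectorspace K ?B"
    by (rule vectorspace_image[OF lin(2), of ?B "\<lambda>x. x"]) simp_all
  then have "linear_map K A ?B c"
    by (intro linear_mapI) (simp_all add: lin)
  moreover have "c (s (c x) \<otimes>\<^bsub>A\<^esub> s (c y)) = c (x \<otimes>\<^bsub>A\<^esub> y)"
    if x: "x \<in> carrier A" and y: "y \<in> carrier A" for x y
  proof -
    have s: "s (c v) \<in> carrier A" "s (c v) \<ominus>\<^bsub>A\<^esub> v \<in> a_kernel A W c" if "v \<in> carrier A" for v
      using that inv_into_into[of "c v" c "carrier A"] f_inv_into_f[of "c v" c "carrier A"]
      by (simp_all add: s_def in_a_kernel lin)
    have "s (c x) \<otimes>\<^bsub>A\<^esub> s (c y) \<ominus>\<^bsub>A\<^esub> x \<otimes>\<^bsub>A\<^esub> y \<in> a_kernel A W c"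
      by (rule ideal_prod_cong[OF I]) (use s x y in auto)
    then show ?thesis
      using x y s by (simp add: in_a_kernel lin prod_closed)
  qed
  ultimately show ?thesis by (simp add: alg_hom_def)
qed

lemma first_isomorphism:
  assumes h: "alg_hom K A B h" and surj: "h ` carrier A = carrier B"
    and I: "alg_ideal K A (a_kernel A B h)"
  obtains \<phi> where "alg_iso K (quot A (a_kernel A B h)) B \<phi>"
proof -
  let ?I = "a_kernel A B h"
  let ?q = "\<lambda>x. ?I +>\<^bsub>A\<^esub> x"
  note N = alg_idealD(1)[OF I] and q = quot_alg_hom[OF I] and lin = linear_mapD[OF alg_homD(1)[OF h]]
  interpret B: vectorspace K B by (rule lin(2))
  have q_surj: "?q ` carrier A = carrier (quot A ?I)" by (simp add: quot_simps)
  obtain \<phi> where \<phi>: "linear_map K (quot A ?I) B \<phi>" "\<And>x. x \<in> carrier A \<Longrightarrow> \<phi> (?q x) = h x"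
    by (rule linear_map_factor[OF alg_homD(1)[OF q] alg_homD(1)[OF h] q_surj])
       (simp add: coset_eq_zero[OF N], simp add: in_a_kernel, blast)
  have "\<phi> (X \<otimes>\<^bsub>quot A ?I\<^esub> Y) = \<phi> X \<otimes>\<^bsub>B\<^esub> \<phi> Y"
    if X: "X \<in> carrier (quot A ?I)" and Y: "Y \<in> carrier (quot A ?I)" for X Y
  proof -
    obtain x where x: "x \<in> carrier A" "X = ?q x" using X by (auto simp: quot_simps)
    obtain y where y: "y \<in> carrier A" "Y = ?q y" using Y by (auto simp: quot_simps)
    show ?thesis
      using alg_homD(2)[OF q x(1) y(1), symmetric] x y alg_homD(2)[OF h]
      by (simp add: \<phi>(2) prod_closed)
  qed
  moreover have "inj_on \<phi> (carrier (quot A ?I))"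
  proof (rule inj_onI)
    fix X Y assume X: "X \<in> carrier (quot A ?I)" and Y: "Y \<in> carrier (quot A ?I)" and eq: "\<phi> X = \<phi> Y"
    obtain x where x: "x \<in> carrier A" "X = ?q x" using X by (auto simp: quot_simps)
    obtain y where y: "y \<in> carrier A" "Y = ?q y" using Y by (auto simp: quot_simps)
    have "h (x \<ominus>\<^bsub>A\<^esub> y) = \<zero>\<^bsub>B\<^esub>" using eq x y \<phi>(2) lin(3) by (simp add: lin(7))
    then show "X = Y" using x y by (simp add: coset_eq_iff[OF N] in_a_kernel)
  qed
  moreover have "\<phi> ` carrier (quot A ?I) = carrier B"
    using \<phi>(2) by (simp add: surj[symmetric] q_surj[symmetric] image_image)
  ultimately have "alg_iso K (quot A ?I) B \<phi>"
    using \<phi>(1) by (simp add: alg_iso_def alg_hom_def bij_betw_def)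
  then show ?thesis by (rule that)
qed

end

section \<open>Free vector spaces\<close>

lemma free_vs_simps:
  "f \<in> carrier (free_vs K S) \<longleftrightarrow> (\<forall>s \<in> S. f s \<in> carrier K) \<and> (\<forall>s. s \<notin> S \<longrightarrow> f s = \<zero>\<^bsub>K\<^esub>) \<and>
    finite {s. f s \<noteq> \<zero>\<^bsub>K\<^esub>}"
  "\<zero>\<^bsub>free_vs K S\<^esub> = (\<lambda>s. \<zero>\<^bsub>K\<^esub>)"
  "f \<oplus>\<^bsub>free_vs K S\<^esub> g = (\<lambda>s. f s \<oplus>\<^bsub>K\<^esub> g s)"
  "a \<odot>\<^bsub>free_vs K S\<^esub> f = (\<lambda>s. a \<otimes>\<^bsub>K\<^esub> f s)"
  by (simp_all add: free_vs_def)

context field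
begin

lemma free_vs_in_field: "f \<in> carrier (free_vs R S) \<Longrightarrow> f s \<in> carrier R"
  by (cases "s \<in> S") (auto simp: free_vs_simps)

lemma free_vs_vectorspace: "vectorspace R (free_vs R S)"
proof -
  have add: "(\<lambda>s. f s \<oplus> g s) \<in> carrier (free_vs R S)"
    if "f \<in> carrier (free_vs R S)" "g \<in> carrier (free_vs R S)" for f g
  proof -
    have "{s. f s \<oplus> g s \<noteq> \<zero>} \<subseteq> {s. f s \<noteq> \<zero>} \<union> {s. g s \<noteq> \<zero>}" by auto
    then have "finite {s. f s \<oplus> g s \<noteq> \<zero>}"
      using that by (auto simp: free_vs_simps intro: finite_subset)
    then show ?thesis using that by (simp add: free_vs_simps)
  qed
  have smult: "(\<lambda>s. a \<otimes> f s) \<in> carrier (free_vs R S)"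
    if f: "f \<in> carrier (free_vs R S)" and a: "a \<in> carrier R" for a f
  proof -
    have "{s. a \<otimes> f s \<noteq> \<zero>} \<subseteq> {s. f s \<noteq> \<zero>}" using a by auto
    then have "finite {s. a \<otimes> f s \<noteq> \<zero>}"
      using f by (auto simp: free_vs_simps intro: finite_subset)
    then show ?thesis using f a by (simp add: free_vs_simps)
  qed
  have neg: "\<exists>g\<in>carrier (free_vs R S). (\<lambda>s. f s \<oplus> g s) = (\<lambda>s. \<zero>)"
    if "f \<in> carrier (free_vs R S)" for f
    using smult[OF that, of "\<ominus> \<one>"] free_vs_in_field[OF that]
    by (intro bexI[of _ "\<lambda>s. \<ominus> \<one> \<otimes> f s"]) (simp_all add: l_minus r_neg)
  show ?thesis
    by (rule vs_criteria)
       (use neg in \<open>auto simp: free_vs_simps(2-4) add smult free_vs_in_field a_ac m_assoc l_distr r_distr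
          field_axioms\<close>, simp add: free_vs_simps)
qed

lemma unit_vec_carrier: "s \<in> S \<Longrightarrow> unit_vec R s \<in> carrier (free_vs R S)"
  by (auto simp: free_vs_simps unit_vec_def)

text \<open>A finitely supported function is taken apart one point of its support at a time.\<close>

lemma free_vs_subspace_induct:
  assumes N: "subspace R N (free_vs R S)" and unit: "\<And>s. s \<in> S \<Longrightarrow> unit_vec R s \<in> N"
  shows "N = carrier (free_vs R S)"
proof
  note ND = subspaceD[OF N]
  show "N \<subseteq> carrier (free_vs R S)" by (rule ND(2))
  have "f \<in> N" if "finite A" "f \<in> carrier (free_vs R S)" "{s. f s \<noteq> \<zero>} = A" for A f
    using that
  proof (induction A arbitrary: f rule: finite_induct)
    case empty
    then have "f = \<zero>\<^bsub>free_vs R S\<^esub>" by (auto simp: free_vs_simps)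
    then show ?case using ND(3) by simp
  next
    case (insert a A)
    then have a: "a \<in> S" "f a \<in> carrier R" by (auto simp: free_vs_simps)
    define g where "g = f(a := \<zero>)"
    have supp: "{s. g s \<noteq> \<zero>} = A" using insert.hyps insert.prems(2) by (auto simp: g_def)
    have "g \<in> carrier (free_vs R S)"
      using insert.prems(1) insert.hyps(1) supp by (auto simp: free_vs_simps g_def)
    then have "g \<in> N" using insert.IH supp by simp
    moreover have "f = g \<oplus>\<^bsub>free_vs R S\<^esub> (f a \<odot>\<^bsub>free_vs R S\<^esub> unit_vec R a)"
      using a free_vs_in_field[OF insert.prems(1)]
      by (auto simp: free_vs_simps g_def unit_vec_def)
    ultimately show ?case using ND(4,5) unit[OF a(1)] a(2) by metis
  qed
  then show "carrier (free_vs R S) \<subseteq> N" by (auto simp: free_vs_simps)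
qed

lemma free_vs_extend:
  assumes V: "vectorspace R V" and g: "\<And>s. s \<in> S \<Longrightarrow> g s \<in> carrier V"
  obtains h where "linear_map R (free_vs R S) V h" and "\<And>s. s \<in> S \<Longrightarrow> h (unit_vec R s) = g s"
proof -
  interpret V: vectorspace R V by (rule V)
  define h where "h f = finsum V (\<lambda>s. f s \<odot>\<^bsub>V\<^esub> g s) {s. f s \<noteq> \<zero>}" for f
  \<comment> \<open>Sums over any finite set that contains the support are allowed, because the
    support of a sum or of a multiple can shrink.\<close>
  have h: "h f = finsum V (\<lambda>s. f s \<odot>\<^bsub>V\<^esub> g s) A"
    if f: "f \<in> carrier (free_vs R S)" and A: "finite A" "{s. f s \<noteq> \<zero>} \<subseteq> A" "A \<subseteq> S" for f A
    unfolding h_def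
    by (rule V.M.add.finprod_mono_neutral_cong_left)
       (use A g free_vs_in_field[OF f] in \<open>auto\<close>)
  have supp: "finite {s. f s \<noteq> \<zero>}" "{s. f s \<noteq> \<zero>} \<subseteq> S" if "f \<in> carrier (free_vs R S)" for f
    using that by (auto simp: free_vs_simps)
  have "linear_map R (free_vs R S) V h"
  proof (rule linear_mapI)
    fix f assume f: "f \<in> carrier (free_vs R S)"
    let ?A = "{s. f s \<noteq> \<zero>}"
    show "h f \<in> carrier V"
      unfolding h_def using supp(2)[OF f] g free_vs_in_field[OF f]
      by (intro V.M.finsum_closed) auto
    show "h (a \<odot>\<^bsub>free_vs R S\<^esub> f) = a \<odot>\<^bsub>V\<^esub> h f" if a: "a \<in> carrier R" for a
    proof -
      have c: "a \<odot>\<^bsub>free_vs R S\<^esub> f \<in> carrier (free_vs R S)"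
        by (rule subspaceD(5)[OF carrier_subspace[OF free_vs_vectorspace] a f])
      have "h (a \<odot>\<^bsub>free_vs R S\<^esub> f) = finsum V (\<lambda>s. (a \<otimes> f s) \<odot>\<^bsub>V\<^esub> g s) ?A"
        using h[OF c supp(1)[OF f]] supp(2)[OF f] a free_vs_in_field[OF f]
        by (force simp: free_vs_simps(4))
      also have "\<dots> = finsum V (\<lambda>s. a \<odot>\<^bsub>V\<^esub> (f s \<odot>\<^bsub>V\<^esub> g s)) ?A"
        by (rule V.M.finsum_cong')
           (use supp(2)[OF f] g a free_vs_in_field[OF f] in \<open>auto simp: V.smult_assoc1\<close>)
      also have "\<dots> = a \<odot>\<^bsub>V\<^esub> h f"
        unfolding h_def
        by (rule V.finsum_smult[symmetric])
           (use supp(2)[OF f] g a free_vs_in_field[OF f] in auto)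
      finally show ?thesis .
    qed
    fix f' assume f': "f' \<in> carrier (free_vs R S)"
    let ?B = "?A \<union> {s. f' s \<noteq> \<zero>}"
    have B: "finite ?B" "?B \<subseteq> S" using supp[OF f] supp[OF f'] by auto
    have c: "f \<oplus>\<^bsub>free_vs R S\<^esub> f' \<in> carrier (free_vs R S)"
      by (rule subspaceD(4)[OF carrier_subspace[OF free_vs_vectorspace] f f'])
    have "h (f \<oplus>\<^bsub>free_vs R S\<^esub> f') = finsum V (\<lambda>s. (f s \<oplus> f' s) \<odot>\<^bsub>V\<^esub> g s) ?B"
      by (subst h[OF c B(1) _ B(2)]) (auto simp: free_vs_simps(3))
    also have "\<dots> = finsum V (\<lambda>s. f s \<odot>\<^bsub>V\<^esub> g s \<oplus>\<^bsub>V\<^esub> f' s \<odot>\<^bsub>V\<^esub> g s) ?B"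
      by (rule V.M.finsum_cong')
         (use B(2) g free_vs_in_field[OF f] free_vs_in_field[OF f']
           in \<open>auto simp: V.smult_l_distr\<close>)
    also have "\<dots> = finsum V (\<lambda>s. f s \<odot>\<^bsub>V\<^esub> g s) ?B \<oplus>\<^bsub>V\<^esub> finsum V (\<lambda>s. f' s \<odot>\<^bsub>V\<^esub> g s) ?B"
      by (rule V.M.finsum_addf)
         (use B(2) g free_vs_in_field[OF f] free_vs_in_field[OF f'] in auto)
    also have "\<dots> = h f \<oplus>\<^bsub>V\<^esub> h f'"
      using h[OF f B(1) _ B(2)] h[OF f' B(1) _ B(2)] by simp
    finally show "h (f \<oplus>\<^bsub>free_vs R S\<^esub> f') = h f \<oplus>\<^bsub>V\<^esub> h f'" .
  qed (rule free_vs_vectorspace V)+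
  moreover have "h (unit_vec R s) = g s" if "s \<in> S" for s
    using h[OF unit_vec_carrier[OF that], of "{s}"] that g
    by (auto simp: unit_vec_def)
  ultimately show ?thesis by (rule that)
qed

end

section \<open>Tensor products\<close>

definition bilinear_map where
  "bilinear_map K V W P b \<longleftrightarrow>
    (\<forall>w\<in>carrier W. linear_map K V P (\<lambda>v. b v w)) \<and> (\<forall>v\<in>carrier V. linear_map K W P (b v))"

lemma tensor_relations_subspace:
  assumes "field K" and V: "vectorspace K V" and W: "vectorspace K W"
  shows "subspace K (tensor_relations K V W) (free_vs K (carrier V \<times> carrier W))"
proof -
  interpret field K by fact
  let ?A = "free_vs K (carrier V \<times> carrier W)"
  interpret A: vectorspace K ?A by (rule free_vs_vectorspace)
  interpret V: vectorspace K V by (rule V)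
  interpret W: vectorspace K W by (rule W)
  have "unit_vec K (v, w) \<in> carrier ?A" if "v \<in> carrier V" "w \<in> carrier W" for v w
    using that by (intro unit_vec_carrier) simp
  then show ?thesis
    unfolding tensor_relations_def Let_def by (intro A.span_is_subspace) auto
qed

lemma pure_tensor_carrier:
  assumes V: "vectorspace K V" and W: "vectorspace K W" and "v \<in> carrier V" and "w \<in> carrier W"
  shows "pure_tensor K V W v w \<in> carrier (tensor_space K V W)"
proof -
  have K: "field K" using V by (simp add: vectorspace_def)
  then interpret field K .
  have "unit_vec K (v, w) \<in> carrier (free_vs K (carrier V \<times> carrier W))"
    by (rule unit_vec_carrier) (simp add: assms)
  then show ?thesis
    unfolding pure_tensor_def tensor_space_def
    by (rule linear_mapD(3)[OF quot_linear_map[OF tensor_relations_subspace[OF K V W]]])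
qed

text \<open>The linear extension of \<open>b\<close> to the free space on pairs kills the four kinds
  of generating relations, which is what bilinearity says, and so descends to the quotient.\<close>

lemma tensor_lift:
  assumes "field K" and V: "vectorspace K V" and W: "vectorspace K W" and P: "vectorspace K P"
    and b: "bilinear_map K V W P b"
  obtains h where "linear_map K (tensor_space K V W) P h"
    and "\<And>v w. v \<in> carrier V \<Longrightarrow> w \<in> carrier W \<Longrightarrow> h (pure_tensor K V W v w) = b v w"
proof -
  interpret field K by fact
  let ?S = "carrier V \<times> carrier W"
  let ?A = "free_vs K ?S"
  let ?T = "tensor_relations K V W"
  note T = tensor_relations_subspace[OF assms(1-3)]
  interpret A: vectorspace K ?A by (rule free_vs_vectorspace)
  interpret V: vectorspace K V by (rule V)
  interpret W: vectorspace K W by (rule W)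
  interpret P: vectorspace K P by (rule P)
  note bl = linear_mapD[OF bspec[OF conjunct1[OF b[unfolded bilinear_map_def]]]]
  note br = linear_mapD[OF bspec[OF conjunct2[OF b[unfolded bilinear_map_def]]]]
  obtain g where g: "linear_map K ?A P g"
    and g_unit: "\<And>s. s \<in> ?S \<Longrightarrow> g (unit_vec K s) = (case s of (v, w) \<Rightarrow> b v w)"
    by (rule free_vs_extend[OF P, of ?S "\<lambda>(v, w). b v w"]) (auto simp: bl)
  note gD = linear_mapD[OF g]
  note unit = unit_vec_carrier[of _ ?S]
  have rel: "?T \<subseteq> a_kernel ?A P g"
    unfolding tensor_relations_def Let_def
    by (rule span_in_subspace[OF linear_map_kernel_subspace[OF g]])
       (auto simp: in_a_kernel gD unit g_unit bl(3-5) br(3-5))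
  have surj: "(+>\<^bsub>?A\<^esub>) ?T ` carrier ?A = carrier (quot ?A ?T)" by (simp add: quot_simps)
  have ker: "g x = \<zero>\<^bsub>P\<^esub>" if "x \<in> carrier ?A" "?T +>\<^bsub>?A\<^esub> x = \<zero>\<^bsub>quot ?A ?T\<^esub>" for x
    using that rel by (auto simp: coset_eq_zero[OF T] in_a_kernel)
  obtain h where h: "linear_map K (quot ?A ?T) P h" "\<And>x. x \<in> carrier ?A \<Longrightarrow> h (?T +>\<^bsub>?A\<^esub> x) = g x"
    using linear_map_factor[OF quot_linear_map[OF T] g surj ker] by blast
  show ?thesis
  proof (rule that)
    show "linear_map K (tensor_space K V W) P h" using h(1) by (simp add: tensor_space_def)
    show "h (pure_tensor K V W v w) = b v w" if "v \<in> carrier V" "w \<in> carrier W" for v w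
      using that by (simp add: pure_tensor_def h(2) unit g_unit)
  qed
qed

text \<open>Pulled back to the free space on pairs, \<open>N\<close> contains all unit vectors. This
  takes the place of an expansion of tensors into pure ones.\<close>

lemma tensor_subspace_induct:
  assumes "field K" and V: "vectorspace K V" and W: "vectorspace K W"
    and N: "subspace K N (tensor_space K V W)"
    and pure: "\<And>v w. v \<in> carrier V \<Longrightarrow> w \<in> carrier W \<Longrightarrow> pure_tensor K V W v w \<in> N"
  shows "N = carrier (tensor_space K V W)"
proof
  interpret field K by fact
  let ?A = "free_vs K (carrier V \<times> carrier W)"
  let ?q = "\<lambda>x. tensor_relations K V W +>\<^bsub>?A\<^esub> x"
  note q = quot_linear_map[OF tensor_relations_subspace[OF assms(1-3)], folded tensor_space_def]
  show "N \<subseteq> carrier (tensor_space K V W)" by (rule subspaceD(2)[OF N])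
  have "{x \<in> carrier ?A. ?q x \<in> N} = carrier ?A"
    by (rule free_vs_subspace_induct[OF linear_map_vimage_subspace[OF q N]])
       (use pure in \<open>auto simp: pure_tensor_def intro: unit_vec_carrier\<close>)
  then show "carrier (tensor_space K V W) \<subseteq> N"
    by (auto simp: tensor_space_def quot_simps)
qed

text \<open>Descent in one variable at a time: for fixed \<open>w\<close> the map in
  \<open>v\<close> factors through \<open>g\<close>, and for fixed \<open>v\<close> the map in
  \<open>w\<close> factors through \<open>h\<close>. Each partial factorization makes the choices in
  the other one harmless.\<close>

lemma bilinear_map_factor:
  assumes g: "linear_map K V V' g" and g_surj: "g ` carrier V = carrier V'"
    and h: "linear_map K W W' h" and h_surj: "h ` carrier W = carrier W'"
    and b: "bilinear_map K V W P b"
    and bg: "\<And>v w. v \<in> carrier V \<Longrightarrow> w \<in> carrier W \<Longrightarrow> g v = \<zero>\<^bsub>V'\<^esub> \<Longrightarrow> b v w = \<zero>\<^bsub>P\<^esub>"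
    and bh: "\<And>v w. v \<in> carrier V \<Longrightarrow> w \<in> carrier W \<Longrightarrow> h w = \<zero>\<^bsub>W'\<^esub> \<Longrightarrow> b v w = \<zero>\<^bsub>P\<^esub>"
  obtains b' where "bilinear_map K V' W' P b'"
    and "\<And>v w. v \<in> carrier V \<Longrightarrow> w \<in> carrier W \<Longrightarrow> b' (g v) (h w) = b v w"
proof -
  have bl: "linear_map K V P (\<lambda>v. b v w)" if "w \<in> carrier W" for w
    using b that by (simp add: bilinear_map_def)
  have br: "linear_map K W P (b v)" if "v \<in> carrier V" for v
    using b that by (simp add: bilinear_map_def)
  define k where "k w = (SOME f. linear_map K V' P f \<and> (\<forall>v\<in>carrier V. f (g v) = b v w))" for w
  define l where "l v = (SOME f. linear_map K W' P f \<and> (\<forall>w\<in>carrier W. f (h w) = b v w))" for v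
  have k: "linear_map K V' P (k w) \<and> (\<forall>v\<in>carrier V. k w (g v) = b v w)" if w: "w \<in> carrier W" for w
  proof -
    obtain f where "linear_map K V' P f" "\<And>v. v \<in> carrier V \<Longrightarrow> f (g v) = b v w"
      using linear_map_factor[OF g bl[OF w] g_surj bg[OF _ w]] by blast
    then show ?thesis
      unfolding k_def
      using someI[of "\<lambda>f. linear_map K V' P f \<and> (\<forall>v\<in>carrier V. f (g v) = b v w)" f] by blast
  qed
  have l: "linear_map K W' P (l v) \<and> (\<forall>w\<in>carrier W. l v (h w) = b v w)" if v: "v \<in> carrier V" for v
  proof -
    obtain f where "linear_map K W' P f" "\<And>w. w \<in> carrier W \<Longrightarrow> f (h w) = b v w"
      using linear_map_factor[OF h br[OF v] h_surj bh[OF v]] by blast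
    then show ?thesis
      unfolding l_def
      using someI[of "\<lambda>f. linear_map K W' P f \<and> (\<forall>w\<in>carrier W. f (h w) = b v w)" f] by blast
  qed
  \<comment> \<open>An arbitrary preimage of \<open>y\<close> fills the second slot. On values of
    \<open>g\<close> the choice does not matter, since \<open>l v\<close> sees only the image under
    \<open>h\<close>.\<close>
  define b' where "b' x y = k (inv_into (carrier W) h y) x" for x y
  have b': "b' (g v) (h w) = b v w" if v: "v \<in> carrier V" and w: "w \<in> carrier W" for v w
  proof -
    let ?w = "inv_into (carrier W) h (h w)"
    have "?w \<in> carrier W" "h ?w = h w"
      using w by (simp_all add: inv_into_into f_inv_into_f)
    then show ?thesis using k[of ?w] l[OF v] v w by (metis b'_def)
  qed
  have "bilinear_map K V' W' P b'"
    unfolding bilinear_map_def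
  proof (intro conjI ballI)
    fix y assume "y \<in> carrier W'"
    then obtain w where w: "w \<in> carrier W" "y = h w" unfolding h_surj[symmetric] by blast
    show "linear_map K V' P (\<lambda>x. b' x y)"
    proof (rule linear_map_cong)
      show "linear_map K V' P (k w)" using k[OF w(1)] by simp
      fix x assume "x \<in> carrier V'"
      then obtain v where v: "v \<in> carrier V" "x = g v" unfolding g_surj[symmetric] by blast
      show "b' x y = k w x" using k[OF w(1)] b'[OF v(1) w(1)] v w by simp
    qed
  next
    fix x assume "x \<in> carrier V'"
    then obtain v where v: "v \<in> carrier V" "x = g v" unfolding g_surj[symmetric] by blast
    show "linear_map K W' P (b' x)"
    proof (rule linear_map_cong)
      show "linear_map K W' P (l v)" using l[OF v(1)] by simp
      fix y assume "y \<in> carrier W'"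
      then obtain w where w: "w \<in> carrier W" "y = h w" unfolding h_surj[symmetric] by blast
      show "b' x y = l v y" using l[OF v(1)] b'[OF v(1) w(1)] v w by simp
    qed
  qed
  then show ?thesis using b' that by blast
qed

text \<open>The form in which \<open>\<theta>\<close> is built: \<open>b\<close> lives on
  \<open>F\<close> and \<open>T\<close>, where the product is available, and descends to
  \<open>L/L'\<close> and \<open>Z\<close>. The last conclusion serves to bound the image of
  \<open>\<theta>\<close>.\<close>

lemma tensor_lift_factor:
  assumes g: "linear_map K V V' g" and g_surj: "g ` carrier V = carrier V'"
    and h: "linear_map K W W' h" and h_surj: "h ` carrier W = carrier W'"
    and P: "vectorspace K P" and b: "bilinear_map K V W P b"
    and bg: "\<And>v w. v \<in> carrier V \<Longrightarrow> w \<in> carrier W \<Longrightarrow> g v = \<zero>\<^bsub>V'\<^esub> \<Longrightarrow> b v w = \<zero>\<^bsub>P\<^esub>"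
    and bh: "\<And>v w. v \<in> carrier V \<Longrightarrow> w \<in> carrier W \<Longrightarrow> h w = \<zero>\<^bsub>W'\<^esub> \<Longrightarrow> b v w = \<zero>\<^bsub>P\<^esub>"
  obtains \<theta> where "linear_map K (tensor_space K V' W') P \<theta>"
    and "\<And>v w. v \<in> carrier V \<Longrightarrow> w \<in> carrier W \<Longrightarrow> \<theta> (pure_tensor K V' W' (g v) (h w)) = b v w"
    and "\<And>N x. subspace K N P \<Longrightarrow> (\<And>v w. v \<in> carrier V \<Longrightarrow> w \<in> carrier W \<Longrightarrow> b v w \<in> N) \<Longrightarrow>
      x \<in> carrier (tensor_space K V' W') \<Longrightarrow> \<theta> x \<in> N"
proof -
  note V' = linear_mapD(2)[OF g] and W' = linear_mapD(2)[OF h]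
  have K: "field K" using P by (simp add: vectorspace_def)
  obtain b' where b': "bilinear_map K V' W' P b'"
    "\<And>v w. v \<in> carrier V \<Longrightarrow> w \<in> carrier W \<Longrightarrow> b' (g v) (h w) = b v w"
    using bilinear_map_factor[OF g g_surj h h_surj b bg bh] by blast
  obtain \<theta> where \<theta>: "linear_map K (tensor_space K V' W') P \<theta>"
    "\<And>x y. x \<in> carrier V' \<Longrightarrow> y \<in> carrier W' \<Longrightarrow> \<theta> (pure_tensor K V' W' x y) = b' x y"
    using tensor_lift[OF K V' W' P b'(1)] by blast
  have pure: "\<theta> (pure_tensor K V' W' (g v) (h w)) = b v w" if "v \<in> carrier V" "w \<in> carrier W" for v w
    using that \<theta>(2) b'(2) linear_mapD(3)[OF g] linear_mapD(3)[OF h] by simp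
  have "\<theta> x \<in> N"
    if N: "subspace K N P" and bN: "\<And>v w. v \<in> carrier V \<Longrightarrow> w \<in> carrier W \<Longrightarrow> b v w \<in> N"
      and x: "x \<in> carrier (tensor_space K V' W')" for N x
  proof -
    let ?S = "{x \<in> carrier (tensor_space K V' W'). \<theta> x \<in> N}"
    have "?S = carrier (tensor_space K V' W')"
    proof (rule tensor_subspace_induct[OF K V' W' linear_map_vimage_subspace[OF \<theta>(1) N]])
      fix x y assume x: "x \<in> carrier V'" and y: "y \<in> carrier W'"
      obtain v where v: "v \<in> carrier V" "x = g v" using x unfolding g_surj[symmetric] by blast
      obtain w where w: "w \<in> carrier W" "y = h w" using y unfolding h_surj[symmetric] by blast
      have "pure_tensor K V' W' x y \<in> carrier (tensor_space K V' W')"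
        by (rule pure_tensor_carrier[OF V' W' x y])
      then show "pure_tensor K V' W' x y \<in> ?S" using pure v w bN by simp
    qed
    then show ?thesis using x by blast
  qed
  then show ?thesis using that[OF \<theta>(1) pure] by blast
qed

section \<open>Lifting from free Leibniz algebras\<close>

text \<open>\<open>free_nonassoc_algebra\<close> is \<open>free_vs\<close> with a new product, so
  linear facts have to cross an update of \<open>mult\<close>.\<close>

lemma vectorspace_mult_update: "vectorspace K (V\<lparr>mult := m\<rparr>) \<longleftrightarrow> vectorspace K V"
  using vectorspace_image[of K V "V\<lparr>mult := m\<rparr>" "\<lambda>x. x"]
    vectorspace_image[of K "V\<lparr>mult := m\<rparr>" V "\<lambda>x. x"]
  by auto

lemma linear_map_mult_update: "linear_map K V W h \<Longrightarrow> linear_map K (V\<lparr>mult := m\<rparr>) W h"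
  by (rule linear_mapI) (simp_all add: linear_mapD vectorspace_mult_update)

lemma subspace_mult_update: "subspace K S (V\<lparr>mult := m\<rparr>) \<Longrightarrow> subspace K S V"
  using subspaceD[of K S "V\<lparr>mult := m\<rparr>"]
  by (intro subspaceI) (simp_all add: vectorspace_mult_update)

lemma leibniz_identity_ideal_ideal:
  assumes "bilinear_algebra K A"
  shows "alg_ideal K A (leibniz_identity_ideal K A)"
proof -
  interpret bilinear_algebra K A by fact
  let ?P = "\<lambda>I. alg_ideal K A I \<and> (\<forall>x \<in> carrier A. \<forall>y \<in> carrier A. \<forall>z \<in> carrier A.
    x \<otimes>\<^bsub>A\<^esub> (y \<otimes>\<^bsub>A\<^esub> z) \<ominus>\<^bsub>A\<^esub> ((x \<otimes>\<^bsub>A\<^esub> y) \<otimes>\<^bsub>A\<^esub> z \<oplus>\<^bsub>A\<^esub> y \<otimes>\<^bsub>A\<^esub> (x \<otimes>\<^bsub>A\<^esub> z)) \<in> I)"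
  \<comment> \<open>The whole algebra is among the ideals being intersected. An empty family would
    have the whole type as its intersection, not a subset of \<open>carrier A\<close>.\<close>
  have carrier: "?P (carrier A)"
    by (simp add: alg_ideal_def carrier_subspace vectorspace_axioms prod_closed)
  have "subspace K (leibniz_identity_ideal K A) A"
  proof (rule subspaceI)
    show "leibniz_identity_ideal K A \<subseteq> carrier A"
      unfolding leibniz_identity_ideal_def using carrier by blast
  qed (auto simp: leibniz_identity_ideal_def vectorspace_axioms dest: subspaceD alg_idealD(1))
  then show ?thesis
    by (auto simp: alg_ideal_def leibniz_identity_ideal_def)
qed

primrec word_eval :: "('e \<Rightarrow> 'e \<Rightarrow> 'e) \<Rightarrow> ('x \<Rightarrow> 'e) \<Rightarrow> 'x word \<Rightarrow> 'e" where
  "word_eval m g (Letter x) = g x"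
| "word_eval m g (Prod u v) = m (word_eval m g u) (word_eval m g v)"

context field
begin

section \<open>The free nonassociative algebra and its universal property\<close>

lemma free_nonassoc_bilinear: "bilinear_algebra R (free_nonassoc_algebra R X)"
proof -
  let ?N = "free_nonassoc_algebra R X"
  let ?V = "free_vs R {w. letters w \<subseteq> X}"
  note inR = free_vs_in_field[of _ "{w. letters w \<subseteq> X}"]
  have N: "vectorspace R ?N"
    unfolding free_nonassoc_algebra_def
    by (rule vectorspace_mult_update[THEN iffD2, OF free_vs_vectorspace])
  have prod: "f \<otimes>\<^bsub>?N\<^esub> g = (\<lambda>w. case w of Letter x \<Rightarrow> \<zero> | Prod u v \<Rightarrow> f u \<otimes> g v)" for f g
    by (simp add: free_nonassoc_algebra_def)
  have ops: "carrier ?N = carrier ?V" "f \<oplus>\<^bsub>?N\<^esub> g = (\<lambda>s. f s \<oplus> g s)"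
    "a \<odot>\<^bsub>?N\<^esub> f = (\<lambda>s. a \<otimes> f s)" for a f g
    by (simp_all add: free_nonassoc_algebra_def free_vs_simps)
  have closed: "f \<otimes>\<^bsub>?N\<^esub> g \<in> carrier ?V" if f: "f \<in> carrier ?V" and g: "g \<in> carrier ?V" for f g
  proof -
    \<comment> \<open>A word factors in at most one way, so the support of a product is covered by
      the pairs of words from the two supports, and is finite.\<close>
    have "{w. (f \<otimes>\<^bsub>?N\<^esub> g) w \<noteq> \<zero>} \<subseteq> (\<lambda>(u, v). Prod u v) ` ({w. f w \<noteq> \<zero>} \<times> {w. g w \<noteq> \<zero>})"
    proof
      fix w assume "w \<in> {w. (f \<otimes>\<^bsub>?N\<^esub> g) w \<noteq> \<zero>}"
      then show "w \<in> (\<lambda>(u, v). Prod u v) ` ({w. f w \<noteq> \<zero>} \<times> {w. g w \<noteq> \<zero>})"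
        using inR[OF f] inR[OF g] by (cases w) (auto simp: prod)
    qed
    then have "finite {w. (f \<otimes>\<^bsub>?N\<^esub> g) w \<noteq> \<zero>}"
      using f g by (auto simp: free_vs_simps intro: finite_subset)
    moreover have "(f \<otimes>\<^bsub>?N\<^esub> g) w \<in> carrier R" for w
      using inR[OF f] inR[OF g] by (cases w) (auto simp: prod)
    moreover have "(f \<otimes>\<^bsub>?N\<^esub> g) w = \<zero>" if "\<not> letters w \<subseteq> X" for w
    proof (cases w)
      case (Prod u v)
      then have "f u = \<zero> \<or> g v = \<zero>" using that f g by (auto simp: free_vs_simps)
      then show ?thesis using inR[OF f] inR[OF g] Prod by (auto simp: prod)
    qed (simp add: prod)
    ultimately show ?thesis by (simp add: free_vs_simps)
  qed
  show ?thesis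
  proof (intro bilinear_algebra.intro bilinear_algebra_axioms.intro N; unfold ops)
    show "\<And>f g. f \<in> carrier ?V \<Longrightarrow> g \<in> carrier ?V \<Longrightarrow> f \<otimes>\<^bsub>?N\<^esub> g \<in> carrier ?V" by (rule closed)
  qed (auto simp: prod inR l_distr r_distr m_assoc m_lcomm fun_eq_iff split: word.split)
qed

lemma unit_vec_prod:
  "unit_vec R u \<otimes>\<^bsub>free_nonassoc_algebra R X\<^esub> unit_vec R v = unit_vec R (Prod u v)"
  by (auto simp: free_nonassoc_algebra_def unit_vec_def fun_eq_iff split: word.split)

lemma free_nonassoc_subspace_induct:
  assumes "subspace R N (free_nonassoc_algebra R X)"
    and "\<And>w. letters w \<subseteq> X \<Longrightarrow> unit_vec R w \<in> N"
  shows "N = carrier (free_nonassoc_algebra R X)"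
  using free_vs_subspace_induct[OF subspace_mult_update[OF assms(1)[unfolded free_nonassoc_algebra_def]]]
    assms(2)
  by (simp add: free_nonassoc_algebra_def)

text \<open>Words form a basis, on which \<open>G\<close> is forced to be evaluation in
  \<open>E\<close>. Multiplicativity spreads from words to all elements in two rounds, first in the
  right factor with a word on the left, then in the left factor.\<close>

lemma free_nonassoc_extend:
  assumes E: "bilinear_algebra R E" and g: "\<And>x. x \<in> X \<Longrightarrow> g x \<in> carrier E"
  obtains G where "alg_hom R (free_nonassoc_algebra R X) E G"
    and "\<And>x. x \<in> X \<Longrightarrow> G (unit_vec R (Letter x)) = g x"
proof -
  interpret E: bilinear_algebra R E by (rule E)
  let ?W = "{w. letters w \<subseteq> X}"
  let ?N = "free_nonassoc_algebra R X"
  let ?ev = "word_eval (mult E) g"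
  interpret N: bilinear_algebra R ?N by (rule free_nonassoc_bilinear)
  have ev: "?ev w \<in> carrier E" if "letters w \<subseteq> X" for w
    using that by (induction w) (auto simp: g E.prod_closed)
  obtain G where G: "linear_map R (free_vs R ?W) E G"
    and G_unit: "\<And>w. w \<in> ?W \<Longrightarrow> G (unit_vec R w) = ?ev w"
    using free_vs_extend[of E ?W ?ev] ev E.vectorspace_axioms by blast
  have lin: "linear_map R ?N E G"
    unfolding free_nonassoc_algebra_def by (rule linear_map_mult_update[OF G])
  note GD = linear_mapD[OF lin]
  have unit: "unit_vec R w \<in> carrier ?N" if "letters w \<subseteq> X" for w
    using unit_vec_carrier[of w ?W] that by (simp add: free_nonassoc_algebra_def)
  have unit_left: "G (unit_vec R u \<otimes>\<^bsub>?N\<^esub> f) = G (unit_vec R u) \<otimes>\<^bsub>E\<^esub> G f"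
    if u: "letters u \<subseteq> X" and f: "f \<in> carrier ?N" for u f
  proof -
    have "{f \<in> carrier ?N. G (unit_vec R u \<otimes>\<^bsub>?N\<^esub> f) = G (unit_vec R u) \<otimes>\<^bsub>E\<^esub> G f} = carrier ?N"
      by (rule free_nonassoc_subspace_induct[OF linear_map_equalizer_subspace[OF
            linear_map_comp[OF N.linear_right[OF unit[OF u]] lin]
            linear_map_comp[OF lin E.linear_right[OF GD(3)[OF unit[OF u]]]]]])
         (use u in \<open>simp add: unit_vec_prod unit G_unit\<close>)
    then show ?thesis using f by blast
  qed
  have "G (f \<otimes>\<^bsub>?N\<^esub> f') = G f \<otimes>\<^bsub>E\<^esub> G f'" if f: "f \<in> carrier ?N" and f': "f' \<in> carrier ?N" for f f'
  proof -
    have "{f \<in> carrier ?N. G (f \<otimes>\<^bsub>?N\<^esub> f') = G f \<otimes>\<^bsub>E\<^esub> G f'} = carrier ?N"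
      by (rule free_nonassoc_subspace_induct[OF linear_map_equalizer_subspace[OF
            linear_map_comp[OF N.linear_left[OF f'] lin]
            linear_map_comp[OF lin E.linear_left[OF GD(3)[OF f']]]]])
         (use f' in \<open>simp add: unit unit_left\<close>)
    then show ?thesis using f by blast
  qed
  then have "alg_hom R ?N E G" using lin by (simp add: alg_hom_def)
  then show ?thesis by (rule that) (simp add: G_unit)
qed

end

lemma alg_hom_factor:
  assumes r: "alg_hom K N F r" and G: "alg_hom K N E G" and "bilinear_algebra K N"
    and surj: "r ` carrier N = carrier F"
    and ker: "\<And>x. x \<in> carrier N \<Longrightarrow> r x = \<zero>\<^bsub>F\<^esub> \<Longrightarrow> G x = \<zero>\<^bsub>E\<^esub>"
  obtains \<rho> where "alg_hom K F E \<rho>" and "\<And>x. x \<in> carrier N \<Longrightarrow> \<rho> (r x) = G x"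
proof -
  interpret N: bilinear_algebra K N by fact
  obtain \<rho> where \<rho>: "linear_map K F E \<rho>" "\<And>x. x \<in> carrier N \<Longrightarrow> \<rho> (r x) = G x"
    using linear_map_factor[OF alg_homD(1)[OF r] alg_homD(1)[OF G] surj ker] by blast
  have "\<rho> (x \<otimes>\<^bsub>F\<^esub> y) = \<rho> x \<otimes>\<^bsub>E\<^esub> \<rho> y" if x: "x \<in> carrier F" and y: "y \<in> carrier F" for x y
  proof -
    obtain a where a: "a \<in> carrier N" "x = r a" using x surj by blast
    obtain b where b: "b \<in> carrier N" "y = r b" using y surj by blast
    show ?thesis
      using a b \<rho>(2) by (simp add: alg_homD(2)[OF r, symmetric] alg_homD(2)[OF G] N.prod_closed)
  qed
  then have "alg_hom K F E \<rho>" using \<rho>(1) by (simp add: alg_hom_def)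
  then show ?thesis by (rule that) (rule \<rho>(2))
qed

text \<open>Chosen preimages under \<open>p\<close> of the images of the letters determine a
  homomorphism \<open>G\<close> from the free nonassociative algebra to \<open>E\<close>. As
  \<open>E\<close> is Leibniz, the kernel of \<open>G\<close> is one of the ideals intersected in
  \<open>leibniz_identity_ideal\<close>, so \<open>G\<close> descends to \<open>F\<close>.\<close>

lemma free_leibniz_projective:
  assumes F: "free_leibniz_on K F X" and \<pi>: "alg_hom K F L \<pi>"
    and E: "leibniz_algebra K E" and p: "alg_hom K E L p" and p_surj: "p ` carrier E = carrier L"
  obtains \<rho> where "alg_hom K F E \<rho>" and "\<And>f. f \<in> carrier F \<Longrightarrow> p (\<rho> f) = \<pi> f"
proof -
  interpret E: leibniz_algebra K E by (rule E)
  let ?N = "free_nonassoc_algebra K X"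
  let ?J = "leibniz_identity_ideal K ?N"
  interpret N: bilinear_algebra K ?N by (rule E.free_nonassoc_bilinear)
  note J = leibniz_identity_ideal_ideal[OF N.bilinear_algebra_axioms]
  note q = N.quot_alg_hom[OF J]
  obtain \<phi> where \<phi>: "alg_hom K (quot ?N ?J) F \<phi>" "bij_betw \<phi> (carrier (quot ?N ?J)) (carrier F)"
    using F by (auto simp: free_leibniz_on_def alg_iso_def free_leibniz_def)
  define r where "r n = \<phi> (?J +>\<^bsub>?N\<^esub> n)" for n
  have r: "alg_hom K ?N F r" unfolding r_def by (rule alg_hom_comp[OF q \<phi>(1)])
  have r_surj: "r ` carrier ?N = carrier F"
    using bij_betw_imp_surj_on[OF \<phi>(2)] by (simp add: r_def quot_simps image_image)
  have r_ker: "n \<in> ?J" if n: "n \<in> carrier ?N" and "r n = \<zero>\<^bsub>F\<^esub>" for n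
  proof -
    have "\<phi> (?J +>\<^bsub>?N\<^esub> n) = \<phi> \<zero>\<^bsub>quot ?N ?J\<^esub>"
      using that linear_mapD(6)[OF alg_homD(1)[OF \<phi>(1)]] by (simp add: r_def)
    moreover have "\<zero>\<^bsub>quot ?N ?J\<^esub> \<in> carrier (quot ?N ?J)"
      using linear_mapD(3,6)[OF alg_homD(1)[OF q]] by (metis N.M.zero_closed)
    ultimately have "?J +>\<^bsub>?N\<^esub> n = \<zero>\<^bsub>quot ?N ?J\<^esub>"
      using bij_betw_imp_inj_on[OF \<phi>(2)] linear_mapD(3)[OF alg_homD(1)[OF q] n]
      by (simp add: inj_on_def)
    then show ?thesis using coset_eq_zero[OF alg_idealD(1)[OF J] n] by simp
  qed
  note rD = linear_mapD[OF alg_homD(1)[OF r]] and piD = linear_mapD[OF alg_homD(1)[OF \<pi>]]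
  have unit: "unit_vec K w \<in> carrier ?N" if "letters w \<subseteq> X" for w
    using E.unit_vec_carrier[of w "{w. letters w \<subseteq> X}"] that
    by (simp add: free_nonassoc_algebra_def)
  define g where "g x = (SOME e. e \<in> carrier E \<and> p e = \<pi> (r (unit_vec K (Letter x))))" for x
  have g: "g x \<in> carrier E \<and> p (g x) = \<pi> (r (unit_vec K (Letter x)))" if "x \<in> X" for x
  proof -
    have "\<pi> (r (unit_vec K (Letter x))) \<in> p ` carrier E"
      unfolding p_surj by (intro piD(3) rD(3) unit) (simp add: that)
    then obtain e where "e \<in> carrier E" "p e = \<pi> (r (unit_vec K (Letter x)))" by fastforce
    then show ?thesis
      unfolding g_def
      using someI[of "\<lambda>e. e \<in> carrier E \<and> p e = \<pi> (r (unit_vec K (Letter x)))" e] by simp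
  qed
  obtain G where G: "alg_hom K ?N E G" and G_unit: "\<And>x. x \<in> X \<Longrightarrow> G (unit_vec K (Letter x)) = g x"
    using E.free_nonassoc_extend[OF leibniz_bilinear[OF E], of X g] g by blast
  note GD = linear_mapD[OF alg_homD(1)[OF G]] and Gm = alg_homD(2)[OF G]
  have "alg_ideal K ?N (a_kernel ?N E G)"
    by (rule N.alg_hom_kernel_ideal[OF G leibniz_bilinear[OF E]])
  moreover have "x \<otimes>\<^bsub>?N\<^esub> (y \<otimes>\<^bsub>?N\<^esub> z) \<ominus>\<^bsub>?N\<^esub> ((x \<otimes>\<^bsub>?N\<^esub> y) \<otimes>\<^bsub>?N\<^esub> z \<oplus>\<^bsub>?N\<^esub> y \<otimes>\<^bsub>?N\<^esub> (x \<otimes>\<^bsub>?N\<^esub> z))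
      \<in> a_kernel ?N E G"
    if "x \<in> carrier ?N" "y \<in> carrier ?N" "z \<in> carrier ?N" for x y z
    using that E.left_leibniz[of "G x" "G y" "G z"]
    by (simp add: in_a_kernel N.prod_closed GD Gm E.prod_closed)
  ultimately have "?J \<subseteq> a_kernel ?N E G" by (auto simp: leibniz_identity_ideal_def)
  then have ker: "G n = \<zero>\<^bsub>E\<^esub>" if "n \<in> carrier ?N" "r n = \<zero>\<^bsub>F\<^esub>" for n
    using r_ker[OF that] by (auto simp: in_a_kernel)
  obtain \<rho> where \<rho>: "alg_hom K F E \<rho>" "\<And>n. n \<in> carrier ?N \<Longrightarrow> \<rho> (r n) = G n"
    using alg_hom_factor[OF r G N.bilinear_algebra_axioms r_surj ker] by blast
  \<comment> \<open>\<open>p\<close> after \<open>G\<close> and \<open>\<pi>\<close> after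
    \<open>r\<close> are homomorphisms that agree on letters, hence on words by induction, hence
    everywhere by linearity.\<close>
  have unit_eq: "p (G (unit_vec K w)) = \<pi> (r (unit_vec K w))" if "letters w \<subseteq> X" for w
    using that
  proof (induction w)
    case (Prod u v)
    then have u: "unit_vec K u \<in> carrier ?N" and v: "unit_vec K v \<in> carrier ?N"
      using unit by simp_all
    show ?case
      using Prod u v
      by (simp add: E.unit_vec_prod[where X = X, symmetric] Gm alg_homD(2)[OF r] alg_homD(2)[OF p]
          alg_homD(2)[OF \<pi>] GD(3) rD(3))
  qed (simp add: G_unit g)
  have "{n \<in> carrier ?N. p (G n) = \<pi> (r n)} = carrier ?N"
    by (rule E.free_nonassoc_subspace_induct[OF linear_map_equalizer_subspace[OF
          linear_map_comp[OF alg_homD(1)[OF G] alg_homD(1)[OF p]]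
          linear_map_comp[OF alg_homD(1)[OF r] alg_homD(1)[OF \<pi>]]]])
       (simp add: unit unit_eq)
  then have "p (\<rho> f) = \<pi> f" if "f \<in> carrier F" for f
    using that r_surj \<rho>(2) by (metis (mono_tags, lifting) imageE mem_Collect_eq)
  with \<rho>(1) show ?thesis by (rule that)
qed

section \<open>Complements and coordinates\<close>

text \<open>Zorn's lemma is needed since nothing is finite-dimensional here: \<open>U\<close> is
  maximal among the subspaces above \<open>A\<close> that meet \<open>P\<close> only inside
  \<open>A\<close>. For \<open>v\<close> outside \<open>U\<close>, adjoining \<open>v\<close> must
  create a new element of \<open>P\<close> with nonzero coefficient at \<open>v\<close>; dividing by
  this coefficient writes \<open>v\<close> as an element of \<open>U\<close> plus one of
  \<open>P\<close>.\<close>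

lemma subspace_complement_above:
  fixes V (structure)
  assumes A: "subspace K A V" and P: "subspace K P V" and "A \<subseteq> P"
  obtains U where "subspace K U V" and "A \<subseteq> U" and "U \<inter> P \<subseteq> A"
    and "\<And>v. v \<in> carrier V \<Longrightarrow> \<exists>u\<in>U. v \<ominus> u \<in> P"
proof -
  interpret vectorspace K V by (rule subspaceD(1)[OF A])
  let ?F = "{U. subspace K U V \<and> A \<subseteq> U \<and> U \<inter> P \<subseteq> A}"
  have "\<exists>M\<in>?F. \<forall>X\<in>?F. M \<subseteq> X \<longrightarrow> X = M"
  proof (rule subset_Zorn_nonempty)
    show "?F \<noteq> {}" using A by auto
    fix C assume C: "C \<noteq> {}" "subset.chain ?F C"
    then have CF: "X \<in> ?F" if "X \<in> C" for X using that by (auto simp: subset.chain_def)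
    have chain: "X \<subseteq> Y \<or> Y \<subseteq> X" if "X \<in> C" "Y \<in> C" for X Y
      using C(2) that by (auto simp: subset_chain_def)
    have "subspace K (\<Union>C) V"
    proof (rule subspaceI[OF vectorspace_axioms])
      show "\<Union>C \<subseteq> carrier V" using CF subspaceD(2) by fastforce
      show "\<zero> \<in> \<Union>C" using C(1) CF subspaceD(3) by fastforce
      show "c \<odot> v \<in> \<Union>C" if "c \<in> carrier K" "v \<in> \<Union>C" for c v
        using that CF subspaceD(5) by fastforce
      show "v \<oplus> w \<in> \<Union>C" if vw: "v \<in> \<Union>C" "w \<in> \<Union>C" for v w
      proof -
        obtain X Y where XY: "X \<in> C" "v \<in> X" "Y \<in> C" "w \<in> Y" using vw by blast
        then obtain Z where "Z \<in> C" "v \<in> Z" "w \<in> Z" using chain[of X Y] by blast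
        then show ?thesis using CF[of Z] subspaceD(4)[of K Z V v w] by blast
      qed
    qed
    then show "\<Union>C \<in> ?F" using C(1) CF by blast
  qed
  then obtain U where UF: "U \<in> ?F" and mx: "\<forall>X\<in>?F. U \<subseteq> X \<longrightarrow> X = U" by (rule bexE)
  have U: "subspace K U V" "A \<subseteq> U" "U \<inter> P \<subseteq> A" using UF by simp_all
  have max: "X = U" if "subspace K X V" "A \<subseteq> X" "X \<inter> P \<subseteq> A" "U \<subseteq> X" for X
    using mx that by simp
  note UD = subspaceD[OF U(1)] and PD = subspaceD[OF P]
  have "\<exists>u\<in>U. v \<ominus> u \<in> P" if v: "v \<in> carrier V" for v
  proof (cases "v \<in> U")
    case True
    then show ?thesis using PD(3) v by (intro bexI[of _ v]) (simp_all add: a_minus_def M.r_neg)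
  next
    case False
    let ?X = "{u \<oplus> c \<odot> v | u c. u \<in> U \<and> c \<in> carrier K}"
    have X: "subspace K ?X V"
    proof (rule subspaceI[OF vectorspace_axioms])
      show "?X \<subseteq> carrier V" using UD(2) v by auto
      have "\<zero> = \<zero> \<oplus> \<zero>\<^bsub>K\<^esub> \<odot> v" using v by simp
      then show "\<zero> \<in> ?X" using UD(3) by blast
    next
      fix x y assume "x \<in> ?X" "y \<in> ?X"
      then obtain a c b d where *: "x = a \<oplus> c \<odot> v" "y = b \<oplus> d \<odot> v" "a \<in> U" "b \<in> U"
        "c \<in> carrier K" "d \<in> carrier K" by blast
      then have "x \<oplus> y = (a \<oplus> b) \<oplus> (c \<oplus>\<^bsub>K\<^esub> d) \<odot> v"
        using UD(2) v by (auto simp: smult_l_distr M.a_ac subset_iff)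
      then show "x \<oplus> y \<in> ?X" using * UD(4) by blast
    next
      fix k x assume k: "k \<in> carrier K" and "x \<in> ?X"
      then obtain a c where *: "x = a \<oplus> c \<odot> v" "a \<in> U" "c \<in> carrier K" by blast
      then have "k \<odot> x = k \<odot> a \<oplus> (k \<otimes>\<^bsub>K\<^esub> c) \<odot> v"
        using UD(2) v k by (auto simp: smult_r_distr smult_assoc1 subset_iff)
      then show "k \<odot> x \<in> ?X" using * k UD(5) by blast
    qed
    have UX: "U \<subseteq> ?X"
    proof
      fix u assume "u \<in> U"
      then have "u = u \<oplus> \<zero>\<^bsub>K\<^esub> \<odot> v" using v UD(2) by auto
      then show "u \<in> ?X" using \<open>u \<in> U\<close> by blast
    qed
    have "v = \<zero> \<oplus> \<one>\<^bsub>K\<^esub> \<odot> v" using v by simp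
    then have "v \<in> ?X" using UD(3) by blast
    then have "?X \<noteq> U" using False by blast
    then have "\<not> ?X \<inter> P \<subseteq> A" using max[OF X _ _ UX] U(2) UX by blast
    then obtain u c where u: "u \<in> U" "c \<in> carrier K" "u \<oplus> c \<odot> v \<in> P" "u \<oplus> c \<odot> v \<notin> A"
      by blast
    have uV: "u \<in> carrier V" using u UD(2) by blast
    \<comment> \<open>With \<open>c\<close> zero, \<open>u\<close> would lie in both
      \<open>U\<close> and \<open>P\<close>, hence in \<open>A\<close>.\<close>
    have c: "c \<noteq> \<zero>\<^bsub>K\<^esub>"
      using u uV v U(3) by auto
    then have i: "inv\<^bsub>K\<^esub> c \<in> carrier K" "inv\<^bsub>K\<^esub> c \<otimes>\<^bsub>K\<^esub> c = \<one>\<^bsub>K\<^esub>"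
      using u(2) field_Units by auto
    have "inv\<^bsub>K\<^esub> c \<odot> (u \<oplus> c \<odot> v) = v \<ominus> (\<ominus> (inv\<^bsub>K\<^esub> c \<odot> u))"
      using uV v u(2) i by (simp add: smult_r_distr smult_assoc1[symmetric] a_minus_def M.a_comm)
    then have "v \<ominus> (\<ominus> (inv\<^bsub>K\<^esub> c \<odot> u)) \<in> P" using PD(5)[OF i(1) u(3)] by simp
    then show ?thesis using UD(6)[OF UD(5)[OF i(1) u(1)]] by blast
  qed
  then show ?thesis using U that by blast
qed

section \<open>Coordinates and a dimension count\<close>

lemma linear_map_inverse:
  assumes h: "linear_map K V W h" and bij: "bij_betw h (carrier V) (carrier W)"
  obtains c where "linear_map K W V c" and "bij_betw c (carrier W) (carrier V)"
proof -
  note hD = linear_mapD[OF h]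
  interpret V: vectorspace K V by (rule hD(1))
  have id: "linear_map K V V (\<lambda>x. x)" by (rule linear_mapI) (simp_all add: hD(1))
  have ker: "x = \<zero>\<^bsub>V\<^esub>" if "x \<in> carrier V" "h x = \<zero>\<^bsub>W\<^esub>" for x
    using bij that hD(6) by (metis V.M.zero_closed bij_betw_imp_inj_on inj_onD)
  have surj: "h ` carrier V = carrier W" by (rule bij_betw_imp_surj_on[OF bij])
  obtain c where c: "linear_map K W V c" "\<And>x. x \<in> carrier V \<Longrightarrow> c (h x) = x"
    using linear_map_factor[OF h id surj ker] by blast
  have "bij_betw c (carrier W) (carrier V)"
    unfolding surj[symmetric]
    by (rule bij_betw_byWitness[where f' = h]) (use c(2) hD(3) in auto)
  with c(1) show ?thesis by (rule that)
qed

text \<open>\<open>maximal_defining_pair\<close> compares with algebras of functions on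
  \<open>nat\<close>, so a finite-dimensional space has to be moved there before maximality can be
  applied to it.\<close>

lemma coordinates:
  assumes "vectorspace K V" and "vectorspace.fin_dim K V"
  obtains n c where "linear_map K V (free_vs K {..<n::nat}) c"
    and "bij_betw c (carrier V) (carrier (free_vs K {..<n}))"
proof -
  interpret vectorspace K V by fact
  obtain B where B: "finite B" "basis B" using finite_basis_exists assms(2) by blast
  then have BV: "B \<subseteq> carrier V" by (simp add: basis_def)
  obtain e where e: "bij_betw e {..<card B} B"
    using ex_bij_betw_nat_finite[OF B(1)] by (auto simp: atLeast0LessThan)
  let ?F = "free_vs K {..<card B}"
  define i where "i = inv_into {..<card B} e"
  have i: "i b < card B" "e (i b) = b" if "b \<in> B" for b
    using that e inv_into_into[of b e "{..<card B}"] f_inv_into_f[of b e "{..<card B}"]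
    by (auto simp: i_def bij_betw_def)
  have ie: "e k \<in> B" "i (e k) = k" if "k < card B" for k
    using that e by (auto simp: i_def bij_betw_def inv_into_f_f)
  \<comment> \<open>\<open>g\<close> renumbers the coordinates by the basis; the restriction is
    there because \<open>func_space\<close> consists of extensional functions.\<close>
  define g where "g f = restrict (\<lambda>b. f (i b)) B" for f :: "nat \<Rightarrow> 'a"
  note inF = free_vs_in_field[of _ "{..<card B}"]
  have g: "linear_map K ?F (func_space B) g"
    by (rule linear_mapI[OF free_vs_vectorspace func_space_is_vs])
       (auto simp: g_def func_space_def inF free_vs_simps(3,4))
  let ?h = "\<lambda>f. lincomb (g f) B"
  have h: "linear_map K ?F V ?h"
    by (rule linear_map_comp[OF g lincomb_is_linear[OF B(1) BV]])
  have ex1: "\<exists>!a. a \<in> B \<rightarrow>\<^sub>E carrier K \<and> lincomb a B = v" if "v \<in> carrier V" for v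
    using basis_criterion[OF B(1) BV] B(2) that by blast
  have gE: "g f \<in> B \<rightarrow>\<^sub>E carrier K" if "f \<in> carrier ?F" for f
    using inF[OF that] by (auto simp: g_def)
  have "bij_betw ?h (carrier ?F) (carrier V)"
  proof (rule bij_betwI')
    fix f f' assume f: "f \<in> carrier ?F" and f': "f' \<in> carrier ?F"
    show "?h f = ?h f' \<longleftrightarrow> f = f'"
    proof
      assume "?h f = ?h f'"
      then have eq: "g f = g f'"
        using ex1[OF linear_mapD(3)[OF h f]] gE[OF f] gE[OF f'] by metis
      show "f = f'"
      proof
        fix k
        show "f k = f' k"
        proof (cases "k < card B")
          case True
          have "g f (e k) = g f' (e k)" by (simp only: eq)
          then show ?thesis using ie[OF True] by (simp add: g_def)
        qed (use f f' in \<open>simp add: free_vs_simps\<close>)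
      qed
    qed simp
  next
    show "?h f \<in> carrier V" if "f \<in> carrier ?F" for f by (rule linear_mapD(3)[OF h that])
  next
    fix v assume "v \<in> carrier V"
    then obtain a where a: "a \<in> B \<rightarrow>\<^sub>E carrier K" "lincomb a B = v" using ex1 by blast
    define f where "f k = (if k < card B then a (e k) else \<zero>\<^bsub>K\<^esub>)" for k
    have "{k. f k \<noteq> \<zero>\<^bsub>K\<^esub>} \<subseteq> {..<card B}" by (auto simp: f_def)
    then have "f \<in> carrier ?F"
      using a(1) ie by (auto simp: free_vs_simps f_def intro: finite_subset)
    moreover have "g f = a"
      using a(1) i by (auto simp: g_def f_def fun_eq_iff PiE_def extensional_def)
    ultimately show "\<exists>f\<in>carrier ?F. v = ?h f" using a(2) by blast
  qed
  then show ?thesis using linear_map_inverse[OF h] that by blast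
qed

text \<open>Steinitz exchange: a nonzero kernel vector \<open>v\<close> can replace a member of a
  basis of \<open>V\<close>. The other vectors of the new spanning set are fewer than the dimension
  of \<open>V\<close>, and their images already span \<open>W\<close>, against the bound
  \<open>dim\<close>.\<close>

lemma surjective_imp_injective:
  assumes h: "linear_map K V W h" and surj: "h ` carrier V = carrier W"
    and fd: "vectorspace.fin_dim K V" and dim: "vectorspace.dim K V \<le> vectorspace.dim K W"
    and v: "v \<in> carrier V" "h v = \<zero>\<^bsub>W\<^esub>"
  shows "v = \<zero>\<^bsub>V\<^esub>"
proof (rule ccontr)
  assume v0: "v \<noteq> \<zero>\<^bsub>V\<^esub>"
  interpret V: vectorspace K V by (rule linear_mapD(1)[OF h])
  interpret W: vectorspace K W by (rule linear_mapD(2)[OF h])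
  have "V.lin_indpt {}" by (simp add: V.lin_dep_def)
  then have li: "V.lin_indpt {v}"
    using V.lin_dep_iff_in_span[of "{}" v] v v0 by (simp add: V.span_empty)
  obtain B where B: "finite B" "V.basis B" using V.finite_basis_exists fd by blast
  then have BV: "B \<subseteq> carrier V" "V.span B = carrier V" by (simp_all add: V.basis_def)
  obtain C where C: "finite C" "C \<subseteq> carrier V" "int (card C) \<le> int (card B) - int (card {v})"
    "V.span ({v} \<union> C) = V.span B"
    using V.replacement[OF _ B(1) BV(1) li] BV v by auto
  have hC: "h ` C \<subseteq> carrier W" using C(2) linear_mapD(3)[OF h] by auto
  note N = W.span_is_subspace[OF hC]
  have "{x \<in> carrier V. h x \<in> W.span (h ` C)} = carrier V"
  proof
    have "h ` C \<subseteq> W.span (h ` C)" by (rule W.in_own_span[OF hC])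
    then have "{v} \<union> C \<subseteq> {x \<in> carrier V. h x \<in> W.span (h ` C)}"
      using C(2) v subspaceD(3)[OF N] by auto
    from span_in_subspace[OF linear_map_vimage_subspace[OF h N] this]
    show "carrier V \<subseteq> {x \<in> carrier V. h x \<in> W.span (h ` C)}"
      unfolding C(4) BV(2) .
  qed auto
  then have "h ` carrier V \<subseteq> W.span (h ` C)" by (auto simp: set_eq_iff)
  then have "W.span (h ` C) = carrier W"
    unfolding surj by (rule equalityI[OF subspaceD(2)[OF N]])
  then have "W.dim \<le> card (h ` C)" using W.gen_ge_dim[OF _ hC] C(1) by simp
  also have "\<dots> \<le> card C" using C(1) by (rule card_image_le)
  also have "\<dots> < card B" using C(3) by simp
  also have "\<dots> = V.dim" using V.dim_basis[OF B] by simp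
  finally show False using dim by simp
qed

section \<open>The Hopf formula\<close>

lemma subspace_sumE:
  fixes V (structure)
  assumes "subspace K M V" and "subspace K N V"
  obtains S where "subspace K S V" and "M \<subseteq> S" and "N \<subseteq> S"
    and "\<And>x. x \<in> S \<Longrightarrow> \<exists>m\<in>M. x \<ominus> m \<in> N"
proof -
  interpret vectorspace K V by (rule subspaceD(1)[OF assms(1)])
  have MN: "m \<in> M \<Longrightarrow> m \<in> carrier V" "n \<in> N \<Longrightarrow> n \<in> carrier V" for m n
    using subspaceD(2) assms by blast+
  have "\<exists>m\<in>M. x \<ominus> m \<in> N" if x: "x \<in> submodule_sum M N" for x
  proof -
    obtain m n where mn: "m \<in> M" "n \<in> N" "x = m \<oplus> n" using x by (auto simp: submodule_sum_def)
    then have "x \<ominus> m = n" using MN by (simp add: a_minus_def M.a_comm[of m n] M.a_assoc M.r_neg)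
    then show ?thesis using mn by blast
  qed
  moreover have "N \<subseteq> submodule_sum M N"
    using in_sum_vs[OF assms(2,1)] vsum_comm[OF assms] by simp
  ultimately show ?thesis
    using that[OF sum_is_subspace[OF assms] in_sum_vs[OF assms]] by blast
qed

lemma surj_derived:
  assumes A: "bilinear_algebra K A" and B: "bilinear_algebra K B"
    and h: "alg_hom K A B h" and surj: "h ` carrier A = carrier B"
  shows "h ` derived_ideal K A = derived_ideal K B"
proof -
  interpret A: bilinear_algebra K A by (rule A)
  interpret B: bilinear_algebra K B by (rule B)
  note lin = alg_homD(1)[OF h]
  have "derived_ideal K A \<subseteq> {x \<in> carrier A. h x \<in> derived_ideal K B}"
    by (rule A.derived_least[OF linear_map_vimage_subspace[OF lin B.derived_subspace]])
       (simp add: A.prod_closed alg_homD(2)[OF h] B.prod_in_derived linear_mapD(3)[OF lin])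
  moreover have "derived_ideal K B \<subseteq> h ` derived_ideal K A"
  proof (rule B.derived_least[OF linear_map_image_subspace[OF lin A.derived_subspace]])
    fix x y assume "x \<in> carrier B" "y \<in> carrier B"
    then obtain a b where "a \<in> carrier A" "x = h a" "b \<in> carrier A" "y = h b"
      unfolding surj[symmetric] by blast
    then show "x \<otimes>\<^bsub>B\<^esub> y \<in> h ` derived_ideal K A"
      using A.prod_in_derived[of a b] by (auto simp: alg_homD(2)[OF h, symmetric])
  qed
  ultimately show ?thesis by blast
qed

text \<open>The quotient \<open>U/(FR + RF)\<close> is the algebra of a defining pair of maximal dimension.\<close>

lemma presentation_reduction:
  fixes F (structure)
  assumes F: "bilinear_algebra K F" and R: "alg_ideal K F R"
  obtains U where "subspace K U F" and "derived_ideal K F \<subseteq> U" and "U \<inter> R \<subseteq> derived_ideal K F"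
    and "\<And>f. f \<in> carrier F \<Longrightarrow> \<exists>u\<in>U. f \<ominus> u \<in> R"
proof -
  interpret bilinear_algebra K F by (rule F)
  note RS = alg_idealD(1)[OF R]
  \<comment> \<open>\<open>P\<close> is the sum of \<open>F'\<close> and \<open>R\<close>. The
    complement is taken relative to \<open>P\<close> and above \<open>F'\<close>, because a plain
    complement of \<open>R\<close> need not contain \<open>F'\<close>. Afterwards the
    \<open>F'\<close> part of \<open>P\<close> is absorbed by \<open>U\<close>, so that
    \<open>U\<close> and \<open>R\<close> together give all of \<open>F\<close>.\<close>
  obtain P where P: "subspace K P F" "derived_ideal K F \<subseteq> P" "R \<subseteq> P"
    "\<And>x. x \<in> P \<Longrightarrow> \<exists>d\<in>derived_ideal K F. x \<ominus> d \<in> R"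
    using subspace_sumE[OF derived_subspace RS] by blast
  obtain U where U: "subspace K U F" "derived_ideal K F \<subseteq> U" "U \<inter> P \<subseteq> derived_ideal K F"
    "\<And>f. f \<in> carrier F \<Longrightarrow> \<exists>u\<in>U. f \<ominus> u \<in> P"
    using subspace_complement_above[OF derived_subspace P(1,2)] by blast
  have "\<exists>u\<in>U. f \<ominus> u \<in> R" if f: "f \<in> carrier F" for f
  proof -
    obtain u where u: "u \<in> U" "f \<ominus> u \<in> P" using U(4)[OF f] by blast
    then obtain d where d: "d \<in> derived_ideal K F" "f \<ominus> u \<ominus> d \<in> R" using P(4) by blast
    have c: "u \<in> carrier F" "d \<in> carrier F"
      using u d subspaceD(2)[OF U(1)] subspaceD(2)[OF derived_subspace] by blast+
    have "f \<ominus> (u \<oplus> d) = f \<ominus> u \<ominus> d" using c f by (simp add: a_minus_def M.minus_add M.a_assoc)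
    moreover have "u \<oplus> d \<in> U" using u d U(2) subspaceD(4)[OF U(1)] by blast
    ultimately show ?thesis using d(2) by metis
  qed
  moreover have "U \<inter> R \<subseteq> derived_ideal K F" using U(3) P(3) by blast
  ultimately show ?thesis using that[OF U(1,2)] by blast
qed

text \<open>\<open>Q\<close> stands for \<open>U/(FR + RF)\<close>. Lifts to \<open>U\<close> of a
  finite spanning set of \<open>L\<close> span \<open>F\<close> modulo \<open>R\<close>, and a
  product modulo \<open>FR + RF\<close> sees its factors only modulo \<open>R\<close>. Hence the
  lifts and their pairwise products span \<open>U\<close> modulo \<open>FR + RF\<close>.\<close>

lemma presentation_fin_dim:
  fixes F (structure)
  assumes F: "bilinear_algebra K F" and \<pi>: "linear_map K F L \<pi>"
    and surj: "\<pi> ` carrier F = carrier L" and fd: "vectorspace.fin_dim K L"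
    and R: "alg_ideal K F (a_kernel F L \<pi>)"
    and U: "subspace K U F" and U': "derived_ideal K F \<subseteq> U"
    and UR: "U \<inter> a_kernel F L \<pi> \<subseteq> derived_ideal K F"
    and FU: "\<And>f. f \<in> carrier F \<Longrightarrow> \<exists>u\<in>U. f \<ominus> u \<in> a_kernel F L \<pi>"
    and Q: "linear_map K (F\<lparr>carrier := U\<rparr>) Q q" and Q_surj: "q ` U = carrier Q"
    and Q_ker: "\<And>u. u \<in> comm_span K F (a_kernel F L \<pi>) \<Longrightarrow> q u = \<zero>\<^bsub>Q\<^esub>"
  shows "vectorspace.fin_dim K Q"
proof -
  interpret F: bilinear_algebra K F by (rule F)
  interpret L: vectorspace K L by (rule linear_mapD(2)[OF \<pi>])
  interpret Q: vectorspace K Q by (rule linear_mapD(2)[OF Q])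
  note piD = linear_mapD[OF \<pi>] and qD = linear_mapD[OF Q] and UD = subspaceD[OF U]
  let ?R = "a_kernel F L \<pi>" and ?C = "comm_span K F (a_kernel F L \<pi>)"
  have RF: "?R \<subseteq> carrier F" by (rule subspaceD(2)[OF alg_idealD(1)[OF R]])
  obtain S where S: "finite S" "S \<subseteq> carrier L" "L.span S = carrier L"
    using fd by (auto simp: L.fin_dim_def)
  have "\<exists>u\<in>U. \<pi> u = s" if "s \<in> S" for s
  proof -
    have "s \<in> \<pi> ` carrier F" using S(2) that unfolding surj by blast
    then obtain f where f: "f \<in> carrier F" "s = \<pi> f" by blast
    then obtain u where u: "u \<in> U" "f \<ominus> u \<in> ?R" using FU by blast
    have "u \<in> carrier F" using u(1) UD(2) by blast
    then have "\<pi> u = s" using u(2) f piD(3) by (simp add: in_a_kernel piD(7))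
    then show ?thesis using u(1) by blast
  qed
  then obtain l where l: "\<And>s. s \<in> S \<Longrightarrow> l s \<in> U \<and> \<pi> (l s) = s" by metis
  define G where "G = l ` S"
  have G: "finite G" "G \<subseteq> U" "S \<subseteq> \<pi> ` G" using S(1) l by (auto simp: G_def image_iff)
  have GF: "G \<subseteq> carrier F" using G(2) UD(2) by blast
  note W = F.span_is_subspace[OF GF]
  have WF: "F.span G \<subseteq> carrier F" by (rule subspaceD(2)[OF W])
  have WU: "F.span G \<subseteq> U" by (rule span_in_subspace[OF U G(2)])
  have GW: "G \<subseteq> F.span G" by (rule F.in_own_span[OF GF])
  have piW: "carrier L \<subseteq> \<pi> ` F.span G"
    unfolding S(3)[symmetric]
    by (rule span_in_subspace[OF linear_map_image_subspace[OF \<pi> W]]) (use G(3) GW in blast)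
  have near: "\<exists>w\<in>F.span G. f \<ominus> w \<in> ?R" if f: "f \<in> carrier F" for f
  proof -
    obtain w where w: "w \<in> F.span G" "\<pi> f = \<pi> w" using piW piD(3)[OF f] by blast
    then show ?thesis using f WF piD(3)[OF f]
      by (intro bexI[of _ w]) (auto simp: in_a_kernel piD(7) subset_iff)
  qed
  \<comment> \<open>The finite set whose image will span \<open>Q\<close>: the lifts in
    \<open>G\<close> account for \<open>L\<close>, their products for \<open>F'\<close>.\<close>
  define H where "H = G \<union> (\<lambda>(x, y). x \<otimes>\<^bsub>F\<^esub> y) ` (G \<times> G)"
  have H: "finite H" "H \<subseteq> U"
    using G(1,2) U' F.prod_in_derived GF by (auto simp: H_def subset_iff)
  have qH: "q ` H \<subseteq> carrier Q" using H(2) qD(3) by auto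
  note N = Q.span_is_subspace[OF qH]
  let ?N = "{u \<in> U. q u \<in> Q.span (q ` H)}"
  have NS: "subspace K ?N F"
  proof -
    have "subspace K ?N (F\<lparr>carrier := U\<rparr>)" using linear_map_vimage_subspace[OF Q N] by simp
    note ND = subspaceD[OF this]
    show ?thesis
      using UD(2) ND(3-5) by (intro subspaceI[OF F.vectorspace_axioms]) (blast, simp_all)
  qed
  have HN: "H \<subseteq> ?N" using H(2) Q.in_own_span[OF qH] by blast
  have CN: "?C \<subseteq> ?N"
    using Q_ker subspaceD(3)[OF N] U' F.comm_span_subset_derived[OF RF] by auto
  \<comment> \<open>Bilinear extension from \<open>G\<close> to its span, one factor at a
    time.\<close>
  have prodN: "x \<otimes>\<^bsub>F\<^esub> y \<in> ?N" if x: "x \<in> F.span G" and y: "y \<in> F.span G" for x y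
  proof -
    have GG: "a \<otimes>\<^bsub>F\<^esub> b \<in> ?N" if "a \<in> G" "b \<in> G" for a b
      using that by (intro subsetD[OF HN]) (auto simp: H_def)
    have 1: "F.span G \<subseteq> {x \<in> carrier F. x \<otimes>\<^bsub>F\<^esub> b \<in> ?N}" if b: "b \<in> G" for b
    proof (rule span_in_subspace[OF linear_map_vimage_subspace[OF F.linear_left NS]])
      show "b \<in> carrier F" using b GF by blast
      show "G \<subseteq> {x \<in> carrier F. x \<otimes>\<^bsub>F\<^esub> b \<in> ?N}" using GG[OF _ b] GF by blast
    qed
    have "F.span G \<subseteq> {y \<in> carrier F. x \<otimes>\<^bsub>F\<^esub> y \<in> ?N}"
    proof (rule span_in_subspace[OF linear_map_vimage_subspace[OF F.linear_right NS]])
      show "x \<in> carrier F" using x WF by blast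
      show "G \<subseteq> {y \<in> carrier F. x \<otimes>\<^bsub>F\<^esub> y \<in> ?N}" using 1 x GF by blast
    qed
    then show ?thesis using y by blast
  qed
  have add_back: "f \<in> ?N" if "f \<in> carrier F" "w \<in> ?N" "f \<ominus> w \<in> ?N" for f w
  proof -
    have "w \<in> carrier F" using that(2) UD(2) by blast
    then have "f = (f \<ominus> w) \<oplus> w" using that(1) by (simp add: a_minus_def F.M.a_assoc F.M.l_neg)
    then show ?thesis using subspaceD(4)[OF NS that(3,2)] by simp
  qed
  \<comment> \<open>Both factors are moved into the span of \<open>G\<close>, at the cost of an
    element of \<open>?C\<close>, which \<open>?N\<close> contains.\<close>
  have DN: "derived_ideal K F \<subseteq> ?N"
  proof (rule F.derived_least[OF NS])
    fix x y assume x: "x \<in> carrier F" and y: "y \<in> carrier F"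
    obtain v where v: "v \<in> F.span G" "x \<ominus> v \<in> ?R" using near[OF x] by blast
    obtain w where w: "w \<in> F.span G" "y \<ominus> w \<in> ?R" using near[OF y] by blast
    have vw: "v \<in> carrier F" "w \<in> carrier F" using v w WF by blast+
    have "x \<otimes>\<^bsub>F\<^esub> y \<ominus> v \<otimes>\<^bsub>F\<^esub> w \<in> ?N"
      using F.prod_cong_comm_span[OF R vw(1) x v(2) vw(2) y w(2)] CN by blast
    then show "x \<otimes>\<^bsub>F\<^esub> y \<in> ?N"
      by (rule add_back[OF F.prod_closed[OF x y] prodN[OF v(1) w(1)]])
  qed
  \<comment> \<open>An element of \<open>U\<close> differs from some element of the span of
    \<open>G\<close> by an element of \<open>U \<inter> R\<close>, and \<open>UR\<close> puts this
    difference into \<open>F'\<close>.\<close>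
  have "U \<subseteq> ?N"
  proof
    fix u assume u: "u \<in> U"
    then have uF: "u \<in> carrier F" using UD(2) by blast
    obtain w where w: "w \<in> F.span G" "u \<ominus> w \<in> ?R" using near[OF uF] by blast
    have "G \<subseteq> ?N" using HN by (auto simp: H_def)
    then have wN: "w \<in> ?N" using span_in_subspace[OF NS] w(1) by blast
    have "u \<ominus> w \<in> U" using UD(7) u w(1) WU by blast
    then have "u \<ominus> w \<in> ?N" using w(2) UR DN by blast
    then show "u \<in> ?N" by (rule add_back[OF uF wN])
  qed
  then have "carrier Q \<subseteq> Q.span (q ` H)" unfolding Q_surj[symmetric] by blast
  then have "Q.span (q ` H) = carrier Q" using subspaceD(2)[OF N] by blast
  then show ?thesis
    using qH H(1) unfolding Q.fin_dim_def by blast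
qed

text \<open>Trades an isomorphism with a quotient for a surjection with prescribed kernel, along
  which \<open>\<pi>\<close> can be lifted.\<close>

lemma defining_pair_projection:
  assumes "defining_pair K L E M"
  obtains p where "alg_hom K E L p" and "p ` carrier E = carrier L" and "a_kernel E L p = M"
proof -
  have E: "leibniz_algebra K E" and M: "alg_ideal K E M"
    using assms by (simp_all add: defining_pair_def)
  obtain \<phi> where \<phi>: "alg_hom K (quot E M) L \<phi>" "bij_betw \<phi> (carrier (quot E M)) (carrier L)"
    using assms by (auto simp: defining_pair_def alg_iso_def)
  note q = bilinear_algebra.quot_alg_hom[OF leibniz_bilinear[OF E] M]
  note qD = linear_mapD[OF alg_homD(1)[OF q]] and phiD = linear_mapD[OF alg_homD(1)[OF \<phi>(1)]]
  note N = alg_idealD(1)[OF M]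
  let ?p = "\<lambda>x. \<phi> (M +>\<^bsub>E\<^esub> x)"
  interpret Q: vectorspace K "quot E M" by (rule qD(2))
  have "?p x = \<zero>\<^bsub>L\<^esub> \<longleftrightarrow> x \<in> M" if x: "x \<in> carrier E" for x
  proof -
    have "?p x = \<zero>\<^bsub>L\<^esub> \<longleftrightarrow> M +>\<^bsub>E\<^esub> x = \<zero>\<^bsub>quot E M\<^esub>"
      using inj_on_eq_iff[OF bij_betw_imp_inj_on[OF \<phi>(2)] qD(3)[OF x] Q.M.zero_closed]
      by (simp add: phiD(6))
    then show ?thesis using coset_eq_zero[OF N x] by simp
  qed
  then have "a_kernel E L ?p = M" using subspaceD(2)[OF N] by (auto simp: in_a_kernel)
  moreover have "?p ` carrier E = carrier L"
    using bij_betw_imp_surj_on[OF \<phi>(2)] by (simp add: quot_simps image_image)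
  ultimately show ?thesis using that[OF alg_hom_comp[OF q \<phi>(1)]] by blast
qed

text \<open>\<open>B\<close> is \<open>U/(FR + RF)\<close> written in coordinates, to make it a
  competitor in the maximality condition, and \<open>M'\<close> is the image of
  \<open>U \<inter> R\<close>. Dividing by \<open>FR + RF\<close> makes this image central, and
  \<open>UR\<close> places it in the derived algebra. \<open>U\<close> is a subalgebra because it
  contains all products of \<open>F\<close>.\<close>

lemma finite_central_extension:
  assumes L: "leibniz_algebra K L" and fd: "vectorspace.fin_dim K L"
    and F: "leibniz_algebra K F" and \<pi>: "alg_hom K F L \<pi>" and surj: "\<pi> ` carrier F = carrier L"
    and U: "subspace K U F" and U': "derived_ideal K F \<subseteq> U"
    and UR: "U \<inter> a_kernel F L \<pi> \<subseteq> derived_ideal K F"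
    and FU: "\<And>f. f \<in> carrier F \<Longrightarrow> \<exists>u\<in>U. f \<ominus>\<^bsub>F\<^esub> u \<in> a_kernel F L \<pi>"
  obtains B :: "('k, nat \<Rightarrow> 'k) module" and M' and c
  where "defining_pair K L B M'" and "vectorspace.fin_dim K B"
    and "linear_map K (F\<lparr>carrier := U\<rparr>) B c" and "c ` U = carrier B"
    and "a_kernel (F\<lparr>carrier := U\<rparr>) B c = comm_span K F (a_kernel F L \<pi>)"
proof -
  let ?R = "a_kernel F L \<pi>" and ?C = "comm_span K F (a_kernel F L \<pi>)" and ?A = "F\<lparr>carrier := U\<rparr>"
  interpret F: bilinear_algebra K F by (rule leibniz_bilinear[OF F])
  note UD = subspaceD[OF U] and piD = linear_mapD[OF alg_homD(1)[OF \<pi>]]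
  have R: "alg_ideal K F ?R" by (rule F.alg_hom_kernel_ideal[OF \<pi> leibniz_bilinear[OF L]])
  have RF: "?R \<subseteq> carrier F" by (rule subspaceD(2)[OF alg_idealD(1)[OF R]])
  have C: "subspace K ?C F" by (rule F.comm_span_subspace[OF RF])
  have CR: "?C \<subseteq> ?R" by (rule F.comm_span_subset_ideal[OF R])
  have CF': "?C \<subseteq> derived_ideal K F" by (rule F.comm_span_subset_derived[OF RF])
  have Uprod: "x \<otimes>\<^bsub>F\<^esub> y \<in> U" if "x \<in> U" "y \<in> U" for x y
    using F.prod_in_derived U' UD(2) that by blast
  have A: "leibniz_algebra K ?A" by (rule subalgebra_leibniz[OF F U Uprod])
  interpret A: bilinear_algebra K ?A by (rule leibniz_bilinear[OF A])
  have CA: "subspace K ?C ?A" using subspace_of_subspace[OF C U] CF' U' by blast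
  have IA: "alg_ideal K ?A ?C"
    unfolding alg_ideal_def
    using CA F.prod_in_comm_span[OF RF _ subsetD[OF CR]] subsetD[OF UD(2)] by simp
  let ?Q = "quot ?A ?C"
  note q = quot_linear_map[OF CA] and q0 = coset_eq_zero[OF CA]
  let ?q = "\<lambda>u. ?C +>\<^bsub>?A\<^esub> u"
  have q_surj: "?q ` U = carrier ?Q" by (simp add: quot_simps)
  have fdQ: "vectorspace.fin_dim K ?Q"
    by (rule presentation_fin_dim[OF F.bilinear_algebra_axioms alg_homD(1)[OF \<pi>] surj fd R U U' UR
          FU q q_surj])
       (use q0 CF' U' in auto)
  then obtain n c0 where c0: "linear_map K ?Q (free_vs K {..<n::nat}) c0"
    and c0_bij: "bij_betw c0 (carrier ?Q) (carrier (free_vs K {..<n}))"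
    using coordinates[OF linear_mapD(2)[OF q]] by blast
  let ?W = "free_vs K {..<n}"
  define c where "c u = c0 (?q u)" for u
  have c: "linear_map K ?A ?W c" unfolding c_def by (rule linear_map_comp[OF q c0])
  have c_surj: "c ` carrier ?A = carrier ?W"
    using bij_betw_imp_surj_on[OF c0_bij] q_surj by (simp add: c_def image_image[symmetric])
  interpret Q: vectorspace K ?Q by (rule linear_mapD(1)[OF c0])
  have "c u = \<zero>\<^bsub>?W\<^esub> \<longleftrightarrow> u \<in> ?C" if u: "u \<in> U" for u
  proof -
    have "?q u \<in> carrier ?Q" using linear_mapD(3)[OF q, of u] u by simp
    then have "c u = \<zero>\<^bsub>?W\<^esub> \<longleftrightarrow> ?q u = \<zero>\<^bsub>?Q\<^esub>"
      using inj_on_eq_iff[OF bij_betw_imp_inj_on[OF c0_bij] _ Q.M.zero_closed]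
      by (simp add: c_def linear_mapD(6)[OF c0])
    then show ?thesis using q0 u by simp
  qed
  then have ker: "a_kernel ?A ?W c = ?C" using CF' U' by (auto simp: in_a_kernel)
  \<comment> \<open>The coordinate space receives the product of \<open>U/(FR + RF)\<close>,
    computed through arbitrary preimages in \<open>U\<close>.\<close>
  define B where "B = ?W\<lparr>mult := \<lambda>x y. c (inv_into (carrier ?A) c x \<otimes>\<^bsub>?A\<^esub> inv_into (carrier ?A) c y)\<rparr>"
  have cB: "alg_hom K ?A B c"
    unfolding B_def by (rule A.push_product[OF c c_surj]) (unfold ker, rule IA)
  have cB_surj: "c ` U = carrier B" using c_surj by (simp add: B_def)
  then have cB_surj': "c ` carrier ?A = carrier B" by simp
  have kerB: "a_kernel ?A B c = ?C" unfolding ker[symmetric] by (auto simp: in_a_kernel B_def)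
  note cD = linear_mapD[OF alg_homD(1)[OF cB], simplified]
  have B: "leibniz_algebra K B" by (rule leibniz_image[OF A cB]) (simp add: cB_surj)
  interpret B: bilinear_algebra K B by (rule leibniz_bilinear[OF B])
  have fdB: "B.fin_dim"
  proof -
    have "linear_map K ?Q B c0"
      using linear_mapD[OF c0] B.vectorspace_axioms by (intro linear_mapI) (simp_all add: B_def)
    moreover have "c0 ` carrier ?Q = carrier B"
      using bij_betw_imp_surj_on[OF c0_bij] by (simp add: B_def)
    ultimately show ?thesis
      by (rule linear_map.surj_fin_dim[OF _ fdQ])
  qed
  have piA: "alg_hom K ?A L \<pi>" by (rule alg_hom_restrict_dom[OF \<pi> U])
  have cker: "\<pi> u = \<zero>\<^bsub>L\<^esub>" if "u \<in> carrier ?A" "c u = \<zero>\<^bsub>B\<^esub>" for u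
  proof -
    have "u \<in> a_kernel ?A B c" using that by (simp add: in_a_kernel)
    then have "u \<in> ?R" using CR unfolding kerB by blast
    then show ?thesis by (simp add: in_a_kernel)
  qed
  \<comment> \<open>The kernel of \<open>c\<close> lies in \<open>R\<close>, so \<open>\<pi>\<close>
    on \<open>U\<close> descends to \<open>B\<close>. The kernel of the descended map is the ideal
    of the new pair.\<close>
  obtain \<psi> where \<psi>: "alg_hom K B L \<psi>" "\<And>u. u \<in> carrier ?A \<Longrightarrow> \<psi> (c u) = \<pi> u"
    using alg_hom_factor[OF cB piA A.bilinear_algebra_axioms cB_surj' cker] by blast
  let ?M = "a_kernel B L \<psi>"
  have M: "alg_ideal K B ?M" by (rule B.alg_hom_kernel_ideal[OF \<psi>(1) leibniz_bilinear[OF L]])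
  have M_lift: "\<exists>r \<in> U \<inter> ?R. x = c r" if x: "x \<in> ?M" for x
  proof -
    obtain u where u: "u \<in> U" "x = c u" using x cB_surj by (auto simp: in_a_kernel)
    moreover have "u \<in> ?R" using x u \<psi>(2)[of u] UD(2) by (auto simp: in_a_kernel)
    ultimately show ?thesis by blast
  qed
  \<comment> \<open>Elements of \<open>?M\<close> come from \<open>R\<close>, and a product with a
    factor in \<open>R\<close> lies in \<open>?C\<close>, which \<open>c\<close> kills.\<close>
  have "?M \<subseteq> leibniz_center B"
  proof
    fix x assume x: "x \<in> ?M"
    then obtain r where r: "r \<in> U" "r \<in> ?R" "x = c r" using M_lift by blast
    have "x \<otimes>\<^bsub>B\<^esub> y = \<zero>\<^bsub>B\<^esub> \<and> y \<otimes>\<^bsub>B\<^esub> x = \<zero>\<^bsub>B\<^esub>" if y: "y \<in> carrier B" for y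
    proof -
      obtain u where u: "u \<in> U" "y = c u" using y cB_surj by blast
      have "u \<in> carrier F" using u UD(2) by blast
      then have "r \<otimes>\<^bsub>F\<^esub> u \<in> ?C" "u \<otimes>\<^bsub>F\<^esub> r \<in> ?C" using F.prod_in_comm_span[OF RF _ r(2)] by blast+
      then have "c (r \<otimes>\<^bsub>F\<^esub> u) = \<zero>\<^bsub>B\<^esub>" "c (u \<otimes>\<^bsub>F\<^esub> r) = \<zero>\<^bsub>B\<^esub>"
        unfolding kerB[symmetric] by (simp_all add: in_a_kernel)
      then show ?thesis
        using alg_homD(2)[OF cB, of r u] alg_homD(2)[OF cB, of u r] r u by simp
    qed
    then show "x \<in> leibniz_center B" using x by (auto simp: leibniz_center_def in_a_kernel)
  qed
  moreover have "?M \<subseteq> derived_ideal K B"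
  proof
    \<comment> \<open>\<open>F'\<close> is generated by products of \<open>F\<close>, but
      \<open>B'\<close> by images of products of \<open>U\<close>. The factors are moved into
      \<open>U\<close> along \<open>R\<close>, which changes a product only by an element of
      \<open>?C\<close>.\<close>
    have FD: "derived_ideal K F \<subseteq> {u \<in> U. c u \<in> derived_ideal K B}"
    proof (rule F.derived_least)
      have "subspace K {u \<in> carrier ?A. c u \<in> derived_ideal K B} ?A"
        by (rule linear_map_vimage_subspace[OF alg_homD(1)[OF cB] B.derived_subspace])
      note D = subspaceD[OF this]
      show "subspace K {u \<in> U. c u \<in> derived_ideal K B} F"
        using D(3-5) UD(2) by (intro subspaceI[OF F.vectorspace_axioms]) (blast, simp_all)
    next
      fix x y assume x: "x \<in> carrier F" and y: "y \<in> carrier F"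
      obtain v where v: "v \<in> U" "x \<ominus>\<^bsub>F\<^esub> v \<in> ?R" using FU[OF x] by blast
      obtain w where w: "w \<in> U" "y \<ominus>\<^bsub>F\<^esub> w \<in> ?R" using FU[OF y] by blast
      have vw: "v \<in> carrier F" "w \<in> carrier F" using v w UD(2) by blast+
      have d: "x \<otimes>\<^bsub>F\<^esub> y \<ominus>\<^bsub>F\<^esub> v \<otimes>\<^bsub>F\<^esub> w \<in> ?C"
        by (rule F.prod_cong_comm_span[OF R vw(1) x v(2) vw(2) y w(2)])
      have xyU: "x \<otimes>\<^bsub>F\<^esub> y \<in> U" using F.prod_in_derived[OF x y] U' by blast
      have vwU: "v \<otimes>\<^bsub>F\<^esub> w \<in> U" by (rule Uprod[OF v(1) w(1)])
      have "?q (x \<otimes>\<^bsub>F\<^esub> y) = ?q (v \<otimes>\<^bsub>F\<^esub> w)"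
      proof -
        have "x \<otimes>\<^bsub>F\<^esub> y \<ominus>\<^bsub>?A\<^esub> v \<otimes>\<^bsub>F\<^esub> w \<in> ?C"
          using d subspace_minus[OF U xyU vwU] by simp
        then show ?thesis using coset_eq_iff[OF CA] xyU vwU by simp
      qed
      then have "c (x \<otimes>\<^bsub>F\<^esub> y) = c v \<otimes>\<^bsub>B\<^esub> c w"
        using alg_homD(2)[OF cB, of v w] v w by (simp add: c_def)
      then show "x \<otimes>\<^bsub>F\<^esub> y \<in> {u \<in> U. c u \<in> derived_ideal K B}"
        using xyU B.prod_in_derived[of "c v" "c w"] cD(3) v w by simp
    qed
    fix x assume "x \<in> ?M"
    then obtain r where "r \<in> U" "r \<in> ?R" "x = c r" using M_lift by blast
    then show "x \<in> derived_ideal K B" using UR FD by blast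
  qed
  moreover have "\<psi> ` carrier B = carrier L"
  proof -
    have "\<pi> ` carrier F \<subseteq> \<pi> ` U"
    proof
      fix y assume "y \<in> \<pi> ` carrier F"
      then obtain f where f: "f \<in> carrier F" "y = \<pi> f" by blast
      then obtain u where u: "u \<in> U" "f \<ominus>\<^bsub>F\<^esub> u \<in> ?R" using FU by blast
      interpret L: vectorspace K L by (rule piD(2))
      have "u \<in> carrier F" using u(1) UD(2) by blast
      then have "\<pi> f = \<pi> u" using u(2) f piD(3) by (simp add: in_a_kernel piD(7))
      then show "y \<in> \<pi> ` U" using f u by blast
    qed
    then have "\<pi> ` U = carrier L" using surj UD(2) by blast
    then show ?thesis using \<psi>(2) by (simp add: cB_surj[symmetric] image_image)
  qed
  then obtain \<phi> where "alg_iso K (quot B ?M) L \<phi>"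
    using B.first_isomorphism[OF \<psi>(1) _ M] by blast
  ultimately have "defining_pair K L B ?M"
    using B M by (auto simp: defining_pair_def)
  then show ?thesis by (rule that[OF _ fdB alg_homD(1)[OF cB] cB_surj kerB])
qed

text \<open>The Hopf formula as statements about the image and kernel of \<open>\<rho>\<close>, so
  that maps between multipliers can be defined on representatives in \<open>F\<close>. Only the last
  conclusion needs maximality; the others hold for every defining pair.\<close>

lemma multiplier_presentation:
  assumes L: "leibniz_algebra K L" and fd: "vectorspace.fin_dim K L"
    and free: "free_leibniz_on K F X" and \<pi>: "alg_hom K F L \<pi>" and surj: "\<pi> ` carrier F = carrier L"
    and max: "maximal_defining_pair K L E M"
  obtains \<rho> p where "alg_hom K F E \<rho>" and "alg_hom K E L p" and "p ` carrier E = carrier L"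
    and "a_kernel E L p = M" and "\<And>f. f \<in> carrier F \<Longrightarrow> p (\<rho> f) = \<pi> f"
    and "\<rho> ` (a_kernel F L \<pi> \<inter> derived_ideal K F) = M"
    and "\<And>f. f \<in> comm_span K F (a_kernel F L \<pi>) \<Longrightarrow> \<rho> f = \<zero>\<^bsub>E\<^esub>"
    and "\<And>f. f \<in> a_kernel F L \<pi> \<inter> derived_ideal K F \<Longrightarrow> \<rho> f = \<zero>\<^bsub>E\<^esub> \<Longrightarrow>
      f \<in> comm_span K F (a_kernel F L \<pi>)"
proof -
  let ?R = "a_kernel F L \<pi>" and ?C = "comm_span K F (a_kernel F L \<pi>)"
  have pair: "defining_pair K L E M" using max by (simp add: maximal_defining_pair_def)
  have E: "leibniz_algebra K E" and M: "alg_ideal K E M"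
    and M_sub: "M \<subseteq> leibniz_center E" "M \<subseteq> derived_ideal K E"
    using pair by (simp_all add: defining_pair_def)
  have F: "leibniz_algebra K F" using free by (simp add: free_leibniz_on_def)
  interpret F: bilinear_algebra K F by (rule leibniz_bilinear[OF F])
  interpret E: bilinear_algebra K E by (rule leibniz_bilinear[OF E])
  interpret L: vectorspace K L by (rule linear_mapD(2)[OF alg_homD(1)[OF \<pi>]])
  obtain p where p: "alg_hom K E L p" "p ` carrier E = carrier L" "a_kernel E L p = M"
    using defining_pair_projection[OF pair] by blast
  obtain \<rho> where \<rho>: "alg_hom K F E \<rho>" and p\<rho>: "\<And>f. f \<in> carrier F \<Longrightarrow> p (\<rho> f) = \<pi> f"
    using free_leibniz_projective[OF free \<pi> E p(1,2)] by blast
  note rD = linear_mapD[OF alg_homD(1)[OF \<rho>]] and pD = linear_mapD[OF alg_homD(1)[OF p(1)]]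
    and piD = linear_mapD[OF alg_homD(1)[OF \<pi>]]
  have R: "alg_ideal K F ?R" by (rule F.alg_hom_kernel_ideal[OF \<pi> leibniz_bilinear[OF L]])
  have RF: "?R \<subseteq> carrier F" by (rule subspaceD(2)[OF alg_idealD(1)[OF R]])
  have \<rho>_M: "\<rho> f \<in> M \<longleftrightarrow> f \<in> ?R" if "f \<in> carrier F" for f
    using that rD(3) by (simp add: p(3)[symmetric] in_a_kernel p\<rho>)
  have \<rho>_C: "\<rho> f = \<zero>\<^bsub>E\<^esub>" if "f \<in> ?C" for f
  proof -
    have central: "\<rho> r \<otimes>\<^bsub>E\<^esub> x = \<zero>\<^bsub>E\<^esub> \<and> x \<otimes>\<^bsub>E\<^esub> \<rho> r = \<zero>\<^bsub>E\<^esub>"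
      if r: "r \<in> ?R" and x: "x \<in> carrier E" for r x
    proof -
      have "\<rho> r \<in> leibniz_center E" using M_sub(1) \<rho>_M r RF by blast
      then show ?thesis using x by (simp add: leibniz_center_def)
    qed
    have "?C \<subseteq> a_kernel F E \<rho>"
    proof (rule F.comm_span_least[OF linear_map_kernel_subspace[OF alg_homD(1)[OF \<rho>]]])
      fix x r assume x: "x \<in> carrier F" and r: "r \<in> ?R"
      then have "r \<in> carrier F" using RF by blast
      then show "x \<otimes>\<^bsub>F\<^esub> r \<in> a_kernel F E \<rho>" "r \<otimes>\<^bsub>F\<^esub> x \<in> a_kernel F E \<rho>"
        using x central[OF r rD(3)[OF x]] by (simp_all add: in_a_kernel F.prod_closed alg_homD(2)[OF \<rho>])
    qed
    then show ?thesis using that by (auto simp: in_a_kernel)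
  qed
  obtain U where U: "subspace K U F" "derived_ideal K F \<subseteq> U" "U \<inter> ?R \<subseteq> derived_ideal K F"
    and FU: "\<And>f. f \<in> carrier F \<Longrightarrow> \<exists>u\<in>U. f \<ominus>\<^bsub>F\<^esub> u \<in> ?R"
    using presentation_reduction[OF F.bilinear_algebra_axioms R] by blast
  note UD = subspaceD[OF U(1)]
  \<comment> \<open>\<open>\<pi>\<close> is onto and \<open>U\<close> represents every class modulo
    \<open>R\<close>, so \<open>\<rho>\<close> maps \<open>U\<close> onto \<open>E\<close> modulo
    \<open>M\<close>.\<close>
  have lift: "\<exists>u\<in>U. e \<ominus>\<^bsub>E\<^esub> \<rho> u \<in> M" if e: "e \<in> carrier E" for e
  proof -
    have "p e \<in> \<pi> ` carrier F" unfolding surj by (rule pD(3)[OF e])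
    then obtain f where f: "f \<in> carrier F" "p e = \<pi> f" by blast
    then obtain u where u: "u \<in> U" "f \<ominus>\<^bsub>F\<^esub> u \<in> ?R" using FU by blast
    have uF: "u \<in> carrier F" using u(1) UD(2) by blast
    have "\<pi> f = \<pi> u" using u(2) f uF piD(3) by (simp add: in_a_kernel piD(7))
    then have "p (e \<ominus>\<^bsub>E\<^esub> \<rho> u) = \<zero>\<^bsub>L\<^esub>" using e uF f rD(3) piD(3) by (simp add: pD(7) p\<rho>)
    then show ?thesis using u(1) uF e rD(3) unfolding p(3)[symmetric] by (auto simp: in_a_kernel)
  qed
  \<comment> \<open>A product in \<open>E\<close> is unchanged when its factors are altered by
    elements of the central ideal \<open>M\<close>, so factors from the image of \<open>U\<close>
    suffice.\<close>
  have derived: "derived_ideal K E \<subseteq> \<rho> ` derived_ideal K F"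
  proof (rule E.derived_least[OF linear_map_image_subspace[OF alg_homD(1)[OF \<rho>] F.derived_subspace]])
    fix x y assume x: "x \<in> carrier E" and y: "y \<in> carrier E"
    obtain u where u: "u \<in> U" "x \<ominus>\<^bsub>E\<^esub> \<rho> u \<in> M" using lift[OF x] by blast
    obtain v where v: "v \<in> U" "y \<ominus>\<^bsub>E\<^esub> \<rho> v \<in> M" using lift[OF y] by blast
    have uv: "u \<in> carrier F" "v \<in> carrier F" using u v UD(2) by blast+
    have "comm_span K E M \<subseteq> {\<zero>\<^bsub>E\<^esub>}"
    proof (rule E.comm_span_least)
      show "subspace K {\<zero>\<^bsub>E\<^esub>} E" by (rule subspaceI[OF E.vectorspace_axioms]) simp_all
    qed (use M_sub(1) in \<open>auto simp: leibniz_center_def\<close>)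
    moreover have "x \<otimes>\<^bsub>E\<^esub> y \<ominus>\<^bsub>E\<^esub> \<rho> u \<otimes>\<^bsub>E\<^esub> \<rho> v \<in> comm_span K E M"
      by (rule E.prod_cong_comm_span[OF M rD(3)[OF uv(1)] x u(2) rD(3)[OF uv(2)] y v(2)])
    ultimately have "x \<otimes>\<^bsub>E\<^esub> y = \<rho> u \<otimes>\<^bsub>E\<^esub> \<rho> v"
      using x y uv rD(3) E.prod_closed by (auto simp: subset_iff)
    then have "x \<otimes>\<^bsub>E\<^esub> y = \<rho> (u \<otimes>\<^bsub>F\<^esub> v)" using uv by (simp add: alg_homD(2)[OF \<rho>])
    then show "x \<otimes>\<^bsub>E\<^esub> y \<in> \<rho> ` derived_ideal K F" using F.prod_in_derived[OF uv] by blast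
  qed
  \<comment> \<open>\<open>M\<close> lies in \<open>E'\<close>, hence in the image of
    \<open>F'\<close>, and preimages of \<open>M\<close> lie in \<open>R\<close>.\<close>
  have \<rho>_onto_M: "\<rho> ` (?R \<inter> derived_ideal K F) = M"
  proof
    show "\<rho> ` (?R \<inter> derived_ideal K F) \<subseteq> M" using \<rho>_M RF by blast
    show "M \<subseteq> \<rho> ` (?R \<inter> derived_ideal K F)"
    proof
      fix m assume m: "m \<in> M"
      then obtain d where d: "d \<in> derived_ideal K F" "m = \<rho> d" using M_sub(2) derived by blast
      then have "d \<in> ?R" using m \<rho>_M subspaceD(2)[OF F.derived_subspace] by blast
      then show "m \<in> \<rho> ` (?R \<inter> derived_ideal K F)" using d by blast
    qed
  qed
  let ?A = "F\<lparr>carrier := U\<rparr>"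
  obtain B :: "('a, nat \<Rightarrow> 'a) module" and M' c
    where B: "defining_pair K L B M'" "vectorspace.fin_dim K B"
      and c: "linear_map K ?A B c" "c ` U = carrier B" "a_kernel ?A B c = ?C"
    using finite_central_extension[OF L fd F \<pi> surj U FU] by blast
  \<comment> \<open>Maximality enters here; \<open>B\<close> is an admissible competitor because its
    elements are functions on \<open>nat\<close>.\<close>
  have dim: "vectorspace.dim K B \<le> vectorspace.dim K E"
    using max B by (auto simp: maximal_defining_pair_def)
  have \<rho>A: "linear_map K ?A E \<rho>" by (rule linear_map_restrict_dom[OF alg_homD(1)[OF \<rho>] U(1)])
  have c_surj: "c ` carrier ?A = carrier B" using c(2) by simp
  have ker: "\<rho> u = \<zero>\<^bsub>E\<^esub>" if "u \<in> carrier ?A" "c u = \<zero>\<^bsub>B\<^esub>" for u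
  proof (rule \<rho>_C)
    show "u \<in> ?C" using that unfolding c(3)[symmetric] by (simp add: in_a_kernel)
  qed
  obtain \<sigma> where \<sigma>: "linear_map K B E \<sigma>" "\<And>u. u \<in> carrier ?A \<Longrightarrow> \<sigma> (c u) = \<rho> u"
    using linear_map_factor[OF c(1) \<rho>A c_surj ker] by blast
  \<comment> \<open>The error in \<open>M\<close> left by \<open>lift\<close> is the image of an
    element of \<open>F'\<close>, and \<open>F'\<close> lies in \<open>U\<close>.\<close>
  have \<rho>U: "\<rho> ` U = carrier E"
  proof
    show "\<rho> ` U \<subseteq> carrier E" using rD(3) UD(2) by blast
    show "carrier E \<subseteq> \<rho> ` U"
    proof
      fix e assume e: "e \<in> carrier E"
      obtain u where u: "u \<in> U" "e \<ominus>\<^bsub>E\<^esub> \<rho> u \<in> M" using lift[OF e] by blast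
      then obtain d where d: "d \<in> derived_ideal K F" "e \<ominus>\<^bsub>E\<^esub> \<rho> u = \<rho> d" using \<rho>_onto_M by blast
      have uF: "u \<in> carrier F" "d \<in> carrier F" using u(1) d(1) U(2) UD(2) by blast+
      have "e = (e \<ominus>\<^bsub>E\<^esub> \<rho> u) \<oplus>\<^bsub>E\<^esub> \<rho> u"
        using e rD(3)[OF uF(1)] by (simp add: a_minus_def E.M.a_assoc E.M.l_neg)
      also have "\<dots> = \<rho> (d \<oplus>\<^bsub>F\<^esub> u)" using uF by (simp add: d(2) rD(4))
      finally show "e \<in> \<rho> ` U" using UD(4)[OF subsetD[OF U(2) d(1)] u(1)] by blast
    qed
  qed
  have \<sigma>_surj: "\<sigma> ` carrier B = carrier E"
    using \<sigma>(2) by (simp add: c(2)[symmetric] \<rho>U[symmetric] image_image)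
  \<comment> \<open>\<open>\<sigma>\<close> is onto and does not raise the dimension bound
    \<open>dim\<close>, so it is injective. Thus \<open>\<rho>\<close> and \<open>c\<close> have the
    same kernel on \<open>U\<close>, namely \<open>?C\<close>.\<close>
  have "f \<in> ?C" if f: "f \<in> ?R \<inter> derived_ideal K F" and "\<rho> f = \<zero>\<^bsub>E\<^esub>" for f
  proof -
    have fU: "f \<in> U" using f U(2) by blast
    have "\<sigma> (c f) = \<zero>\<^bsub>E\<^esub>" using \<sigma>(2)[of f] fU that(2) by simp
    moreover have "c f \<in> carrier B" using c(2) fU by blast
    ultimately have "c f = \<zero>\<^bsub>B\<^esub>"
      by (intro surjective_imp_injective[OF \<sigma>(1) \<sigma>_surj B(2) dim])
    then show ?thesis unfolding c(3)[symmetric] using fU by (simp add: in_a_kernel)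
  qed
  then show ?thesis using that[OF \<rho> p p\<rho> \<rho>_onto_M \<rho>_C] by blast
qed

section \<open>The Ganea sequence\<close>

text \<open>The first isomorphism theorem for \<open>\<rho>\<close> on \<open>R \<inter> F'\<close>.
  The value of \<open>\<iota>\<close> on cosets is kept, because the formulas for
  \<open>\<theta>\<close>, \<open>\<beta>\<close> and \<open>\<gamma>\<close> are stated through
  it.\<close>

lemma hopf_space_iso:
  assumes F: "bilinear_algebra K F" and R: "alg_ideal K F R"
    and \<rho>: "linear_map K F E \<rho>" and M: "subspace K M E"
    and onto: "\<rho> ` (R \<inter> derived_ideal K F) = M"
    and C: "\<And>f. f \<in> comm_span K F R \<Longrightarrow> \<rho> f = \<zero>\<^bsub>E\<^esub>"
    and ker: "\<And>f. f \<in> R \<inter> derived_ideal K F \<Longrightarrow> \<rho> f = \<zero>\<^bsub>E\<^esub> \<Longrightarrow> f \<in> comm_span K F R"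
  obtains \<iota> where "linear_iso K (hopf_space K F R) (E\<lparr>carrier := M\<rparr>) \<iota>"
    and "\<And>r. r \<in> R \<inter> derived_ideal K F \<Longrightarrow> \<iota> (comm_span K F R +>\<^bsub>F\<^esub> r) = \<rho> r"
proof -
  interpret F: bilinear_algebra K F by (rule F)
  let ?S = "R \<inter> derived_ideal K F" and ?C = "comm_span K F R"
  let ?A = "F\<lparr>carrier := ?S\<rparr>"
  note RS = alg_idealD(1)[OF R]
  have RF: "R \<subseteq> carrier F" by (rule subspaceD(2)[OF RS])
  have S: "subspace K ?S F" by (rule subspace_Int[OF RS F.derived_subspace])
  have CS: "?C \<subseteq> ?S" using F.comm_span_subset_ideal[OF R] F.comm_span_subset_derived[OF RF] by blast
  have CA: "subspace K ?C ?A" by (rule subspace_of_subspace[OF F.comm_span_subspace[OF RF] S CS])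
  \<comment> \<open>A coset is formed with the addition alone, so shrinking the carrier does not
    change it.\<close>
  have coset: "?C +>\<^bsub>?A\<^esub> x = ?C +>\<^bsub>F\<^esub> x" for x by (simp add: a_r_coset_def r_coset_def)
  let ?q = "\<lambda>x. ?C +>\<^bsub>?A\<^esub> x"
  note q = quot_linear_map[OF CA]
  have hopf: "hopf_space K F R = quot ?A ?C" by (simp add: hopf_space_def)
  have q_surj: "?q ` carrier ?A = carrier (quot ?A ?C)" by (simp add: quot_simps)
  have \<rho>A: "linear_map K ?A (E\<lparr>carrier := M\<rparr>) \<rho>"
    by (rule linear_map_restrict[OF \<rho> S M]) (simp add: onto)
  have q_ker: "\<rho> x = \<zero>\<^bsub>E\<lparr>carrier := M\<rparr>\<^esub>" if "x \<in> carrier ?A" "?q x = \<zero>\<^bsub>quot ?A ?C\<^esub>" for x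
    using that coset_eq_zero[OF CA that(1)] C by simp
  obtain \<iota> where \<iota>: "linear_map K (quot ?A ?C) (E\<lparr>carrier := M\<rparr>) \<iota>"
    "\<And>x. x \<in> carrier ?A \<Longrightarrow> \<iota> (?q x) = \<rho> x"
    using linear_map_factor[OF q \<rho>A q_surj q_ker] by blast
  have "inj_on \<iota> (carrier (quot ?A ?C))"
  proof (rule inj_onI)
    fix X Y assume X: "X \<in> carrier (quot ?A ?C)" and Y: "Y \<in> carrier (quot ?A ?C)" and eq: "\<iota> X = \<iota> Y"
    obtain x where x: "x \<in> ?S" "X = ?q x" using X by (auto simp: quot_simps)
    obtain y where y: "y \<in> ?S" "Y = ?q y" using Y by (auto simp: quot_simps)
    have xy: "x \<in> carrier F" "y \<in> carrier F" using x y RF by blast+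
    interpret E: vectorspace K E by (rule subspaceD(1)[OF M])
    have "\<rho> x = \<rho> y" using eq x y \<iota>(2) by simp
    then have "\<rho> (x \<ominus>\<^bsub>F\<^esub> y) = \<zero>\<^bsub>E\<^esub>" using xy linear_mapD(3)[OF \<rho>] by (simp add: linear_mapD(7)[OF \<rho>])
    then have "x \<ominus>\<^bsub>F\<^esub> y \<in> ?C" by (rule ker[OF subspaceD(7)[OF S x(1) y(1)]])
    then show "X = Y"
      using x y coset_eq_iff[OF CA, of x y] subspace_minus[OF S x(1) y(1)] by simp
  qed
  moreover have "\<iota> ` carrier (quot ?A ?C) = M"
  proof -
    have "\<iota> ` carrier (quot ?A ?C) = \<rho> ` ?S"
      unfolding q_surj[symmetric] image_image by (rule image_cong) (simp_all add: \<iota>(2))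
    then show ?thesis by (simp add: onto)
  qed
  ultimately have "linear_iso K (hopf_space K F R) (E\<lparr>carrier := M\<rparr>) \<iota>"
    using \<iota>(1) by (simp add: hopf linear_iso_def bij_betw_def)
  moreover have "\<iota> (?C +>\<^bsub>F\<^esub> r) = \<rho> r" if "r \<in> ?S" for r
    using \<iota>(2)[of r] that by (simp add: coset)
  ultimately show ?thesis by (rule that)
qed

theorem theorem4p2:
  fixes K :: "('k, 'r) ring_scheme"
    and L :: "('k, 'l) module" and Z :: "'l set"
    and F :: "('k, 'f) module" and X :: "'f set" and \<pi> :: "'f \<Rightarrow> 'l"
    and E1 :: "('k, 'a) module" and M1 :: "'a set"
    and E2 :: "('k, 'b) module" and M2 :: "'b set"
  defines "L' \<equiv> derived_ideal K L"
    and "R \<equiv> a_kernel F L \<pi>"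
    and "T \<equiv> {t \<in> carrier F. \<pi> t \<in> Z}"
  defines "ab \<equiv> quot L L'" and "ZV \<equiv> L\<lparr>carrier := Z\<rparr>"
    and "mult_L \<equiv> E1\<lparr>carrier := M1\<rparr>" and "mult_LZ \<equiv> E2\<lparr>carrier := M2\<rparr>"
    and "L'_Z \<equiv> L\<lparr>carrier := L' \<inter> Z\<rparr>"
  defines "D \<equiv> direct_sum (tensor_space K ab ZV) (tensor_space K ZV ab)"
  assumes "leibniz_algebra K L" and "vectorspace.fin_dim K L"
    and "central_ideal K L Z"
    and "free_leibniz_on K F X"
    and "alg_hom K F L \<pi>" and "\<pi> ` carrier F = carrier L"
    and "maximal_defining_pair K L E1 M1"
    and "maximal_defining_pair K (quot L Z) E2 M2"
  shows "\<exists>\<iota>1 \<iota>2 \<theta> \<beta> \<gamma>.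
    linear_iso K (hopf_space K F R) mult_L \<iota>1 \<and>
    linear_iso K (hopf_space K F T) mult_LZ \<iota>2 \<and>
    linear_map K D mult_L \<theta> \<and>
    linear_map K mult_L mult_LZ \<beta> \<and>
    linear_map K mult_LZ L'_Z \<gamma> \<and>
    (\<forall>f \<in> carrier F. \<forall>t \<in> T.
       \<theta> (pure_tensor K ab ZV (L' +>\<^bsub>L\<^esub> \<pi> f) (\<pi> t), \<zero>\<^bsub>tensor_space K ZV ab\<^esub>)
         = \<iota>1 (comm_span K F R +>\<^bsub>F\<^esub> (f \<otimes>\<^bsub>F\<^esub> t)) \<and>
       \<theta> (\<zero>\<^bsub>tensor_space K ab ZV\<^esub>, pure_tensor K ZV ab (\<pi> t) (L' +>\<^bsub>L\<^esub> \<pi> f))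
         = \<iota>1 (comm_span K F R +>\<^bsub>F\<^esub> (t \<otimes>\<^bsub>F\<^esub> f))) \<and>
    (\<forall>r \<in> R \<inter> derived_ideal K F.
       \<beta> (\<iota>1 (comm_span K F R +>\<^bsub>F\<^esub> r)) = \<iota>2 (comm_span K F T +>\<^bsub>F\<^esub> r)) \<and>
    (\<forall>t \<in> T \<inter> derived_ideal K F.
       \<gamma> (\<iota>2 (comm_span K F T +>\<^bsub>F\<^esub> t)) = \<pi> t) \<and>
    \<theta> ` carrier D = a_kernel mult_L mult_LZ \<beta> \<and>
    \<beta> ` carrier mult_L = a_kernel mult_LZ L'_Z \<gamma> \<and>
    \<gamma> ` carrier mult_LZ = carrier L'_Z"
proof -
  let ?F' = "derived_ideal K F" and ?CR = "comm_span K F R" and ?CT = "comm_span K F T"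
  note L = assms(10) and fd = assms(11) and Z = assms(12) and free = assms(13)
    and \<pi> = assms(14) and surj = assms(15) and max1 = assms(16) and max2 = assms(17)
  have F: "leibniz_algebra K F" using free by (simp add: free_leibniz_on_def)
  interpret F: leibniz_algebra K F by (rule F)
  interpret FB: bilinear_algebra K F by (rule leibniz_bilinear[OF F])
  interpret LB: bilinear_algebra K L by (rule leibniz_bilinear[OF L])
  note piD = linear_mapD[OF alg_homD(1)[OF \<pi>]] and pi_mult = alg_homD(2)[OF \<pi>]
  have Z_ideal: "alg_ideal K L Z" and Z_central: "Z \<subseteq> leibniz_center L"
    using Z by (simp_all add: central_ideal_def)
  note ZS = alg_idealD(1)[OF Z_ideal]
  note LS = LB.derived_subspace[folded L'_def]
  have R: "alg_ideal K F R"
    unfolding R_def by (rule FB.alg_hom_kernel_ideal[OF \<pi> LB.bilinear_algebra_axioms])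
  have inR: "f \<in> R \<longleftrightarrow> f \<in> carrier F \<and> \<pi> f = \<zero>\<^bsub>L\<^esub>" for f by (simp add: R_def in_a_kernel)
  have inT: "f \<in> T \<longleftrightarrow> f \<in> carrier F \<and> \<pi> f \<in> Z" for f by (simp add: T_def)

  \<comment> \<open>The presentation of \<open>L/Z\<close> by \<open>F\<close> and
    \<open>T\<close>\<close>
  note q = LB.quot_alg_hom[OF Z_ideal]
  have LZ: "leibniz_algebra K (quot L Z)" by (rule leibniz_image[OF L q]) (simp add: quot_simps)
  have fdZ: "vectorspace.fin_dim K (quot L Z)"
    by (rule linear_map.surj_fin_dim[OF alg_homD(1)[OF q] fd]) (simp add: quot_simps)
  let ?\<pi>' = "\<lambda>f. Z +>\<^bsub>L\<^esub> \<pi> f"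
  have \<pi>': "alg_hom K F (quot L Z) ?\<pi>'" by (rule alg_hom_comp[OF \<pi> q])
  have surj': "?\<pi>' ` carrier F = carrier (quot L Z)"
    by (simp add: quot_simps surj[symmetric] image_image)
  \<comment> \<open>The same free algebra presents \<open>L/Z\<close>, with \<open>T\<close> in
    place of \<open>R\<close>, so one lemma describes both multipliers.\<close>
  have T_kernel: "a_kernel F (quot L Z) ?\<pi>' = T"
    by (auto simp: in_a_kernel inT coset_eq_zero[OF ZS] piD(3))
  have T: "alg_ideal K F T"
    unfolding T_kernel[symmetric] by (rule FB.alg_hom_kernel_ideal[OF \<pi>' leibniz_bilinear[OF LZ]])
  have RT: "R \<subseteq> T" using subspaceD(3)[OF ZS] by (auto simp: inR inT)
  have RF: "R \<subseteq> carrier F" and TF: "T \<subseteq> carrier F" by (auto simp: inR inT)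
  \<comment> \<open>Centrality of \<open>Z\<close>: \<open>\<pi>\<close> sends these products to
    zero. Both the values of \<open>\<theta>\<close> and the definition of \<open>\<gamma>\<close>
    rest on this.\<close>
  have FT: "x \<otimes>\<^bsub>F\<^esub> t \<in> R" "t \<otimes>\<^bsub>F\<^esub> x \<in> R" if "x \<in> carrier F" "t \<in> T" for x t
    using that Z_central piD(3)[OF that(1)]
    by (auto simp: inR inT F.prod_closed pi_mult leibniz_center_def subset_iff)
  have CT_R: "?CT \<subseteq> R" by (rule FB.comm_span_least[OF alg_idealD(1)[OF R]]) (simp_all add: FT)
  have CR_CT: "?CR \<subseteq> ?CT"
    by (rule FB.comm_span_least[OF FB.comm_span_subspace[OF TF]])
       (use FB.prod_in_comm_span[OF TF] RT in blast)+
  have CT_F': "?CT \<subseteq> ?F'" by (rule FB.comm_span_subset_derived[OF TF])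
  have pi_F': "\<pi> ` ?F' = L'"
    unfolding L'_def
    by (rule surj_derived[OF FB.bilinear_algebra_axioms LB.bilinear_algebra_axioms \<pi> surj])

  text \<open>By the Leibniz identity, \<open>(xy)t = x(yt) - y(xt)\<close> and \<open>t(xy) = (tx)y + x(ty)\<close>.\<close>

  have F'_T: "d \<otimes>\<^bsub>F\<^esub> t \<in> ?CR \<and> t \<otimes>\<^bsub>F\<^esub> d \<in> ?CR" if d: "d \<in> ?F'" and t: "t \<in> T" for d t
  proof -
    have tF: "t \<in> carrier F" using t TF by blast
    note CR = FB.comm_span_subspace[OF RF]
    have "?F' \<subseteq> {d \<in> carrier F. d \<otimes>\<^bsub>F\<^esub> t \<in> ?CR}"
    proof (rule FB.derived_least[OF linear_map_vimage_subspace[OF FB.linear_left[OF tF] CR]])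
      fix x y assume x: "x \<in> carrier F" and y: "y \<in> carrier F"
      have "(x \<otimes>\<^bsub>F\<^esub> y) \<otimes>\<^bsub>F\<^esub> t = x \<otimes>\<^bsub>F\<^esub> (y \<otimes>\<^bsub>F\<^esub> t) \<ominus>\<^bsub>F\<^esub> y \<otimes>\<^bsub>F\<^esub> (x \<otimes>\<^bsub>F\<^esub> t)"
        unfolding F.left_leibniz[OF x y tF]
        using x y tF by (simp add: a_minus_def F.prod_closed F.M.a_assoc F.M.r_neg)
      also have "\<dots> \<in> ?CR"
        by (rule subspaceD(7)[OF CR])
           (rule FB.prod_in_comm_span(1)[OF RF x FT(1)[OF y t]]
             FB.prod_in_comm_span(1)[OF RF y FT(1)[OF x t]])+
      finally show "x \<otimes>\<^bsub>F\<^esub> y \<in> {d \<in> carrier F. d \<otimes>\<^bsub>F\<^esub> t \<in> ?CR}" using x y by (simp add: F.prod_closed)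
    qed
    moreover have "?F' \<subseteq> {d \<in> carrier F. t \<otimes>\<^bsub>F\<^esub> d \<in> ?CR}"
    proof (rule FB.derived_least[OF linear_map_vimage_subspace[OF FB.linear_right[OF tF] CR]])
      fix x y assume x: "x \<in> carrier F" and y: "y \<in> carrier F"
      have "t \<otimes>\<^bsub>F\<^esub> (x \<otimes>\<^bsub>F\<^esub> y) \<in> ?CR"
        unfolding F.left_leibniz[OF tF x y]
        by (rule subspaceD(4)[OF CR])
           (rule FB.prod_in_comm_span(2)[OF RF y FT(2)[OF x t]]
             FB.prod_in_comm_span(1)[OF RF x FT(2)[OF y t]])+
      then show "x \<otimes>\<^bsub>F\<^esub> y \<in> {d \<in> carrier F. t \<otimes>\<^bsub>F\<^esub> d \<in> ?CR}" using x y by (simp add: F.prod_closed)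
    qed
    ultimately show ?thesis using d by blast
  qed
  \<comment> \<open>As \<open>L'\<close> is the image of \<open>F'\<close>, such an \<open>f\<close>
    differs from some \<open>d\<close> in \<open>F'\<close> by an element of \<open>R\<close>.
    Replacing \<open>f\<close> by \<open>d\<close> alters both products only within
    \<open>?CR\<close>.\<close>
  have kernel_ab: "f \<otimes>\<^bsub>F\<^esub> t \<in> ?CR \<and> t \<otimes>\<^bsub>F\<^esub> f \<in> ?CR"
    if f: "f \<in> carrier F" "\<pi> f \<in> L'" and t: "t \<in> T" for f t
  proof -
    have tF: "t \<in> carrier F" using t TF by blast
    note CR = FB.comm_span_subspace[OF RF]
    obtain d where d: "d \<in> ?F'" "\<pi> f = \<pi> d" using f(2) unfolding pi_F'[symmetric] by blast
    have dF: "d \<in> carrier F" using d(1) subspaceD(2)[OF FB.derived_subspace] by blast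
    have fd: "f \<ominus>\<^bsub>F\<^esub> d \<in> R" using f dF d(2) piD(3)[OF dF] by (simp add: inR piD(7))
    have zero: "t \<ominus>\<^bsub>F\<^esub> t \<in> R"
      using tF subspaceD(3)[OF alg_idealD(1)[OF R]] by (simp add: a_minus_def F.M.r_neg)
    have split: "x \<in> ?CR" if "x \<ominus>\<^bsub>F\<^esub> y \<in> ?CR" "y \<in> ?CR" "x \<in> carrier F" for x y
    proof -
      have "y \<in> carrier F" using that(2) subspaceD(2)[OF CR] by blast
      then have "x = (x \<ominus>\<^bsub>F\<^esub> y) \<oplus>\<^bsub>F\<^esub> y" using that(3) by (simp add: a_minus_def F.M.a_assoc F.M.l_neg)
      then show ?thesis using subspaceD(4)[OF CR that(1,2)] by simp
    qed
    show ?thesis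
      using split[OF FB.prod_cong_comm_span[OF R dF f(1) fd tF tF zero]]
        split[OF FB.prod_cong_comm_span[OF R tF tF zero dF f(1) fd]] F'_T[OF d(1) t]
        f(1) tF F.prod_closed by blast
  qed

  \<comment> \<open>The two multipliers and the maps \<open>\<beta>\<close> and
    \<open>\<gamma>\<close>\<close>
  obtain \<rho>1 p1 where \<rho>1: "alg_hom K F E1 \<rho>1" and onto1: "\<rho>1 ` (R \<inter> ?F') = M1"
    and zero1: "\<And>f. f \<in> ?CR \<Longrightarrow> \<rho>1 f = \<zero>\<^bsub>E1\<^esub>"
    and ker1: "\<And>f. f \<in> R \<inter> ?F' \<Longrightarrow> \<rho>1 f = \<zero>\<^bsub>E1\<^esub> \<Longrightarrow> f \<in> ?CR"
    using multiplier_presentation[OF L fd free \<pi> surj max1, folded R_def] by metis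
  obtain \<rho>2 p2 where \<rho>2: "alg_hom K F E2 \<rho>2" and onto2: "\<rho>2 ` (T \<inter> ?F') = M2"
    and zero2: "\<And>f. f \<in> ?CT \<Longrightarrow> \<rho>2 f = \<zero>\<^bsub>E2\<^esub>"
    and ker2: "\<And>f. f \<in> T \<inter> ?F' \<Longrightarrow> \<rho>2 f = \<zero>\<^bsub>E2\<^esub> \<Longrightarrow> f \<in> ?CT"
    using multiplier_presentation[OF LZ fdZ free \<pi>' surj' max2, unfolded T_kernel] by metis
  have M1: "subspace K M1 E1" and M2: "subspace K M2 E2"
    using max1 max2 by (simp_all add: maximal_defining_pair_def defining_pair_def alg_ideal_def)
  note \<rho>1_lin = alg_homD(1)[OF \<rho>1] and \<rho>2_lin = alg_homD(1)[OF \<rho>2]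
  obtain \<iota>1 where \<iota>1: "linear_iso K (hopf_space K F R) mult_L \<iota>1"
    "\<And>r. r \<in> R \<inter> ?F' \<Longrightarrow> \<iota>1 (?CR +>\<^bsub>F\<^esub> r) = \<rho>1 r"
    using hopf_space_iso[OF FB.bilinear_algebra_axioms R \<rho>1_lin M1 onto1 zero1 ker1]
    unfolding mult_L_def by blast
  obtain \<iota>2 where \<iota>2: "linear_iso K (hopf_space K F T) mult_LZ \<iota>2"
    "\<And>t. t \<in> T \<inter> ?F' \<Longrightarrow> \<iota>2 (?CT +>\<^bsub>F\<^esub> t) = \<rho>2 t"
    using hopf_space_iso[OF FB.bilinear_algebra_axioms T \<rho>2_lin M2 onto2 zero2 ker2]
    unfolding mult_LZ_def by blast

  note RF'_sub = subspace_Int[OF alg_idealD(1)[OF R] FB.derived_subspace]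
    and TF'_sub = subspace_Int[OF alg_idealD(1)[OF T] FB.derived_subspace]
  let ?AR = "F\<lparr>carrier := R \<inter> ?F'\<rparr>" and ?AT = "F\<lparr>carrier := T \<inter> ?F'\<rparr>"
  have \<rho>1_AR: "linear_map K ?AR mult_L \<rho>1"
    unfolding mult_L_def by (rule linear_map_restrict[OF \<rho>1_lin RF'_sub M1]) (simp add: onto1)
  have \<rho>1_AR_surj: "\<rho>1 ` carrier ?AR = carrier mult_L" by (simp add: onto1 mult_L_def)
  have \<rho>2_AR: "linear_map K ?AR mult_LZ \<rho>2"
    unfolding mult_LZ_def
    by (rule linear_map_restrict[OF \<rho>2_lin RF'_sub M2]) (use onto2 RT in blast)
  have \<rho>2_AT: "linear_map K ?AT mult_LZ \<rho>2"
    unfolding mult_LZ_def by (rule linear_map_restrict[OF \<rho>2_lin TF'_sub M2]) (simp add: onto2)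
  have \<rho>2_AT_surj: "\<rho>2 ` carrier ?AT = carrier mult_LZ" by (simp add: onto2 mult_LZ_def)
  have \<pi>_AT: "linear_map K ?AT L'_Z \<pi>"
    unfolding L'_Z_def
    by (rule linear_map_restrict[OF alg_homD(1)[OF \<pi>] TF'_sub subspace_Int[OF LS ZS]])
       (use pi_F' inT in blast)

  \<comment> \<open>\<open>\<beta>\<close> is well defined: on \<open>R \<inter> F'\<close> the
    kernel of \<open>\<rho>1\<close> is \<open>?CR\<close>, and \<open>?CR\<close> lies in
    \<open>?CT\<close> since \<open>R\<close> lies in \<open>T\<close>.\<close>
  have ker_\<beta>: "\<rho>2 r = \<zero>\<^bsub>mult_LZ\<^esub>" if "r \<in> carrier ?AR" "\<rho>1 r = \<zero>\<^bsub>mult_L\<^esub>" for r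
  proof -
    have "r \<in> ?CR" using that by (intro ker1) (simp_all add: mult_L_def)
    then have "r \<in> ?CT" using CR_CT by blast
    then show ?thesis using zero2 by (simp add: mult_LZ_def)
  qed
  obtain \<beta> where \<beta>: "linear_map K mult_L mult_LZ \<beta>" "\<And>r. r \<in> R \<inter> ?F' \<Longrightarrow> \<beta> (\<rho>1 r) = \<rho>2 r"
    using linear_map_factor[OF \<rho>1_AR \<rho>2_AR \<rho>1_AR_surj ker_\<beta>] by auto
  \<comment> \<open>\<open>\<gamma>\<close> is well defined: on \<open>T \<inter> F'\<close> the
    kernel of \<open>\<rho>2\<close> is \<open>?CT\<close>, which centrality of \<open>Z\<close>
    puts inside \<open>R\<close>.\<close>
  have ker_\<gamma>: "\<pi> t = \<zero>\<^bsub>L'_Z\<^esub>" if "t \<in> carrier ?AT" "\<rho>2 t = \<zero>\<^bsub>mult_LZ\<^esub>" for t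
  proof -
    have "t \<in> ?CT" using that by (intro ker2) (simp_all add: mult_LZ_def)
    then have "t \<in> R" using CT_R by blast
    then show ?thesis by (simp add: inR L'_Z_def)
  qed
  obtain \<gamma> where \<gamma>: "linear_map K mult_LZ L'_Z \<gamma>" "\<And>t. t \<in> T \<inter> ?F' \<Longrightarrow> \<gamma> (\<rho>2 t) = \<pi> t"
    using linear_map_factor[OF \<rho>2_AT \<pi>_AT \<rho>2_AT_surj ker_\<gamma>] by auto

  \<comment> \<open>The map \<open>\<theta>\<close>\<close>
  let ?V = "F\<lparr>carrier := T\<rparr>" and ?g = "\<lambda>f. L' +>\<^bsub>L\<^esub> \<pi> f"
  note TS = alg_idealD(1)[OF T]
  have g: "linear_map K F ab ?g"
    unfolding ab_def by (rule linear_map_comp[OF alg_homD(1)[OF \<pi>] quot_linear_map[OF LS]])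
  have g_surj: "?g ` carrier F = carrier ab"
    by (simp add: ab_def quot_simps surj[symmetric] image_image)
  have h: "linear_map K ?V ZV \<pi>"
    unfolding ZV_def by (rule linear_map_restrict[OF alg_homD(1)[OF \<pi>] TS ZS]) (auto simp: inT)
  have h_surj: "\<pi> ` carrier ?V = carrier ZV"
  proof -
    have "\<exists>t\<in>T. z = \<pi> t" if z: "z \<in> Z" for z
    proof -
      have "z \<in> \<pi> ` carrier F" unfolding surj using z subspaceD(2)[OF ZS] by blast
      then show ?thesis using z by (auto simp: inT)
    qed
    then show ?thesis by (auto simp: ZV_def inT)
  qed
  have prodM: "\<rho>1 (f \<otimes>\<^bsub>F\<^esub> t) \<in> M1" "\<rho>1 (t \<otimes>\<^bsub>F\<^esub> f) \<in> M1" if "f \<in> carrier F" "t \<in> T" for f t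
    using onto1 FT[OF that] FB.prod_in_derived that TF by blast+
  have b_left: "linear_map K F mult_L (\<lambda>f. \<rho>1 (f \<otimes>\<^bsub>F\<^esub> t))" "linear_map K F mult_L (\<lambda>f. \<rho>1 (t \<otimes>\<^bsub>F\<^esub> f))"
    if t: "t \<in> T" for t
  proof -
    have tF: "t \<in> carrier F" using t TF by blast
    show "linear_map K F mult_L (\<lambda>f. \<rho>1 (f \<otimes>\<^bsub>F\<^esub> t))" "linear_map K F mult_L (\<lambda>f. \<rho>1 (t \<otimes>\<^bsub>F\<^esub> f))"
      unfolding mult_L_def
      by (rule linear_map_restrict_cod[OF linear_map_comp[OF FB.linear_left[OF tF] \<rho>1_lin] M1]
          linear_map_restrict_cod[OF linear_map_comp[OF FB.linear_right[OF tF] \<rho>1_lin] M1],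
          rule prodM[OF _ t], assumption)+
  qed
  have b_right: "linear_map K ?V mult_L (\<lambda>t. \<rho>1 (f \<otimes>\<^bsub>F\<^esub> t))" "linear_map K ?V mult_L (\<lambda>t. \<rho>1 (t \<otimes>\<^bsub>F\<^esub> f))"
    if f: "f \<in> carrier F" for f
    unfolding mult_L_def
    using prodM[OF f]
    by (intro linear_map_restrict[OF linear_map_comp[OF FB.linear_right[OF f] \<rho>1_lin] TS M1]
        linear_map_restrict[OF linear_map_comp[OF FB.linear_left[OF f] \<rho>1_lin] TS M1]; blast)+
  have b1: "bilinear_map K F ?V mult_L (\<lambda>f t. \<rho>1 (f \<otimes>\<^bsub>F\<^esub> t))"
    and b2: "bilinear_map K ?V F mult_L (\<lambda>t f. \<rho>1 (t \<otimes>\<^bsub>F\<^esub> f))"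
    using b_left b_right by (simp_all add: bilinear_map_def)
  have mult_L_vs: "vectorspace K mult_L" by (rule linear_mapD(2)[OF \<rho>1_AR])
  \<comment> \<open>Independence of the representative of a class in \<open>L/L'\<close>; the
    Leibniz identity enters through \<open>kernel_ab\<close>.\<close>
  have g_zero: "\<rho>1 (f \<otimes>\<^bsub>F\<^esub> t) = \<zero>\<^bsub>mult_L\<^esub>" "\<rho>1 (t \<otimes>\<^bsub>F\<^esub> f) = \<zero>\<^bsub>mult_L\<^esub>"
    if "f \<in> carrier F" "t \<in> carrier ?V" "?g f = \<zero>\<^bsub>ab\<^esub>" for f t
  proof -
    have "\<pi> f \<in> L'" using that(1,3) piD(3) by (simp add: ab_def coset_eq_zero[OF LS])
    then show "\<rho>1 (f \<otimes>\<^bsub>F\<^esub> t) = \<zero>\<^bsub>mult_L\<^esub>" "\<rho>1 (t \<otimes>\<^bsub>F\<^esub> f) = \<zero>\<^bsub>mult_L\<^esub>"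
      using kernel_ab[OF that(1)] that(2) zero1 by (simp_all add: mult_L_def)
  qed
  \<comment> \<open>Independence of the representative of an element of \<open>Z\<close>: products
    with \<open>R\<close> lie in \<open>?CR\<close>, where \<open>\<rho>1\<close> vanishes.\<close>
  have h_zero: "\<rho>1 (f \<otimes>\<^bsub>F\<^esub> t) = \<zero>\<^bsub>mult_L\<^esub>" "\<rho>1 (t \<otimes>\<^bsub>F\<^esub> f) = \<zero>\<^bsub>mult_L\<^esub>"
    if "f \<in> carrier F" "t \<in> carrier ?V" "\<pi> t = \<zero>\<^bsub>ZV\<^esub>" for f t
  proof -
    have "t \<in> R" using that(2,3) TF by (auto simp: inR ZV_def)
    then show "\<rho>1 (f \<otimes>\<^bsub>F\<^esub> t) = \<zero>\<^bsub>mult_L\<^esub>" "\<rho>1 (t \<otimes>\<^bsub>F\<^esub> f) = \<zero>\<^bsub>mult_L\<^esub>"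
      using FB.prod_in_comm_span[OF RF that(1)] zero1 by (simp_all add: mult_L_def)
  qed
  let ?D1 = "tensor_space K ab ZV" and ?D2 = "tensor_space K ZV ab"
  obtain \<theta>1 where \<theta>1: "linear_map K ?D1 mult_L \<theta>1"
    and \<theta>1_pure: "\<And>f t. f \<in> carrier F \<Longrightarrow> t \<in> carrier ?V \<Longrightarrow>
      \<theta>1 (pure_tensor K ab ZV (?g f) (\<pi> t)) = \<rho>1 (f \<otimes>\<^bsub>F\<^esub> t)"
    and \<theta>1_in: "\<And>N x. subspace K N mult_L \<Longrightarrow>
      (\<And>f t. f \<in> carrier F \<Longrightarrow> t \<in> carrier ?V \<Longrightarrow> \<rho>1 (f \<otimes>\<^bsub>F\<^esub> t) \<in> N) \<Longrightarrow> x \<in> carrier ?D1 \<Longrightarrow> \<theta>1 x \<in> N"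
    using tensor_lift_factor[OF g g_surj h h_surj mult_L_vs b1 g_zero(1) h_zero(1)] by blast
  obtain \<theta>2 where \<theta>2: "linear_map K ?D2 mult_L \<theta>2"
    and \<theta>2_pure: "\<And>t f. t \<in> carrier ?V \<Longrightarrow> f \<in> carrier F \<Longrightarrow>
      \<theta>2 (pure_tensor K ZV ab (\<pi> t) (?g f)) = \<rho>1 (t \<otimes>\<^bsub>F\<^esub> f)"
    and \<theta>2_in: "\<And>N x. subspace K N mult_L \<Longrightarrow>
      (\<And>t f. t \<in> carrier ?V \<Longrightarrow> f \<in> carrier F \<Longrightarrow> \<rho>1 (t \<otimes>\<^bsub>F\<^esub> f) \<in> N) \<Longrightarrow> x \<in> carrier ?D2 \<Longrightarrow> \<theta>2 x \<in> N"
    using tensor_lift_factor[OF h h_surj g g_surj mult_L_vs b2 h_zero(2) g_zero(2)] by blast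
  define \<theta> where "\<theta> x = \<theta>1 (fst x) \<oplus>\<^bsub>mult_L\<^esub> \<theta>2 (snd x)" for x
  have \<theta>: "linear_map K D mult_L \<theta>" unfolding D_def \<theta>_def by (rule direct_sum_linear[OF \<theta>1 \<theta>2])
  have \<theta>_pure: "\<theta> (pure_tensor K ab ZV (?g f) (\<pi> t), \<zero>\<^bsub>?D2\<^esub>) = \<rho>1 (f \<otimes>\<^bsub>F\<^esub> t)"
      "\<theta> (\<zero>\<^bsub>?D1\<^esub>, pure_tensor K ZV ab (\<pi> t) (?g f)) = \<rho>1 (t \<otimes>\<^bsub>F\<^esub> f)"
    if "f \<in> carrier F" "t \<in> T" for f t
  proof -
    interpret mL: vectorspace K mult_L by (rule mult_L_vs)
    have "\<rho>1 (f \<otimes>\<^bsub>F\<^esub> t) \<in> carrier mult_L" "\<rho>1 (t \<otimes>\<^bsub>F\<^esub> f) \<in> carrier mult_L"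
      using prodM[OF that] by (simp_all add: mult_L_def)
    then show "\<theta> (pure_tensor K ab ZV (?g f) (\<pi> t), \<zero>\<^bsub>?D2\<^esub>) = \<rho>1 (f \<otimes>\<^bsub>F\<^esub> t)"
      "\<theta> (\<zero>\<^bsub>?D1\<^esub>, pure_tensor K ZV ab (\<pi> t) (?g f)) = \<rho>1 (t \<otimes>\<^bsub>F\<^esub> f)"
      using that \<theta>1_pure \<theta>2_pure linear_mapD(6)[OF \<theta>1] linear_mapD(6)[OF \<theta>2]
      by (simp_all add: \<theta>_def)
  qed
  have prodRF: "f \<otimes>\<^bsub>F\<^esub> t \<in> R \<inter> ?F'" "t \<otimes>\<^bsub>F\<^esub> f \<in> R \<inter> ?F'" if "f \<in> carrier F" "t \<in> T" for f t
    using FT[OF that] FB.prod_in_derived that TF by blast+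

  \<comment> \<open>Exactness\<close>
  have exact_mult_L: "\<theta> ` carrier D = a_kernel mult_L mult_LZ \<beta>"
  proof
    note ker = linear_map_kernel_subspace[OF \<beta>(1)]
    \<comment> \<open>\<open>\<beta>\<close> turns \<open>\<rho>1\<close> into
      \<open>\<rho>2\<close>, and \<open>\<rho>2\<close> vanishes on \<open>?CT\<close>, to which
      these products belong.\<close>
    have in_ker: "\<rho>1 (f \<otimes>\<^bsub>F\<^esub> t) \<in> a_kernel mult_L mult_LZ \<beta>" "\<rho>1 (t \<otimes>\<^bsub>F\<^esub> f) \<in> a_kernel mult_L mult_LZ \<beta>"
      if "f \<in> carrier F" "t \<in> T" for f t
      using \<beta>(2)[OF prodRF(1)[OF that]] \<beta>(2)[OF prodRF(2)[OF that]] prodM[OF that]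
        zero2 FB.prod_in_comm_span[OF TF that]
      by (simp_all add: in_a_kernel mult_L_def mult_LZ_def)
    show "\<theta> ` carrier D \<subseteq> a_kernel mult_L mult_LZ \<beta>"
    proof
      fix y assume "y \<in> \<theta> ` carrier D"
      then obtain x1 x2 where x: "x1 \<in> carrier ?D1" "x2 \<in> carrier ?D2" "y = \<theta> (x1, x2)"
        by (auto simp: D_def direct_sum_def)
      have "\<theta>1 x1 \<in> a_kernel mult_L mult_LZ \<beta>" by (rule \<theta>1_in[OF ker _ x(1)]) (simp add: in_ker)
      moreover have "\<theta>2 x2 \<in> a_kernel mult_L mult_LZ \<beta>"
        by (rule \<theta>2_in[OF ker _ x(2)]) (simp add: in_ker)
      ultimately show "y \<in> a_kernel mult_L mult_LZ \<beta>"
        using subspaceD(4)[OF ker] by (simp add: x(3) \<theta>_def)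
    qed
    have D_vs: "vectorspace K D" by (rule linear_mapD(1)[OF \<theta>])
    have "subspace K (\<theta> ` carrier D) E1"
      using linear_map_image_subspace[OF \<theta> carrier_subspace[OF D_vs]] M1
      unfolding mult_L_def by (rule subspace_trans)
    \<comment> \<open>\<open>\<rho>1\<close> is linear from \<open>F\<close> to \<open>E1\<close>,
      which is why the image of \<open>\<theta>\<close> was first viewed in \<open>E1\<close>. Its
      preimage in \<open>F\<close> is a subspace; containing all products of \<open>F\<close> with
      \<open>T\<close>, it contains \<open>?CT\<close>.\<close>
    note I = linear_map_vimage_subspace[OF \<rho>1_lin this]
    have pure_carrier: "(pure_tensor K ab ZV (?g f) (\<pi> t), \<zero>\<^bsub>?D2\<^esub>) \<in> carrier D"
      "(\<zero>\<^bsub>?D1\<^esub>, pure_tensor K ZV ab (\<pi> t) (?g f)) \<in> carrier D"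
      if f: "f \<in> carrier F" and t: "t \<in> T" for f t
    proof -
      have "?g f \<in> carrier ab" by (rule linear_mapD(3)[OF g f])
      moreover have "\<pi> t \<in> carrier ZV" using linear_mapD(3)[OF h, of t] t by simp
      ultimately show "(pure_tensor K ab ZV (?g f) (\<pi> t), \<zero>\<^bsub>?D2\<^esub>) \<in> carrier D"
        "(\<zero>\<^bsub>?D1\<^esub>, pure_tensor K ZV ab (\<pi> t) (?g f)) \<in> carrier D"
        using subspaceD(3)[OF carrier_subspace[OF linear_mapD(1)[OF \<theta>1]]]
          subspaceD(3)[OF carrier_subspace[OF linear_mapD(1)[OF \<theta>2]]]
          pure_tensor_carrier[OF linear_mapD(2)[OF g] linear_mapD(2)[OF h]]
          pure_tensor_carrier[OF linear_mapD(2)[OF h] linear_mapD(2)[OF g]]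
        by (simp_all add: D_def direct_sum_def)
    qed
    have "?CT \<subseteq> {f \<in> carrier F. \<rho>1 f \<in> \<theta> ` carrier D}"
    proof (rule FB.comm_span_least[OF I])
      fix f t assume f: "f \<in> carrier F" and t: "t \<in> T"
      then have "t \<in> carrier F" using TF by blast
      then show "f \<otimes>\<^bsub>F\<^esub> t \<in> {f \<in> carrier F. \<rho>1 f \<in> \<theta> ` carrier D}"
        "t \<otimes>\<^bsub>F\<^esub> f \<in> {f \<in> carrier F. \<rho>1 f \<in> \<theta> ` carrier D}"
        using f F.prod_closed pure_carrier[OF f t] by (simp_all flip: \<theta>_pure[OF f t])
    qed
    then show "a_kernel mult_L mult_LZ \<beta> \<subseteq> \<theta> ` carrier D"
    proof (intro subsetI)
      fix m assume m: "m \<in> a_kernel mult_L mult_LZ \<beta>"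
      then obtain r where r: "r \<in> R \<inter> ?F'" "m = \<rho>1 r"
        using onto1 by (auto simp: in_a_kernel mult_L_def)
      \<comment> \<open>\<open>\<beta> m\<close> is \<open>\<rho>2 r\<close>, so its vanishing is
        the kernel condition for \<open>\<rho>2\<close> on \<open>T \<inter> F'\<close>.\<close>
      then have "r \<in> ?CT"
        using m \<beta>(2)[OF r(1)] RT by (intro ker2) (auto simp: in_a_kernel mult_LZ_def)
      then show "m \<in> \<theta> ` carrier D"
        using \<open>?CT \<subseteq> {f \<in> carrier F. \<rho>1 f \<in> \<theta> ` carrier D}\<close> r(2) by blast
    qed
  qed

  have exact_mult_LZ: "\<beta> ` carrier mult_L = a_kernel mult_LZ L'_Z \<gamma>"
  proof
    show "\<beta> ` carrier mult_L \<subseteq> a_kernel mult_LZ L'_Z \<gamma>"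
    proof
      fix y assume "y \<in> \<beta> ` carrier mult_L"
      then obtain r where r: "r \<in> R \<inter> ?F'" "y = \<rho>2 r"
        using onto1 \<beta>(2) by (auto simp: mult_L_def)
      then have "r \<in> T \<inter> ?F'" using RT by blast
      then show "y \<in> a_kernel mult_LZ L'_Z \<gamma>"
        using r onto2 \<gamma>(2)[of r] by (auto simp: in_a_kernel mult_LZ_def L'_Z_def inR)
    qed
    show "a_kernel mult_LZ L'_Z \<gamma> \<subseteq> \<beta> ` carrier mult_L"
    proof
      fix y assume y: "y \<in> a_kernel mult_LZ L'_Z \<gamma>"
      then obtain t where t: "t \<in> T \<inter> ?F'" "y = \<rho>2 t"
        using onto2 by (auto simp: in_a_kernel mult_LZ_def)
      \<comment> \<open>\<open>\<gamma> y\<close> is \<open>\<pi> t\<close>, so its vanishing puts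
        \<open>t\<close> into \<open>R\<close>; then \<open>y\<close> is \<open>\<beta>\<close> of
        \<open>\<rho>1 t\<close>.\<close>
      then have "t \<in> R \<inter> ?F'"
        using y \<gamma>(2)[OF t(1)] by (auto simp: in_a_kernel L'_Z_def inR inT)
      then show "y \<in> \<beta> ` carrier mult_L"
        using t(2) \<beta>(2) onto1 by (force simp: mult_L_def)
    qed
  qed

  have onto_L'_Z: "\<gamma> ` carrier mult_LZ = carrier L'_Z"
  proof
    show "\<gamma> ` carrier mult_LZ \<subseteq> carrier L'_Z" using linear_mapD(3)[OF \<gamma>(1)] by blast
    show "carrier L'_Z \<subseteq> \<gamma> ` carrier mult_LZ"
    proof
      fix y assume y: "y \<in> carrier L'_Z"
      then have "y \<in> \<pi> ` ?F'" "y \<in> Z" unfolding pi_F' by (simp_all add: L'_Z_def)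
      then obtain d where d: "d \<in> ?F'" "y = \<pi> d" by blast
      \<comment> \<open>The preimage \<open>d\<close> was taken in \<open>F'\<close> because
        \<open>y\<close> lies in \<open>L'\<close>; that it lies in \<open>T\<close> is the
        condition that \<open>y\<close> is in \<open>Z\<close>.\<close>
      then have "d \<in> T \<inter> ?F'"
        using \<open>y \<in> Z\<close> subspaceD(2)[OF FB.derived_subspace] by (auto simp: inT)
      then have "y = \<gamma> (\<rho>2 d)" "\<rho>2 d \<in> carrier mult_LZ"
        using \<gamma>(2) d(2) onto2 by (auto simp: mult_LZ_def)
      then show "y \<in> \<gamma> ` carrier mult_LZ" by blast
    qed
  qed

  have "\<gamma> (\<iota>2 (?CT +>\<^bsub>F\<^esub> t)) = \<pi> t" if "t \<in> T \<inter> ?F'" for t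
    using that by (simp only: \<iota>2(2) \<gamma>(2))
  moreover have "\<beta> (\<iota>1 (?CR +>\<^bsub>F\<^esub> r)) = \<iota>2 (?CT +>\<^bsub>F\<^esub> r)" if r: "r \<in> R \<inter> ?F'" for r
  proof -
    have "r \<in> T \<inter> ?F'" using r RT by blast
    then show ?thesis by (simp only: \<iota>1(2)[OF r] \<iota>2(2) \<beta>(2)[OF r])
  qed
  moreover have "\<theta> (pure_tensor K ab ZV (?g f) (\<pi> t), \<zero>\<^bsub>?D2\<^esub>) = \<iota>1 (?CR +>\<^bsub>F\<^esub> (f \<otimes>\<^bsub>F\<^esub> t)) \<and>
      \<theta> (\<zero>\<^bsub>?D1\<^esub>, pure_tensor K ZV ab (\<pi> t) (?g f)) = \<iota>1 (?CR +>\<^bsub>F\<^esub> (t \<otimes>\<^bsub>F\<^esub> f))"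
    if "f \<in> carrier F" "t \<in> T" for f t
    using \<theta>_pure[OF that] \<iota>1(2)[OF prodRF(1)[OF that]] \<iota>1(2)[OF prodRF(2)[OF that]] by simp
  ultimately show ?thesis
    using \<iota>1(1) \<iota>2(1) \<theta> \<beta>(1) \<gamma>(1) exact_mult_L exact_mult_LZ onto_L'_Z
    by (intro exI[of _ \<iota>1] exI[of _ \<iota>2] exI[of _ \<theta>] exI[of _ \<beta>] exI[of _ \<gamma>] conjI ballI) simp_all
qed

end
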